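(* Let $X(\mathbb{Z})$ be a reflexive rearrangement-invariant Banach sequence space with nontrivial Boyd indices $\alpha_X,\beta_X$ (that is, $0<\alpha_X$ and $\beta_X<1$) and let $w\in A_{1/\alpha_X}^{\rm sym}(\mathbb{Z})\cap A_{1/\beta_X}^{\rm sym}(\mathbb{Z})$. Then both sets \[ C_{X(\mathbb{Z},w)}+H_{X(\mathbb{Z},w)}^{\infty,+} \quad\text{and}\quad C_{X(\mathbb{Z},w)}+H_{X(\mathbb{Z},w)}^{\infty,-} \] are closed subalgebras of the Banach algebra $M_{X(\mathbb{Z},w)}$.
   Context: **Banach sequence spaces.** Let $\mathbb{S}\in\{\mathbb{N},\mathbb{Z}\}$ carry the counting measure $m$. Let $\ell^0(\mathbb{S})$ be the set of all sequences $f:\mathbb{S}\to\mathbb{C}$ and $\ell^0_+(\mathbb{S})$ its cone of nonnegative sequences. A Banach function norm is a map $\varrho:\ell^0_+(\mathbb{S})\to[0,\infty]$ such that for all $f,g,f^{(n)}\in\ell_+^0(\mathbb{S})$ ($n\in\mathbb{N}$), all finite $E\subset\mathbb{S}$ and all constants $\alpha\ge0$: (A1) $\varrho(f)=0\Leftrightarrow f=0$, $\varrho(\alpha f)=\alpha\varrho(f)$, $\varrho(f+g)\le\varrho(f)+\varrho(g)$; (A2) $0\le g\le f\Rightarrow\varrho(g)\le\varrho(f)$; (A3) $0\le f^{(n)}\uparrow f\Rightarrow\varrho(f^{(n)})\uparrow\varrho(f)$; (A4) $\varrho(\chi_E)<\infty$; (A5) $\sum_{k\in E}f_k\le C_E\varrho(f)$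 with $C_E\in(0,\infty)$ independent of $f$. The Banach sequence space $X(\mathbb{S})$ generated by $\varrho$ is $\{f\in\ell^0(\mathbb{S}):\varrho(|f|)<\infty\}$ with norm $\|f\|_{X(\mathbb{S})}=\varrho(|f|)$. **Rearrangement-invariance.** For $f\in\ell^0(\mathbb{S})$ put $d_f(\lambda)=m\{k\in\mathbb{S}:|f_k|>\lambda\}$, $\lambda\ge0$, and $f^*(n)=\inf\{\lambda\ge0:d_f(\lambda)\le n-1\}$, $n\in\mathbb{N}$. $\varrho$ and $X(\mathbb{S})$ are rearrangement-invariant if $\varrho(f)=\varrho(g)$ whenever $f,g\in\ell^0_+(\mathbb{S})$ and $d_f=d_g$. **Boyd indices.** If $X(\mathbb{Z})$ is rearrangement-invariant, generated by $\varrho$, there is a unique rearrangement-invariant Banach function norm $\overline\varrho:\ell_+^0(\mathbb{N})\to[0,\infty]$ with $\varrho(f)=\overline\varrho(f^* )$ for $f\in\ell_+^0(\mathbb{Z})$ (Luxemburg representation); let $\overline X(\mathbb{N})$ be the space it generates (with $\overline\varrho(f)$ meaning $\overline\varrho(|f|)$ for $f\in\overline X(\mathbb{N})$). For $f:\mathbb{N}\to[0,\infty)$ and $j,k\in\mathbb{N}$ let $(E_jf)_k=f_{jk}$ and $(F_jf)_k=f_{\lfloor(k-1)/j\rfloor+1}$. Put $H(j,X)=\sup\{\overline\varrho(E_jf^* ):f\in\overline X(\mathbb{N}),\overline\varrho(f)\le1\}$ and $K(j,X)=\sup\{\overline\varrho(F_jf^* ):f\in\overline X(\mathbb{N}),\overline\varrho(f)\le1\}$.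 The lower and upper Boyd indices are the (existing) limits $\alpha_X=\lim_{j\to\infty}\frac{-\log H(j,X)}{\log j}$ and $\beta_X=\lim_{j\to\infty}\frac{\log K(j,X)}{\log j}$; they satisfy $0\le\alpha_X\le\beta_X\le1$. **Weights.** A weight on $\mathbb{Z}$ is a sequence $w=\{w_k\}_{k\in\mathbb{Z}}$ of positive numbers. For $1<p<\infty$, $1/p+1/q=1$, $w\in A_p(\mathbb{Z})$ means \[\sup_J\frac1{m(J)}\Big(\sum_{k\in J}w_k^p\Big)^{1/p}\Big(\sum_{k\in J}w_k^{-q}\Big)^{1/q}<\infty,\] the supremum over all intervals $J=\{l,\dots,n\}$, $l\le n$, of $\mathbb{Z}$. $A_p^{\rm sym}(\mathbb{Z})$ is the set of $w\in A_p(\mathbb{Z})$ with $w_{-k}=w_k$ for all $k$. The weighted space is $X(\mathbb{Z},w)=\{f:fw\in X(\mathbb{Z})\}$ with $\|f\|_{X(\mathbb{Z},w)}=\|fw\|_{X(\mathbb{Z})}$, where $fw=\{f_kw_k\}$; it is a Banach sequence space. **Multipliers.** $\mathcal{P}$ is the space of infinitely differentiable $2\pi$-periodic functions $\mathbb{R}\to\mathbb{C}$ with its usual Fréchet topology (seminorms $\sup|D^{k}u|$, $k\ge0$), and $\mathcal{P}'$ is the space of continuous linear functionals on $\mathcal{P}$ (periodic distributions). For $a\in\mathcal{P}'$, $\widehat a(n)=a(E_{-n})$, where $E_n(\theta)=e^{in\theta}$, $n\in\mathbb{Z}$. A $2\pi$-periodic function $a$ integrable on $(-\pi,\pi)$ is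 identified with the distribution $u\mapsto\frac1{2\pi}\int_{-\pi}^{\pi}a(\theta)u(\theta)\,d\theta$. Let $S_0(\mathbb{Z})$ be the set of finitely supported sequences. For $a\in\mathcal{P}'$, $\varphi\in S_0(\mathbb{Z})$, put $(a*\varphi)_j=\sum_{k\in\mathbb{Z}}\widehat a(j-k)\varphi_k$. For a Banach sequence space $Y(\mathbb{Z})$, $M_{Y(\mathbb{Z})}$ is the set of $a\in\mathcal{P}'$ with $a*\varphi\in Y(\mathbb{Z})$ for all $\varphi\in S_0(\mathbb{Z})$ and \[\|a\|_{M_{Y(\mathbb{Z})}}=\sup\{\|a*\varphi\|_{Y(\mathbb{Z})}/\|\varphi\|_{Y(\mathbb{Z})}:\varphi\in S_0(\mathbb{Z}),\varphi\ne0\}<\infty.\] Under the hypotheses of the claim, every element of $M_{X(\mathbb{Z},w)}$ is a function in $L^\infty(-\pi,\pi)$ (essentially bounded $2\pi$-periodic functions), $M_{X(\mathbb{Z},w)}$ is a Banach algebra under pointwise multiplication and the norm $\|a\|_{M_{X(\mathbb{Z},w)}}=\sup\{\|a*\varphi\|_{X(\mathbb{Z},w)}/\|\varphi\|_{X(\mathbb{Z},w)}:\varphi\in S_0(\mathbb{Z}),\varphi\ne0\}$, and every $2\pi$-periodic function of bounded variation, in particular every trigonometric polynomial, belongs to $M_{X(\mathbb{Z},w)}$. **The subspaces.** $\mathcal{TP}$ is the set of trigonometric polynomials $p(\theta)=\sum_{|k|\le n}c_ke^{ik\theta}$ with $n\in\{0,1,2,\dots\}$ and $c_k\in\mathbb{C}$.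 $C_{X(\mathbb{Z},w)}$ is the closure of $\mathcal{TP}$ in the norm of $M_{X(\mathbb{Z},w)}$. Finally, \[H_{X(\mathbb{Z},w)}^{\infty,\pm}=\{a\in M_{X(\mathbb{Z},w)}:\widehat a(\pm n)=0\text{ for all integers }n<0\}.\] *)

theory Defs
  imports "HOL-Analysis.Analysis" "HOL-Library.Function_Algebras" "HOL-Library.Set_Algebras"
begin

section \<open>Banach sequence spaces\<close>

text \<open>
  The index type \<open>'s\<close> is instantiated by \<^typ>\<open>int\<close> and \<^typ>\<open>nat\<close>.  The index set
  $\{1,2,\dots\}$ is represented by the type \<^typ>\<open>nat\<close>, where \<open>k\<close> stands for the usual index
  $k+1$; all formulas for sequences on \<^typ>\<open>nat\<close> below are shifted accordingly.
  A function norm is defined on the cone of nonnegative real sequences; its values at other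
  real sequences are irrelevant.
\<close>

definition banach_function_norm :: "(('s \<Rightarrow> real) \<Rightarrow> ennreal) \<Rightarrow> bool" where
  "banach_function_norm \<rho> \<longleftrightarrow>
     (\<forall>f. (\<forall>k. 0 \<le> f k) \<longrightarrow> (\<rho> f = 0 \<longleftrightarrow> (\<forall>k. f k = 0))) \<and>
     (\<forall>f c. (\<forall>k. 0 \<le> f k) \<longrightarrow> 0 \<le> c \<longrightarrow> \<rho> (\<lambda>k. c * f k) = ennreal c * \<rho> f) \<and>
     (\<forall>f g. (\<forall>k. 0 \<le> f k) \<longrightarrow> (\<forall>k. 0 \<le> g k) \<longrightarrow> \<rho> (\<lambda>k. f k + g k) \<le> \<rho> f + \<rho> g) \<and>
     (\<forall>f g. (\<forall>k. 0 \<le> g k \<and> g k \<le> f k) \<longrightarrow> \<rho> g \<le> \<rho> f) \<and>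
     (\<forall>F f. (\<forall>n k. 0 \<le> F n k) \<longrightarrow> (\<forall>k. incseq (\<lambda>n. F n k)) \<longrightarrow>
        (\<forall>k. (\<lambda>n::nat. F n k) \<longlonglongrightarrow> f k) \<longrightarrow>
        incseq (\<lambda>n. \<rho> (F n)) \<and> (\<lambda>n. \<rho> (F n)) \<longlonglongrightarrow> \<rho> f) \<and>
     (\<forall>E. finite E \<longrightarrow> \<rho> (indicator E) < \<infinity>) \<and>
     (\<forall>E. finite E \<longrightarrow>
        (\<exists>C>0. \<forall>f. (\<forall>k. 0 \<le> f k) \<longrightarrow> ennreal (\<Sum>k\<in>E. f k) \<le> ennreal C * \<rho> f))"

definition seq_norm :: "(('s \<Rightarrow> real) \<Rightarrow> ennreal) \<Rightarrow> ('s \<Rightarrow> complex) \<Rightarrow> ennreal" where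
  "seq_norm \<rho> f = \<rho> (\<lambda>k. cmod (f k))"

definition seq_space :: "(('s \<Rightarrow> real) \<Rightarrow> ennreal) \<Rightarrow> ('s \<Rightarrow> complex) set" where
  "seq_space \<rho> = {f. seq_norm \<rho> f < \<infinity>}"

section \<open>Reflexivity\<close>

text \<open>
  A normed space is given by a linear space \<open>V\<close> of complex functions and a norm \<open>N\<close>.  A bounded
  linear functional on \<open>V\<close> is extended by \<open>0\<close> outside \<open>V\<close>, so that functionals that agree on \<open>V\<close>
  are equal.  The dual is again a linear space of complex functions, and so the construction can
  be iterated.
\<close>

definition dual_space ::
    "('a \<Rightarrow> complex) set \<Rightarrow> (('a \<Rightarrow> complex) \<Rightarrow> real) \<Rightarrow> (('a \<Rightarrow> complex) \<Rightarrow> complex) set" where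
  "dual_space V N = {\<phi>.
     (\<forall>f\<in>V. \<forall>g\<in>V. \<phi> (\<lambda>x. f x + g x) = \<phi> f + \<phi> g) \<and>
     (\<forall>c. \<forall>f\<in>V. \<phi> (\<lambda>x. c * f x) = c * \<phi> f) \<and>
     (\<exists>C. \<forall>f\<in>V. cmod (\<phi> f) \<le> C * N f) \<and>
     (\<forall>f. f \<notin> V \<longrightarrow> \<phi> f = 0)}"

definition dual_norm ::
    "('a \<Rightarrow> complex) set \<Rightarrow> (('a \<Rightarrow> complex) \<Rightarrow> real) \<Rightarrow> (('a \<Rightarrow> complex) \<Rightarrow> complex) \<Rightarrow> real" where
  "dual_norm V N \<phi> = (SUP f\<in>{f\<in>V. N f \<le> 1}. cmod (\<phi> f))"

text \<open>Surjectivity of the canonical embedding into the bidual.\<close>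

definition reflexive_space :: "('a \<Rightarrow> complex) set \<Rightarrow> (('a \<Rightarrow> complex) \<Rightarrow> real) \<Rightarrow> bool" where
  "reflexive_space V N \<longleftrightarrow>
     (\<forall>\<Phi> \<in> dual_space (dual_space V N) (dual_norm V N).
        \<exists>f\<in>V. \<forall>\<phi> \<in> dual_space V N. \<Phi> \<phi> = \<phi> f)"

definition reflexive_norm :: "(('s \<Rightarrow> real) \<Rightarrow> ennreal) \<Rightarrow> bool" where
  "reflexive_norm \<rho> \<longleftrightarrow> reflexive_space (seq_space \<rho>) (\<lambda>f. enn2real (seq_norm \<rho> f))"

section \<open>Rearrangement-invariance and Boyd indices\<close>

definition distribution_fun :: "('s \<Rightarrow> 'b::real_normed_vector) \<Rightarrow> real \<Rightarrow> ennreal" where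
  "distribution_fun f s = emeasure (count_space UNIV) {k. norm (f k) > s}"

text \<open>
  With the index shift, \<open>rearrangement f n\<close> is $f^*(n+1)$.  For unbounded \<open>f\<close> the infimum is taken
  over the empty set, $f^*$ is identically infinite, and the real number
  \<open>rearrangement f n\<close> is meaningless.
\<close>

definition rearrangement :: "('s \<Rightarrow> 'b::real_normed_vector) \<Rightarrow> nat \<Rightarrow> real" where
  "rearrangement f n = Inf {s. 0 \<le> s \<and> distribution_fun f s \<le> of_nat n}"

definition rearrangement_invariant :: "(('s \<Rightarrow> real) \<Rightarrow> ennreal) \<Rightarrow> bool" where
  "rearrangement_invariant \<rho> \<longleftrightarrow>
     (\<forall>f g. (\<forall>k. 0 \<le> f k) \<longrightarrow> (\<forall>k. 0 \<le> g k) \<longrightarrow>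
        (\<forall>s\<ge>0. distribution_fun f s = distribution_fun g s) \<longrightarrow> \<rho> f = \<rho> g)"

text \<open>
  The case distinction implements the convention that a function norm is infinite at a sequence
  taking the value infinity.
\<close>

definition luxemburg_rep ::
    "((int \<Rightarrow> real) \<Rightarrow> ennreal) \<Rightarrow> ((nat \<Rightarrow> real) \<Rightarrow> ennreal) \<Rightarrow> bool" where
  "luxemburg_rep \<rho> \<sigma> \<longleftrightarrow>
     banach_function_norm \<sigma> \<and> rearrangement_invariant \<sigma> \<and>
     (\<forall>f. (\<forall>k. 0 \<le> f k) \<longrightarrow>
        \<rho> f = (if bounded (range f) then \<sigma> (rearrangement f) else \<infinity>))"

text \<open>
  The Luxemburg representation is uniquely determined on the cone of nonnegative sequences, and
  only its values there are used.
\<close>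

definition luxemburg_norm :: "((int \<Rightarrow> real) \<Rightarrow> ennreal) \<Rightarrow> (nat \<Rightarrow> real) \<Rightarrow> ennreal" where
  "luxemburg_norm \<rho> = (SOME \<sigma>. luxemburg_rep \<rho> \<sigma>)"

text \<open>
  In terms of indices starting at $1$, $(E_jf)_k=f_{jk}$ and
  $(F_jf)_k=f_{\lfloor(k-1)/j\rfloor+1}$, for $j \ge 1$.
\<close>

definition dilation_E :: "nat \<Rightarrow> (nat \<Rightarrow> real) \<Rightarrow> nat \<Rightarrow> real" where
  "dilation_E j f k = f (j * (k + 1) - 1)"

definition dilation_F :: "nat \<Rightarrow> (nat \<Rightarrow> real) \<Rightarrow> nat \<Rightarrow> real" where
  "dilation_F j f k = f (k div j)"

definition boyd_H :: "((int \<Rightarrow> real) \<Rightarrow> ennreal) \<Rightarrow> nat \<Rightarrow> ennreal" where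
  "boyd_H \<rho> j =
     (SUP f\<in>{f \<in> seq_space (luxemburg_norm \<rho>). seq_norm (luxemburg_norm \<rho>) f \<le> 1}.
        luxemburg_norm \<rho> (dilation_E j (rearrangement f)))"

definition boyd_K :: "((int \<Rightarrow> real) \<Rightarrow> ennreal) \<Rightarrow> nat \<Rightarrow> ennreal" where
  "boyd_K \<rho> j =
     (SUP f\<in>{f \<in> seq_space (luxemburg_norm \<rho>). seq_norm (luxemburg_norm \<rho>) f \<le> 1}.
        luxemburg_norm \<rho> (dilation_F j (rearrangement f)))"

definition lower_boyd_index :: "((int \<Rightarrow> real) \<Rightarrow> ennreal) \<Rightarrow> real" where
  "lower_boyd_index \<rho> = lim (\<lambda>j. - ln (enn2real (boyd_H \<rho> j)) / ln (real j))"

definition upper_boyd_index :: "((int \<Rightarrow> real) \<Rightarrow> ennreal) \<Rightarrow> real" where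
  "upper_boyd_index \<rho> = lim (\<lambda>j. ln (enn2real (boyd_K \<rho> j)) / ln (real j))"

section \<open>Weights\<close>

text \<open>The exponent \<open>q = p / (p - 1)\<close> is the conjugate exponent; only $1 < p < \infty$ is meaningful.\<close>

definition muckenhoupt :: "real \<Rightarrow> (int \<Rightarrow> real) set" where
  "muckenhoupt p = {w. (\<forall>k. 0 < w k) \<and>
     (let q = p / (p - 1) in
      bdd_above {1 / real (card {l..n}) *
          (\<Sum>k=l..n. w k powr p) powr (1 / p) *
          (\<Sum>k=l..n. w k powr (- q)) powr (1 / q) | l n. l \<le> n})}"

definition muckenhoupt_sym :: "real \<Rightarrow> (int \<Rightarrow> real) set" where
  "muckenhoupt_sym p = {w \<in> muckenhoupt p. \<forall>k. w (- k) = w k}"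

text \<open>
  The norm generating the weighted space; see lemmas \<open>seq_norm_weighted\<close> and
  \<open>seq_space_weighted\<close>.
\<close>

definition weighted :: "(('s \<Rightarrow> real) \<Rightarrow> ennreal) \<Rightarrow> ('s \<Rightarrow> real) \<Rightarrow> ('s \<Rightarrow> real) \<Rightarrow> ennreal" where
  "weighted \<rho> w f = \<rho> (\<lambda>k. f k * w k)"

lemma seq_norm_weighted:
  assumes "\<And>k. 0 < w k"
  shows "seq_norm (weighted \<rho> w) f = seq_norm \<rho> (\<lambda>k. f k * complex_of_real (w k))"
  using assms by (simp add: seq_norm_def weighted_def norm_mult less_imp_le)

lemma seq_space_weighted:
  assumes "\<And>k. 0 < w k"
  shows "seq_space (weighted \<rho> w) = {f. (\<lambda>k. f k * complex_of_real (w k)) \<in> seq_space \<rho>}"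
  using assms by (simp add: seq_space_def seq_norm_weighted)

section \<open>Periodic distributions\<close>

definition vderiv :: "(real \<Rightarrow> complex) \<Rightarrow> real \<Rightarrow> complex" where
  "vderiv u = (\<lambda>t. vector_derivative u (at t))"

definition periodic_smooth :: "(real \<Rightarrow> complex) set" where
  "periodic_smooth = {u. (\<forall>t. u (t + 2 * pi) = u t) \<and>
     (\<forall>k t. ((vderiv ^^ k) u) differentiable (at t))}"

definition smooth_seminorm :: "nat \<Rightarrow> (real \<Rightarrow> complex) \<Rightarrow> real" where
  "smooth_seminorm k u = (SUP t. cmod ((vderiv ^^ k) u t))"

definition periodic_smooth_topology :: "(real \<Rightarrow> complex) topology" where
  "periodic_smooth_topology = topology_generated_by
     {{v \<in> periodic_smooth. smooth_seminorm k (\<lambda>t. v t - u t) < \<epsilon>} | k u \<epsilon>.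
        u \<in> periodic_smooth \<and> 0 < \<epsilon>}"

text \<open>
  As for dual spaces, functionals are extended by \<open>0\<close> outside their domain; the linear operations
  on distributions are the pointwise ones.
\<close>

definition periodic_distributions :: "((real \<Rightarrow> complex) \<Rightarrow> complex) set" where
  "periodic_distributions = {a.
     (\<forall>u\<in>periodic_smooth. \<forall>v\<in>periodic_smooth. a (\<lambda>t. u t + v t) = a u + a v) \<and>
     (\<forall>c. \<forall>u\<in>periodic_smooth. a (\<lambda>t. c * u t) = c * a u) \<and>
     continuous_map periodic_smooth_topology euclidean a \<and>
     (\<forall>u. u \<notin> periodic_smooth \<longrightarrow> a u = 0)}"

definition fourier_coeff :: "((real \<Rightarrow> complex) \<Rightarrow> complex) \<Rightarrow> int \<Rightarrow> complex" where
  "fourier_coeff a n = a (\<lambda>\<theta>. cis (of_int (- n) * \<theta>))"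

definition distr_of :: "(real \<Rightarrow> complex) \<Rightarrow> (real \<Rightarrow> complex) \<Rightarrow> complex" where
  "distr_of f u =
     (if u \<in> periodic_smooth
      then complex_of_real (1 / (2 * pi)) * (LINT \<theta>:{-pi<..<pi}|lebesgue. f \<theta> * u \<theta>)
      else 0)"

definition periodic_Linf :: "(real \<Rightarrow> complex) set" where
  "periodic_Linf = {f. f \<in> borel_measurable lebesgue \<and> (\<forall>t. f (t + 2 * pi) = f t) \<and>
     (\<exists>C. AE t in lebesgue. cmod (f t) \<le> C)}"

text \<open>
  Pointwise product of two distributions that are given by essentially bounded functions.  It does
  not depend on the chosen representatives, which are unique up to null sets.
\<close>

definition symbol_fun :: "((real \<Rightarrow> complex) \<Rightarrow> complex) \<Rightarrow> real \<Rightarrow> complex" where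
  "symbol_fun a = (SOME f. f \<in> periodic_Linf \<and> distr_of f = a)"

definition distr_mult ::
    "((real \<Rightarrow> complex) \<Rightarrow> complex) \<Rightarrow> ((real \<Rightarrow> complex) \<Rightarrow> complex) \<Rightarrow> (real \<Rightarrow> complex) \<Rightarrow> complex" where
  "distr_mult a b = distr_of (\<lambda>\<theta>. symbol_fun a \<theta> * symbol_fun b \<theta>)"

section \<open>Multipliers\<close>

definition fin_supp_seqs :: "(int \<Rightarrow> complex) set" where
  "fin_supp_seqs = {\<phi>. finite {k. \<phi> k \<noteq> 0}}"

definition distr_conv ::
    "((real \<Rightarrow> complex) \<Rightarrow> complex) \<Rightarrow> (int \<Rightarrow> complex) \<Rightarrow> int \<Rightarrow> complex" where
  "distr_conv a \<phi> j = (\<Sum>k | \<phi> k \<noteq> 0. fourier_coeff a (j - k) * \<phi> k)"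

definition multiplier_norm ::
    "((int \<Rightarrow> real) \<Rightarrow> ennreal) \<Rightarrow> ((real \<Rightarrow> complex) \<Rightarrow> complex) \<Rightarrow> ennreal" where
  "multiplier_norm \<rho> a =
     (SUP \<phi> \<in> fin_supp_seqs - {0}. seq_norm \<rho> (distr_conv a \<phi>) / seq_norm \<rho> \<phi>)"

definition multipliers :: "((int \<Rightarrow> real) \<Rightarrow> ennreal) \<Rightarrow> ((real \<Rightarrow> complex) \<Rightarrow> complex) set" where
  "multipliers \<rho> = {a \<in> periodic_distributions.
     (\<forall>\<phi>\<in>fin_supp_seqs. distr_conv a \<phi> \<in> seq_space \<rho>) \<and> multiplier_norm \<rho> a < \<infinity>}"

definition multiplier_closure ::
    "((int \<Rightarrow> real) \<Rightarrow> ennreal) \<Rightarrow> ((real \<Rightarrow> complex) \<Rightarrow> complex) set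
      \<Rightarrow> ((real \<Rightarrow> complex) \<Rightarrow> complex) set" where
  "multiplier_closure \<rho> A =
     {a \<in> multipliers \<rho>. \<forall>\<epsilon>>0. \<exists>b\<in>A. multiplier_norm \<rho> (a - b) < ennreal \<epsilon>}"

definition trig_polys :: "(real \<Rightarrow> complex) set" where
  "trig_polys =
     {(\<lambda>\<theta>. \<Sum>k = - int n..int n. c k * cis (of_int k * \<theta>)) | (n::nat) (c::int \<Rightarrow> complex). True}"

definition C_multipliers :: "((int \<Rightarrow> real) \<Rightarrow> ennreal) \<Rightarrow> ((real \<Rightarrow> complex) \<Rightarrow> complex) set" where
  "C_multipliers \<rho> = multiplier_closure \<rho> (distr_of ` trig_polys)"

definition Hinf_plus :: "((int \<Rightarrow> real) \<Rightarrow> ennreal) \<Rightarrow> ((real \<Rightarrow> complex) \<Rightarrow> complex) set" where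
  "Hinf_plus \<rho> = {a \<in> multipliers \<rho>. \<forall>n<0. fourier_coeff a n = 0}"

definition Hinf_minus :: "((int \<Rightarrow> real) \<Rightarrow> ennreal) \<Rightarrow> ((real \<Rightarrow> complex) \<Rightarrow> complex) set" where
  "Hinf_minus \<rho> = {a \<in> multipliers \<rho>. \<forall>n<0. fourier_coeff a (- n) = 0}"

definition closed_subalgebra ::
    "((int \<Rightarrow> real) \<Rightarrow> ennreal) \<Rightarrow> ((real \<Rightarrow> complex) \<Rightarrow> complex) set \<Rightarrow> bool" where
  "closed_subalgebra \<rho> S \<longleftrightarrow>
     S \<subseteq> multipliers \<rho> \<and>
     0 \<in> S \<and>
     (\<forall>a\<in>S. \<forall>b\<in>S. a + b \<in> S) \<and>
     (\<forall>c. \<forall>a\<in>S. (\<lambda>u. c * a u) \<in> S) \<and>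
     (\<forall>a\<in>S. \<forall>b\<in>S. distr_mult a b \<in> S) \<and>
     multiplier_closure \<rho> S \<subseteq> S"

end

theory Submission
  imports Defs
begin

text \<open>
  A multiplier is determined by its Fourier coefficients $c$, and its norm is the norm of the
  convolution with $c$ on finitely supported sequences.  Only three properties of the weighted norm
  matter: it is a Banach function norm, it is invariant under $k \mapsto -k$, and the shift is
  bounded.  The last one follows from $w \in A_p$ with $p = 1/\beta_X \in (1,\infty)$, since
  $0 < \alpha_X \le \beta_X < 1$.

  The Fejer means $\sigma_n$ are contractions of the multiplier norm.  If $x = q + h$ with a
  trigonometric polynomial $q$ and $h \in H^{\infty,\pm}$, then $\sigma_n x + (q - \sigma_n q)$ is
  a trigonometric polynomial that differs from $x$ by an element of $H^{\infty,\pm}$ and whose norm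
  is almost bounded by that of $x$.  Telescoping a convergent sequence of such $x$ shows that
  $C + H^{\infty,\pm}$ is exactly the closure of the polynomials plus $H^{\infty,\pm}$, an algebra.

  The reflection symmetry gives $|c_j| \le \|a\|$, and $\bar a$ has the same norm as $a$.  Applied
  to the powers of $|p|^2$ this yields $\|p\|_{L^{2n}} \le \|p\|$ for all $n$, hence
  $\|p\|_\infty \le \|p\|$ for trigonometric polynomials $p$.  The Fejer means of a multiplier are
  therefore bounded; they converge in $L^1$ to a bounded symbol, and the coefficients of a product of
  two symbols are limits of convolutions.
\<close>

subsection \<open>Convolution\<close>

text \<open>The main obstacle is closedness, because a sum of two closed subspaces need not be
  closed. Here every polynomial plus a one-sided multiplier is congruent, modulo one-sided
  multipliers, to a polynomial of almost the same norm; passing to the quotient therefore costs no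
  constant that could accumulate in a series. This is the mechanism of Rudin's proof that H^infinity
  + C is closed. The second obstacle is the product. The sequence a * phi leaves the finitely
  supported sequences, so two convolutions cannot simply be composed. Fejer means of the second
  factor keep every convolution finite, and the Fatou property carries norm bounds to
  coefficientwise limits. Bounded symbols are needed at three places: a limit of coefficient
  sequences has to be realised by a distribution, the product is defined through symbols, and the
  approximants of two factors must have a product of their own.\<close>

definition conv :: "(int \<Rightarrow> complex) \<Rightarrow> (int \<Rightarrow> complex) \<Rightarrow> int \<Rightarrow> complex" where
  "conv c \<phi> j = (\<Sum>k | \<phi> k \<noteq> 0. c (j - k) * \<phi> k)"

abbreviation finsupp :: "(int \<Rightarrow> complex) \<Rightarrow> bool" where
  "finsupp c \<equiv> finite {k. c k \<noteq> 0}"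

definition unit_seq :: "int \<Rightarrow> int \<Rightarrow> complex" where
  "unit_seq m k = (if k = m then 1 else 0)"

lemma conv_eq_sum:
  assumes "finite A" "{k. \<phi> k \<noteq> 0} \<subseteq> A"
  shows "conv c \<phi> j = (\<Sum>k\<in>A. c (j - k) * \<phi> k)"
  unfolding conv_def by (rule sum.mono_neutral_left) (use assms in auto)

lemma conv_add_left: "conv (c + d) \<phi> = conv c \<phi> + conv d \<phi>"
  by (auto simp: conv_def fun_eq_iff algebra_simps sum.distrib)

lemma conv_diff_left: "conv (c - d) \<phi> = conv c \<phi> - conv d \<phi>"
  by (auto simp: conv_def fun_eq_iff algebra_simps sum_subtractf)

lemma conv_scale_left: "conv (\<lambda>k. z * c k) \<phi> = (\<lambda>j. z * conv c \<phi> j)"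
  by (auto simp: conv_def fun_eq_iff sum_distrib_left algebra_simps)

lemma finsupp_add: "finsupp c \<Longrightarrow> finsupp d \<Longrightarrow> finsupp (c + d)"
  by (rule finite_subset[of _ "{k. c k \<noteq> 0} \<union> {k. d k \<noteq> 0}"]) auto

lemma finsupp_diff: "finsupp c \<Longrightarrow> finsupp d \<Longrightarrow> finsupp (c - d)"
  by (rule finite_subset[of _ "{k. c k \<noteq> 0} \<union> {k. d k \<noteq> 0}"]) auto

lemma conv_diff_right:
  assumes "finsupp \<phi>" "finsupp \<psi>"
  shows "conv c (\<phi> - \<psi>) = conv c \<phi> - conv c \<psi>"
proof
  fix j
  let ?A = "{k. \<phi> k \<noteq> 0} \<union> {k. \<psi> k \<noteq> 0}"
  have A: "finite ?A" using assms by auto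
  have "conv c \<phi> j = (\<Sum>k\<in>?A. c (j - k) * \<phi> k)" "conv c \<psi> j = (\<Sum>k\<in>?A. c (j - k) * \<psi> k)"
    "conv c (\<phi> - \<psi>) j = (\<Sum>k\<in>?A. c (j - k) * (\<phi> - \<psi>) k)"
    by (rule conv_eq_sum[OF A]; auto)+
  then show "conv c (\<phi> - \<psi>) j = (conv c \<phi> - conv c \<psi>) j"
    by (simp add: sum_subtractf[symmetric] algebra_simps)
qed

lemma conv_supp:
  assumes "conv c \<phi> j \<noteq> 0"
  obtains k where "c (j - k) \<noteq> 0" "\<phi> k \<noteq> 0"
  using assms unfolding conv_def by (metis (mono_tags, lifting) mem_Collect_eq mult_eq_0_iff sum.neutral)

lemma conv_supp_subset:
  "{k. conv d \<phi> k \<noteq> 0} \<subseteq> (\<lambda>(x, y). x + y) ` ({k. d k \<noteq> 0} \<times> {k. \<phi> k \<noteq> 0})"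
proof
  fix j assume "j \<in> {k. conv d \<phi> k \<noteq> 0}"
  then obtain k where "d (j - k) \<noteq> 0" "\<phi> k \<noteq> 0" by (auto elim: conv_supp)
  then show "j \<in> (\<lambda>(x, y). x + y) ` ({k. d k \<noteq> 0} \<times> {k. \<phi> k \<noteq> 0})"
    by (intro image_eqI[of _ _ "(j - k, k)"]) auto
qed

lemma finsupp_conv: "finsupp d \<Longrightarrow> finsupp \<phi> \<Longrightarrow> finsupp (conv d \<phi>)"
  by (rule finite_subset[OF conv_supp_subset]) auto

text \<open>Only d and \<phi> need finite support: all indices that occur then lie in the finite
  sumset D, and c may be arbitrary. This is what later allows an infinite c against Fejer
  means.\<close>

lemma conv_assoc:
  assumes d: "finsupp d" and \<phi>: "finsupp \<phi>"
  shows "conv c (conv d \<phi>) = conv (conv c d) \<phi>"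
proof
  fix j
  define D where "D = (\<lambda>(x, y). x + y) ` ({k. d k \<noteq> 0} \<times> {k. \<phi> k \<noteq> 0})"
  have D: "finite D" "{k. conv d \<phi> k \<noteq> 0} \<subseteq> D"
    unfolding D_def using d \<phi> conv_supp_subset by auto
  have inner: "(\<Sum>m\<in>D. c (j - m) * d (m - k)) = conv c d (j - k)" if k: "\<phi> k \<noteq> 0" for k
  proof -
    have "{i. d i \<noteq> 0} \<subseteq> (\<lambda>m. m - k) ` D"
    proof
      fix i assume "i \<in> {i. d i \<noteq> 0}"
      then show "i \<in> (\<lambda>m. m - k) ` D"
        unfolding D_def using k by (intro image_eqI[of _ _ "i + k"]) force+
    qed
    then have "conv c d (j - k) = (\<Sum>i\<in>(\<lambda>m. m - k) ` D. c (j - k - i) * d i)"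
      using D by (intro conv_eq_sum) auto
    also have "\<dots> = (\<Sum>m\<in>D. c (j - m) * d (m - k))"
      by (subst sum.reindex) (auto simp: inj_on_def)
    finally show ?thesis by simp
  qed
  have "conv c (conv d \<phi>) j = (\<Sum>m\<in>D. c (j - m) * (\<Sum>k | \<phi> k \<noteq> 0. d (m - k) * \<phi> k))"
    using D by (subst conv_eq_sum[of D]) (auto simp: conv_def)
  also have "\<dots> = (\<Sum>k | \<phi> k \<noteq> 0. \<Sum>m\<in>D. c (j - m) * d (m - k) * \<phi> k)"
    by (subst sum.swap) (simp add: sum_distrib_left mult.assoc)
  also have "\<dots> = conv (conv c d) \<phi> j"
    unfolding conv_def[of "conv c d"]
    by (intro sum.cong) (auto simp: inner sum_distrib_right[symmetric])
  finally show "conv c (conv d \<phi>) j = conv (conv c d) \<phi> j" .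
qed

lemma conv_unit_seq: "conv c (unit_seq m) j = c (j - m)"
  by (subst conv_eq_sum[of "{m}"]) (auto simp: unit_seq_def)

lemma unit_seq_conv:
  assumes "finsupp \<phi>"
  shows "conv (unit_seq m) \<phi> j = \<phi> (j - m)"
proof -
  have "conv (unit_seq m) \<phi> j = (\<Sum>k\<in>{k. \<phi> k \<noteq> 0} \<union> {j - m}. unit_seq m (j - k) * \<phi> k)"
    using assms by (intro conv_eq_sum) auto
  also have "\<dots> = (\<Sum>k\<in>{j - m}. unit_seq m (j - k) * \<phi> k)"
    using assms by (intro sum.mono_neutral_right) (auto simp: unit_seq_def)
  finally show ?thesis by (simp add: unit_seq_def)
qed

lemma conv_tendsto:
  assumes "\<And>k. (\<lambda>n. c n k) \<longlonglongrightarrow> d k"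
  shows "(\<lambda>n. conv (c n) \<phi> j) \<longlonglongrightarrow> conv d \<phi> j"
  unfolding conv_def by (intro tendsto_intros assms)

subsection \<open>Fejer means\<close>

definition fejer_coeff :: "nat \<Rightarrow> int \<Rightarrow> real" where
  "fejer_coeff n k = max 0 (1 - \<bar>of_int k\<bar> / real (n + 1))"

definition fejer :: "nat \<Rightarrow> (int \<Rightarrow> complex) \<Rightarrow> int \<Rightarrow> complex" where
  "fejer n c k = of_real (fejer_coeff n k) * c k"

lemma fejer_coeff_nonneg: "0 \<le> fejer_coeff n k"
  and fejer_coeff_le_1: "fejer_coeff n k \<le> 1"
  by (auto simp: fejer_coeff_def)

lemma fejer_coeff_mono: "n \<le> m \<Longrightarrow> fejer_coeff n k \<le> fejer_coeff m k"
  unfolding fejer_coeff_def by (intro max.mono diff_left_mono divide_left_mono) auto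

lemma fejer_coeff_ge: "fejer_coeff n k \<ge> 1 - \<bar>of_int k\<bar> / real (n + 1)"
  by (auto simp: fejer_coeff_def)

lemma fejer_coeff_eq_0: "\<bar>k\<bar> > int n \<Longrightarrow> fejer_coeff n k = 0"
  by (auto simp: fejer_coeff_def max_def field_simps)

lemma fejer_coeff_tendsto: "(\<lambda>n. fejer_coeff n k) \<longlonglongrightarrow> 1"
proof -
  have "(\<lambda>n. 1 - \<bar>of_int k\<bar> * inverse (real (Suc n))) \<longlonglongrightarrow> 1 - \<bar>of_int k\<bar> * 0"
    by (intro tendsto_intros LIMSEQ_inverse_real_of_nat)
  then have "(\<lambda>n. 1 - \<bar>of_int k\<bar> / real (n + 1)) \<longlonglongrightarrow> (1::real)"
    by (simp add: divide_inverse)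
  then show ?thesis
    by (rule tendsto_sandwich[rotated 2, OF _ tendsto_const])
      (use fejer_coeff_ge fejer_coeff_le_1 in auto)
qed

lemma fejer_tendsto: "(\<lambda>n. fejer n c k) \<longlonglongrightarrow> c k"
proof -
  have "(\<lambda>n. of_real (fejer_coeff n k) * c k) \<longlonglongrightarrow> of_real 1 * c k"
    by (intro tendsto_intros fejer_coeff_tendsto)
  then show ?thesis by (simp add: fejer_def)
qed

lemma fejer_supp: "{k. fejer n c k \<noteq> 0} \<subseteq> {- int n..int n}"
proof
  fix k assume "k \<in> {k. fejer n c k \<noteq> 0}"
  then have "\<not> \<bar>k\<bar> > int n" using fejer_coeff_eq_0 by (auto simp: fejer_def)
  then show "k \<in> {- int n..int n}" by auto
qed

lemma finsupp_fejer: "finsupp (fejer n c)"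
  using fejer_supp finite_subset by blast

lemma fejer_diff: "fejer n (c - d) = fejer n c - fejer n d"
  by (auto simp: fejer_def fun_eq_iff algebra_simps)

section \<open>The Fejer kernel averaged over roots of unity\<close>

lemma sum_cis_root_of_unity:
  fixes N :: nat and m :: int
  assumes "\<bar>m\<bar> < int N"
  shows "(\<Sum>t<N. cis (2 * pi * real t * real_of_int m / real N)) = (if m = 0 then of_nat N else 0)"
proof (cases "m = 0")
  case False
  have N: "N > 0" using assms by auto
  define z where "z = cis (2 * pi * real_of_int m / real N)"
  have z: "cis (2 * pi * real t * real_of_int m / real N) = z ^ t" for t
    unfolding z_def by (subst Complex.DeMoivre) (simp add: field_simps)
  have "z \<noteq> 1"
  proof
    assume "z = 1"
    then have "cos (2 * pi * real_of_int m / real N) = 1"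
      by (simp add: z_def complex_eq_iff)
    then obtain x :: int where "2 * pi * real_of_int m / real N = of_int x * 2 * pi"
      by (auto simp: cos_one_2pi_int)
    then have "real_of_int m = of_int x * real N"
      using N by (simp add: field_simps)
    then have "real_of_int m = real_of_int (x * int N)" by simp
    then have m: "m = x * int N" by linarith
    then have "x \<noteq> 0" using False by auto
    then have "1 * int N \<le> \<bar>x\<bar> * int N" by (intro mult_right_mono) auto
    then have "\<bar>m\<bar> \<ge> int N" using m by (simp add: abs_mult)
    then show False using assms by simp
  qed
  moreover have "z ^ N = 1"
  proof -
    have "z ^ N = cis (2 * pi * real_of_int m)"
      unfolding z_def using N by (subst Complex.DeMoivre) simp
    also have "\<dots> = 1" by (intro cis_multiple_2pi) auto
    finally show ?thesis .
  qed
  ultimately show ?thesis using False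
    by (simp add: z geometric_sum)
qed simp

text \<open>This counts the entries on one diagonal of a square of side n + 1; divided by n + 1 it
  gives the triangular Fejer weights. \<open>nat\<close> truncates to 0 once |k| exceeds n, where
  the diagonal is empty.\<close>

lemma card_diff_pairs:
  "card {(i, j). i \<le> n \<and> j \<le> n \<and> int i - int j = k} = nat (int n + 1 - \<bar>k\<bar>)"
proof -
  have "{(i, j). i \<le> n \<and> j \<le> n \<and> int i - int j = k}
      = (\<lambda>j. (nat (int j + k), j)) ` {nat (max 0 (- k))..<nat (max 0 (- k)) + nat (int n + 1 - \<bar>k\<bar>)}"
  proof (intro equalityI subsetI)
    fix x assume "x \<in> {(i, j). i \<le> n \<and> j \<le> n \<and> int i - int j = k}"
    then show "x \<in> (\<lambda>j. (nat (int j + k), j)) ` {nat (max 0 (- k))..<nat (max 0 (- k)) + nat (int n + 1 - \<bar>k\<bar>)}"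
      by (intro image_eqI[of _ _ "snd x"]) auto
  qed auto
  then show ?thesis
    by (simp add: card_image inj_on_def)
qed

text \<open>The square form makes positivity of the kernel evident; positivity is what turns the
  averages below into convex combinations.\<close>

definition fejer_kernel :: "nat \<Rightarrow> real \<Rightarrow> real" where
  "fejer_kernel n x = (cmod (\<Sum>j\<le>n. cis (real j * x)))\<^sup>2 / real (n + 1)"

text \<open>All frequencies i - j + k that arise are smaller than N in modulus, so sampling at the
  N-th roots of unity causes no aliasing and reproduces the exact coefficient. Finite averages
  replace an integral of norm-valued functions.\<close>

lemma fejer_kernel_average:
  fixes N n :: nat and k :: int
  assumes "\<bar>k\<bar> + int n < int N"
  shows "(\<Sum>t<N. of_real (fejer_kernel n (2 * pi * real t / real N)) * cis (2 * pi * real t * of_int k / real N))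
     = of_nat N * complex_of_real (fejer_coeff n k)"
proof -
  have K: "complex_of_real (fejer_kernel n x)
      = (\<Sum>(i,j)\<in>{..n}\<times>{..n}. cis ((real i - real j) * x)) / of_nat (n + 1)" for x
  proof -
    have "complex_of_real ((cmod (\<Sum>j\<le>n. cis (real j * x)))\<^sup>2)
        = (\<Sum>j\<le>n. cis (real j * x)) * cnj (\<Sum>j\<le>n. cis (real j * x))"
      by (rule complex_norm_square)
    also have "\<dots> = (\<Sum>i\<le>n. \<Sum>j\<le>n. cis ((real i - real j) * x))"
      by (simp add: sum_product cis_cnj cis_mult algebra_simps)
    finally show ?thesis
      by (simp add: fejer_kernel_def sum.cartesian_product)
  qed
  have eq: "{x \<in> {..n} \<times> {..n}. int (fst x) - int (snd x) + k = 0} = {(i, j). i \<le> n \<and> j \<le> n \<and> int i - int j = - k}"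
    by auto
  have "(\<Sum>t<N. of_real (fejer_kernel n (2 * pi * real t / real N)) * cis (2 * pi * real t * of_int k / real N))
      = (\<Sum>t<N. \<Sum>(i,j)\<in>{..n}\<times>{..n}. cis (2 * pi * real t * of_int (int i - int j + k) / real N)) / of_nat (n + 1)"
    unfolding K sum_divide_distrib sum_distrib_right
    by (intro sum.cong refl) (auto simp: cis_mult algebra_simps add_divide_distrib diff_divide_distrib)
  also have "\<dots> = (\<Sum>(i,j)\<in>{..n}\<times>{..n}. \<Sum>t<N. cis (2 * pi * real t * of_int (int i - int j + k) / real N)) / of_nat (n + 1)"
    by (subst sum.swap) (simp add: case_prod_beta)
  also have "\<dots> = (\<Sum>(i,j)\<in>{..n}\<times>{..n}. if int i - int j + k = 0 then of_nat N else 0) / of_nat (n + 1)"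
    using assms by (intro arg_cong2[of _ _ _ _ "(/)"] sum.cong refl) (auto simp del: of_int_add of_int_diff intro!: sum_cis_root_of_unity[THEN trans])
  also have "\<dots> = of_nat (card {(i, j). i \<le> n \<and> j \<le> n \<and> int i - int j = - k}) * of_nat N / of_nat (n + 1)"
    by (simp add: case_prod_beta sum.If_cases Int_def eq)
  also have "\<dots> = of_nat N * complex_of_real (fejer_coeff n k)"
  proof -
    have "real (nat (int n + 1 - \<bar>k\<bar>)) = fejer_coeff n k * real (n + 1)"
    proof (cases "\<bar>k\<bar> \<le> int n + 1")
      case True
      then have "real (nat (int n + 1 - \<bar>k\<bar>)) = real (n + 1) - \<bar>of_int k\<bar>" by simp
      moreover have "fejer_coeff n k = 1 - \<bar>of_int k\<bar> / real (n + 1)"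
      proof -
        have "real_of_int \<bar>k\<bar> \<le> real_of_int (int n + 1)" using True by (simp only: of_int_le_iff)
        then show ?thesis unfolding fejer_coeff_def by (intro max_absorb2) simp
      qed
      ultimately show ?thesis by (simp add: left_diff_distrib)
    qed (simp add: fejer_coeff_eq_0)
    then have "of_nat (nat (int n + 1 - \<bar>k\<bar>)) = complex_of_real (fejer_coeff n k * real (n + 1))"
      by (metis of_real_of_nat_eq)
    then show ?thesis
      by (simp add: card_diff_pairs del: of_nat_add of_nat_Suc)
  qed
  finally show ?thesis .
qed


subsection \<open>Banach function norms\<close>

context
  fixes \<rho> :: "('s \<Rightarrow> real) \<Rightarrow> ennreal"
  assumes \<rho>: "banach_function_norm \<rho>"
begin

lemma bfn_zero_iff: "(\<And>k. 0 \<le> f k) \<Longrightarrow> \<rho> f = 0 \<longleftrightarrow> (\<forall>k. f k = 0)"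
  using \<rho> unfolding banach_function_norm_def by (elim conjE) simp

lemma bfn_scale: "(\<And>k. 0 \<le> f k) \<Longrightarrow> 0 \<le> c \<Longrightarrow> \<rho> (\<lambda>k. c * f k) = ennreal c * \<rho> f"
  using \<rho> unfolding banach_function_norm_def by (elim conjE) simp

lemma bfn_add: "(\<And>k. 0 \<le> f k) \<Longrightarrow> (\<And>k. 0 \<le> g k) \<Longrightarrow> \<rho> (\<lambda>k. f k + g k) \<le> \<rho> f + \<rho> g"
  using \<rho> unfolding banach_function_norm_def by (elim conjE) simp

lemma bfn_mono: "(\<And>k. 0 \<le> g k) \<Longrightarrow> (\<And>k. g k \<le> f k) \<Longrightarrow> \<rho> g \<le> \<rho> f"
  using \<rho> unfolding banach_function_norm_def by (elim conjE) simp

lemma bfn_Fatou: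
  assumes "\<And>n k. 0 \<le> F n k" "\<And>k. incseq (\<lambda>n. F n k)" "\<And>k. (\<lambda>n::nat. F n k) \<longlonglongrightarrow> f k"
  shows "(\<lambda>n. \<rho> (F n)) \<longlonglongrightarrow> \<rho> f"
proof -
  have "\<forall>F f. (\<forall>n k. 0 \<le> F n k) \<longrightarrow> (\<forall>k. incseq (\<lambda>n. F n k)) \<longrightarrow>
        (\<forall>k. (\<lambda>n::nat. F n k) \<longlonglongrightarrow> f k) \<longrightarrow>
        incseq (\<lambda>n. \<rho> (F n)) \<and> (\<lambda>n. \<rho> (F n)) \<longlonglongrightarrow> \<rho> f"
    using \<rho> unfolding banach_function_norm_def by (elim conjE)
  then show ?thesis using assms by blast
qed

lemma bfn_indicator: "finite E \<Longrightarrow> \<rho> (indicator E) < \<infinity>"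
  using \<rho> unfolding banach_function_norm_def by (elim conjE) simp

lemma bfn_sum_bound:
  "finite E \<Longrightarrow> \<exists>C>0. \<forall>f. (\<forall>k. 0 \<le> f k) \<longrightarrow> ennreal (\<Sum>k\<in>E. f k) \<le> ennreal C * \<rho> f"
  using \<rho> unfolding banach_function_norm_def by (elim conjE) simp

end

lemma bfn_sum_le:
  assumes "banach_function_norm \<rho>" "finite A" "\<And>i k. i \<in> A \<Longrightarrow> 0 \<le> f i k"
  shows "\<rho> (\<lambda>k. \<Sum>i\<in>A. f i k) \<le> (\<Sum>i\<in>A. \<rho> (f i))"
  using assms(2,3)
proof (induction rule: finite_induct)
  case empty
  then show ?case using bfn_zero_iff[OF assms(1), of "\<lambda>_. 0"] by simp
next
  case (insert i A)
  have "\<rho> (\<lambda>k. \<Sum>i\<in>insert i A. f i k) \<le> \<rho> (f i) + \<rho> (\<lambda>k. \<Sum>i\<in>A. f i k)"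
    using insert by (simp add: bfn_add[OF assms(1)] sum_nonneg)
  also have "\<dots> \<le> \<rho> (f i) + (\<Sum>i\<in>A. \<rho> (f i))"
    using insert by (intro add_mono) auto
  finally show ?case using insert by simp
qed

text \<open>The Fatou axiom speaks of increasing sequences only. The infima over the tails increase,
  have the same limit and lie below g n, which removes that restriction.\<close>

lemma bfn_lim_le:
  assumes \<rho>: "banach_function_norm \<rho>" and g0: "\<And>n k. 0 \<le> g n k"
    and lim: "\<And>k. (\<lambda>n::nat. g n k) \<longlonglongrightarrow> f k" and le: "\<And>n. \<rho> (g n) \<le> K"
  shows "\<rho> f \<le> K"
proof -
  define h where "h n k = (INF m\<in>{n..}. g m k)" for n k
  have bdd: "bdd_below ((\<lambda>m. g m k) ` {n..})" for n k
    using g0 by (intro bdd_belowI[of _ 0]) auto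
  have h0: "0 \<le> h n k" for n k
    unfolding h_def using g0 by (intro cINF_greatest) auto
  have hg: "h n k \<le> g n k" for n k
    unfolding h_def using bdd by (intro cINF_lower) auto
  have inc: "incseq (\<lambda>n. h n k)" for k
    unfolding h_def by (intro monoI cINF_superset_mono bdd) auto
  have hlim: "(\<lambda>n. h n k) \<longlonglongrightarrow> f k" for k
  proof (rule LIMSEQ_I)
    fix r :: real assume "r > 0"
    then obtain N where N: "\<And>n. n \<ge> N \<Longrightarrow> \<bar>g n k - f k\<bar> < r / 2"
      using LIMSEQ_D[OF lim[of k], of "r/2"] by auto
    have "norm (h n k - f k) < r" if "n \<ge> N" for n
    proof -
      have "f k - r / 2 \<le> h n k"
        unfolding h_def
      proof (rule cINF_greatest)
        fix m assume "m \<in> {n..}"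
        then have "\<bar>g m k - f k\<bar> < r / 2" using N[of m] that by simp
        then show "f k - r / 2 \<le> g m k" by linarith
      qed simp
      moreover have "h n k < f k + r / 2" using hg[of n k] N[OF that] by linarith
      ultimately show ?thesis using \<open>r > 0\<close> by auto
    qed
    then show "\<exists>no. \<forall>n\<ge>no. norm (h n k - f k) < r" by blast
  qed
  have "(\<lambda>n. \<rho> (h n)) \<longlonglongrightarrow> \<rho> f"
    by (intro bfn_Fatou[OF \<rho>] h0 inc hlim)
  moreover have "\<rho> (h n) \<le> K" for n
    using bfn_mono[OF \<rho>, of "h n" "g n"] h0 hg le order.trans by blast
  ultimately show ?thesis by (intro LIMSEQ_le_const2) auto
qed

lemma bfn_finite_supp:
  assumes \<rho>: "banach_function_norm \<rho>" and "finite {k. f k \<noteq> 0}" "\<And>k. 0 \<le> f k"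
  shows "\<rho> f < \<infinity>"
proof -
  define S where "S = {k. f k \<noteq> 0}"
  define M where "M = (\<Sum>k\<in>S. f k)"
  have "f k \<le> M * indicator S k" for k
    using assms(2,3) unfolding M_def S_def by (auto simp: indicator_def intro!: member_le_sum)
  then have "\<rho> f \<le> \<rho> (\<lambda>k. M * indicator S k)"
    using assms(3) by (intro bfn_mono[OF \<rho>]) auto
  also have "\<dots> = ennreal M * \<rho> (indicator S)"
    by (intro bfn_scale[OF \<rho>]) (auto simp: M_def assms(3) sum_nonneg)
  also have "\<dots> < \<infinity>"
    using bfn_indicator[OF \<rho>, of S] assms(2) by (simp add: S_def ennreal_mult_less_top)
  finally show ?thesis .
qed

section \<open>Norm bounds for convolution operators\<close>

locale sequence_norm =
  fixes \<tau> :: "(int \<Rightarrow> real) \<Rightarrow> ennreal"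
  assumes bfn: "banach_function_norm \<tau>"
    and reflect: "\<And>f. (\<And>k. 0 \<le> f k) \<Longrightarrow> \<tau> (\<lambda>k. f (- k)) = \<tau> f"
    and shift: "\<exists>C\<ge>0. \<forall>f. (\<forall>k. 0 \<le> f k) \<longrightarrow> \<tau> (\<lambda>k. f (k - 1)) \<le> ennreal C * \<tau> f"
begin

text \<open>An upper bound for the operator norm, kept as a real number so that bounds can be added,
  multiplied and compared in the reals. Nonnegativity is recorded because \<open>ennreal\<close>
  sends negative numbers to 0.\<close>

definition conv_bounded :: "real \<Rightarrow> (int \<Rightarrow> complex) \<Rightarrow> bool" where
  "conv_bounded A c \<longleftrightarrow> 0 \<le> A \<and>
     (\<forall>\<phi>. finsupp \<phi> \<longrightarrow> seq_norm \<tau> (conv c \<phi>) \<le> ennreal A * seq_norm \<tau> \<phi>)"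

lemma conv_bounded_nonneg: "conv_bounded A c \<Longrightarrow> 0 \<le> A"
  by (simp add: conv_bounded_def)

lemma seq_norm_mono: "(\<And>k. cmod (f k) \<le> cmod (g k)) \<Longrightarrow> seq_norm \<tau> f \<le> seq_norm \<tau> g"
  unfolding seq_norm_def by (intro bfn_mono[OF bfn]) auto

lemma seq_norm_add: "seq_norm \<tau> (f + g) \<le> seq_norm \<tau> f + seq_norm \<tau> g"
proof -
  have "seq_norm \<tau> (f + g) \<le> \<tau> (\<lambda>k. cmod (f k) + cmod (g k))"
    unfolding seq_norm_def by (intro bfn_mono[OF bfn]) (auto intro: norm_triangle_ineq)
  also have "\<dots> \<le> seq_norm \<tau> f + seq_norm \<tau> g"
    unfolding seq_norm_def by (intro bfn_add[OF bfn]) auto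
  finally show ?thesis .
qed

lemma seq_norm_scale: "seq_norm \<tau> (\<lambda>k. z * f k) = ennreal (cmod z) * seq_norm \<tau> f"
  unfolding seq_norm_def norm_mult by (intro bfn_scale[OF bfn]) auto

lemma seq_norm_finite: "finsupp f \<Longrightarrow> seq_norm \<tau> f < \<infinity>"
  unfolding seq_norm_def by (intro bfn_finite_supp[OF bfn]) auto

lemma seq_norm_eq_0: "seq_norm \<tau> f = 0 \<longleftrightarrow> f = 0"
  unfolding seq_norm_def by (subst bfn_zero_iff[OF bfn]) (auto simp: fun_eq_iff)

lemma conv_bounded_mono: "conv_bounded A c \<Longrightarrow> A \<le> B \<Longrightarrow> conv_bounded B c"
  unfolding conv_bounded_def
  by (meson ennreal_leI mult_right_mono order.trans zero_le)

lemma conv_bounded_add: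
  assumes "conv_bounded A c" "conv_bounded B d"
  shows "conv_bounded (A + B) (c + d)"
  unfolding conv_bounded_def
proof (intro conjI allI impI)
  show "0 \<le> A + B" using assms by (auto simp: conv_bounded_def)
  fix \<phi> assume "finsupp \<phi>"
  then have "seq_norm \<tau> (conv c \<phi> + conv d \<phi>) \<le> ennreal A * seq_norm \<tau> \<phi> + ennreal B * seq_norm \<tau> \<phi>"
    using assms unfolding conv_bounded_def by (meson add_mono order.trans seq_norm_add)
  then show "seq_norm \<tau> (conv (c + d) \<phi>) \<le> ennreal (A + B) * seq_norm \<tau> \<phi>"
    using assms unfolding conv_bounded_def by (simp add: conv_add_left ennreal_plus distrib_right)
qed

lemma conv_bounded_scale:
  assumes "conv_bounded A c"
  shows "conv_bounded (cmod z * A) (\<lambda>k. z * c k)"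
  using assms unfolding conv_bounded_def conv_scale_left seq_norm_scale
  by (auto simp: ennreal_mult mult.assoc intro!: mult_left_mono)

lemma conv_bounded_diff:
  assumes "conv_bounded A c" "conv_bounded B d"
  shows "conv_bounded (A + B) (c - d)"
proof -
  have eq: "c - d = c + (\<lambda>k. - 1 * d k)" by (auto simp: fun_eq_iff)
  show ?thesis
    unfolding eq using conv_bounded_add[OF assms(1) conv_bounded_scale[OF assms(2), of "-1"]]
    by (simp only: norm_minus_cancel norm_one mult_1)
qed

lemma conv_bounded_zero: "conv_bounded 0 0"
proof -
  have "conv 0 \<phi> = 0" for \<phi> by (auto simp: conv_def fun_eq_iff)
  then show ?thesis by (simp add: conv_bounded_def seq_norm_eq_0)
qed

lemma conv_bounded_conv:
  assumes "conv_bounded A c" "conv_bounded B d" "finsupp d"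
  shows "conv_bounded (A * B) (conv c d)"
  unfolding conv_bounded_def
proof (intro conjI allI impI)
  show "0 \<le> A * B" using assms by (auto simp: conv_bounded_def)
  fix \<phi> assume \<phi>: "finsupp \<phi>"
  have "seq_norm \<tau> (conv c (conv d \<phi>)) \<le> ennreal A * seq_norm \<tau> (conv d \<phi>)"
    using assms \<phi> finsupp_conv unfolding conv_bounded_def by blast
  also have "\<dots> \<le> ennreal A * (ennreal B * seq_norm \<tau> \<phi>)"
    using assms \<phi> unfolding conv_bounded_def by (intro mult_left_mono) auto
  finally show "seq_norm \<tau> (conv (conv c d) \<phi>) \<le> ennreal (A * B) * seq_norm \<tau> \<phi>"
    using assms \<phi> by (simp add: conv_assoc conv_bounded_def ennreal_mult mult.assoc)
qed

text \<open>For fixed \<phi> the convolution is a finite sum, so coefficientwise convergence gives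
  pointwise convergence of the convolutions, and the Fatou property preserves the bound. Every limit
  below is taken in this way.\<close>

lemma conv_bounded_lim:
  assumes "\<And>n. conv_bounded A (c n)" "\<And>k. (\<lambda>n. c n k) \<longlonglongrightarrow> d k"
  shows "conv_bounded A d"
  unfolding conv_bounded_def
proof (intro conjI allI impI)
  show "0 \<le> A" using assms(1)[of 0] by (auto simp: conv_bounded_def)
  fix \<phi> assume \<phi>: "finsupp \<phi>"
  show "seq_norm \<tau> (conv d \<phi>) \<le> ennreal A * seq_norm \<tau> \<phi>"
    unfolding seq_norm_def
  proof (rule bfn_lim_le[OF bfn, where g = "\<lambda>n k. cmod (conv (c n) \<phi> k)"])
    show "(\<lambda>n. cmod (conv (c n) \<phi> k)) \<longlonglongrightarrow> cmod (conv d \<phi> k)" for k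
      by (intro tendsto_norm conv_tendsto assms(2))
    show "\<tau> (\<lambda>k. cmod (conv (c n) \<phi> k)) \<le> ennreal A * \<tau> (\<lambda>k. cmod (\<phi> k))" for n
      using assms(1)[of n] \<phi> unfolding conv_bounded_def seq_norm_def by auto
  qed auto
qed

text \<open>The entries \<open>(k + j, k)\<close> and \<open>(- k, - j - k)\<close> of the matrix of \<open>c\<close> both equal \<open>c j\<close>, and the
  reflection interchanges the two norm quotients that bound them.\<close>

lemma conv_bounded_coeff:
  assumes "conv_bounded A c"
  shows "cmod (c j) \<le> A"
proof -
  have bound: "ennreal (cmod (c j)) * seq_norm \<tau> (unit_seq (m + j)) \<le> ennreal A * seq_norm \<tau> (unit_seq m)" for m
  proof -
    have "seq_norm \<tau> (\<lambda>k. c j * unit_seq (m + j) k) \<le> seq_norm \<tau> (conv c (unit_seq m))"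
      by (intro seq_norm_mono) (auto simp: conv_unit_seq unit_seq_def)
    also have "\<dots> \<le> ennreal A * seq_norm \<tau> (unit_seq m)"
      using assms by (auto simp: conv_bounded_def unit_seq_def)
    finally show ?thesis by (simp add: seq_norm_scale)
  qed
  have refl: "seq_norm \<tau> (unit_seq (- m)) = seq_norm \<tau> (unit_seq m)" for m
  proof -
    have "(\<lambda>k. cmod (unit_seq (- m) k)) = (\<lambda>k. cmod (unit_seq m (- k)))"
      by (auto simp: fun_eq_iff unit_seq_def)
    then show ?thesis
      unfolding seq_norm_def using reflect[of "\<lambda>k. cmod (unit_seq m k)"] by simp
  qed
  define s where "s = enn2real (seq_norm \<tau> (unit_seq 0))"
  define t where "t = enn2real (seq_norm \<tau> (unit_seq j))"
  have fin: "seq_norm \<tau> (unit_seq m) < \<infinity>" for m by (intro seq_norm_finite) (simp add: unit_seq_def)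
  have nz: "seq_norm \<tau> (unit_seq m) \<noteq> 0" for m
    unfolding seq_norm_eq_0 by (auto simp: unit_seq_def fun_eq_iff)
  have st: "seq_norm \<tau> (unit_seq 0) = ennreal s" "seq_norm \<tau> (unit_seq j) = ennreal t"
    using fin by (auto simp: s_def t_def less_top)
  have pos: "0 < s" "0 < t"
    using fin[of 0] nz[of 0] fin[of j] nz[of j] by (auto simp: s_def t_def enn2real_positive_iff zero_less_iff_neq_zero)
  have A: "0 \<le> A" using assms by (rule conv_bounded_nonneg)
  have "cmod (c j) * t \<le> A * s"
    using bound[of 0] st A pos by (simp add: ennreal_mult[symmetric])
  \<comment> \<open>Testing at index - j and reflecting exchanges the roles of s and t; in the sum
    of the two inequalities the positive factor s + t cancels.\<close>
  moreover have "cmod (c j) * s \<le> A * t"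
    using bound[of "- j"] st A pos by (simp add: refl ennreal_mult[symmetric])
  ultimately have "cmod (c j) * (s + t) \<le> A * (s + t)" by (simp add: algebra_simps)
  then show ?thesis using pos by simp
qed

text \<open>The new sequence belongs to the complex conjugate symbol. Conjugation combined with the
  reflection is an isometry on sequences and intertwines the two convolutions.\<close>

lemma conv_bounded_cnj_reflect:
  assumes "conv_bounded A c"
  shows "conv_bounded A (\<lambda>k. cnj (c (- k)))"
  unfolding conv_bounded_def
proof (intro conjI allI impI)
  show "0 \<le> A" using assms by (rule conv_bounded_nonneg)
  fix \<phi> assume \<phi>: "finsupp \<phi>"
  define \<psi> where "\<psi> k = cnj (\<phi> (- k))" for k
  have supp: "{k. \<psi> k \<noteq> 0} = uminus ` {k. \<phi> k \<noteq> 0}"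
    by (force simp: \<psi>_def image_iff)
  have eq: "conv (\<lambda>k. cnj (c (- k))) \<phi> j = cnj (conv c \<psi> (- j))" for j
    unfolding conv_def supp by (subst sum.reindex) (auto simp: \<psi>_def algebra_simps intro!: sum.cong)
  have "seq_norm \<tau> (conv (\<lambda>k. cnj (c (- k))) \<phi>) = seq_norm \<tau> (conv c \<psi>)"
    unfolding seq_norm_def eq complex_mod_cnj by (rule reflect) auto
  also have "\<dots> \<le> ennreal A * seq_norm \<tau> \<psi>"
    using assms \<phi> unfolding conv_bounded_def by (simp add: supp)
  also have "seq_norm \<tau> \<psi> = seq_norm \<tau> \<phi>"
    unfolding seq_norm_def \<psi>_def complex_mod_cnj by (rule reflect) auto
  finally show "seq_norm \<tau> (conv (\<lambda>k. cnj (c (- k))) \<phi>) \<le> ennreal A * seq_norm \<tau> \<phi>" .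
qed

text \<open>On a fixed finite window the Fejer mean is a convex combination of conjugates of the
  convolution by unimodular diagonal matrices, which are isometries.\<close>

lemma conv_bounded_fejer:
  assumes "conv_bounded A c"
  shows "conv_bounded A (fejer n c)"
  unfolding conv_bounded_def
proof (intro conjI allI impI)
  show A0: "0 \<le> A" using assms by (rule conv_bounded_nonneg)
  fix \<phi> assume \<phi>: "finsupp \<phi>"
  obtain L where L: "\<And>k. \<phi> k \<noteq> 0 \<Longrightarrow> \<bar>k\<bar> \<le> int L"
  proof -
    have "\<exists>L. \<forall>k\<in>{k. \<phi> k \<noteq> 0}. nat \<bar>k\<bar> \<le> L"
      using \<phi> by (meson finite_imageI finite_nat_set_iff_bounded_le image_eqI)
    then show ?thesis using that by (metis mem_Collect_eq nat_le_iff)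
  qed
  \<comment> \<open>For |j| at most L + n and |k| at most L the difference j - k is at most 2 L + n
    in modulus, and the kernel average needs a further n below N. Beyond |j| = L + n the left side
    vanishes.\<close>
  define N where "N = 2 * L + 2 * n + 1"
  define K where "K t = fejer_kernel n (2 * pi * real t / real N)" for t
  define \<omega> where "\<omega> t k = cis (2 * pi * real t * of_int k / real N)" for t :: nat and k :: int
  have K0: "0 \<le> K t" for t by (simp add: K_def fejer_kernel_def)
  have Npos: "real N > 0" by (simp add: N_def)
  have avg: "(\<Sum>t<N. of_real (K t) * \<omega> t k) = of_nat N * complex_of_real (fejer_coeff n k)" if "\<bar>k\<bar> \<le> 2 * int L + int n" for k
    unfolding K_def \<omega>_def using that by (intro fejer_kernel_average) (auto simp: N_def)
  have sumK: "(\<Sum>t<N. K t) = real N"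
  proof -
    have "complex_of_real (\<Sum>t<N. K t) = of_real (real N)"
      using avg[of 0] by (simp add: \<omega>_def fejer_coeff_def)
    then show ?thesis using of_real_eq_iff by blast
  qed
  have \<omega>_diff: "\<omega> t (j - k) = \<omega> t j * cnj (\<omega> t k)" for t j k
    by (simp add: \<omega>_def cis_cnj cis_mult algebra_simps diff_divide_distrib)
  have \<omega>_norm: "cmod (\<omega> t k) = 1" for t k by (simp add: \<omega>_def)
  define \<psi> where "\<psi> t k = cnj (\<omega> t k) * \<phi> k" for t k
  have supp\<psi>: "{k. \<psi> t k \<noteq> 0} = {k. \<phi> k \<noteq> 0}" for t
    using \<omega>_norm by (auto simp: \<psi>_def) (metis norm_zero zero_neq_one)
  have norm\<psi>: "seq_norm \<tau> (\<psi> t) = seq_norm \<tau> \<phi>" for t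
    by (simp add: seq_norm_def \<psi>_def norm_mult \<omega>_norm)
  \<comment> \<open>The factor \<omega> t (j - k) splits into a unimodular number in j, lost when
    taking the modulus, and one in k, absorbed into \<psi>, which has the same norm as
    \<phi>.\<close>
  have dom: "cmod (conv (fejer n c) \<phi> j) \<le> (\<Sum>t<N. K t / real N * cmod (conv c (\<psi> t) j))" for j
  proof (cases "\<bar>j\<bar> \<le> int L + int n")
    case True
    have "of_nat N * conv (fejer n c) \<phi> j
       = (\<Sum>k | \<phi> k \<noteq> 0. (of_nat N * of_real (fejer_coeff n (j - k))) * (c (j - k) * \<phi> k))"
      by (simp add: conv_def sum_distrib_left fejer_def mult.assoc)
    also have "\<dots> = (\<Sum>k | \<phi> k \<noteq> 0. \<Sum>t<N. of_real (K t) * \<omega> t j * (c (j - k) * \<psi> t k))"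
    proof (intro sum.cong refl)
      fix k assume "k \<in> {k. \<phi> k \<noteq> 0}"
      then have "\<bar>k\<bar> \<le> int L" using L by auto
      then have "\<bar>j - k\<bar> \<le> 2 * int L + int n" using True by linarith
      then show "of_nat N * of_real (fejer_coeff n (j - k)) * (c (j - k) * \<phi> k)
          = (\<Sum>t<N. of_real (K t) * \<omega> t j * (c (j - k) * \<psi> t k))"
        by (subst avg[symmetric]) (simp_all add: sum_distrib_left sum_distrib_right \<omega>_diff \<psi>_def mult_ac)
    qed
    also have "\<dots> = (\<Sum>t<N. of_real (K t) * \<omega> t j * conv c (\<psi> t) j)"
      by (subst sum.swap) (simp add: conv_def supp\<psi> sum_distrib_left)
    finally have "real N * cmod (conv (fejer n c) \<phi> j) = cmod (\<Sum>t<N. of_real (K t) * \<omega> t j * conv c (\<psi> t) j)"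
      by (metis norm_mult norm_of_nat)
    also have "\<dots> \<le> (\<Sum>t<N. K t * cmod (conv c (\<psi> t) j))"
      by (intro sum_norm_le) (simp add: norm_mult \<omega>_norm K0)
    finally show ?thesis using Npos
      by (simp add: sum_divide_distrib[symmetric] field_simps)
  next
    case False
    have "conv (fejer n c) \<phi> j = 0"
    proof (rule ccontr)
      assume "conv (fejer n c) \<phi> j \<noteq> 0"
      then obtain k where k: "fejer n c (j - k) \<noteq> 0" "\<phi> k \<noteq> 0" by (rule conv_supp)
      have "\<bar>j - k\<bar> \<le> int n" using k fejer_supp[of n c] by (auto simp: subset_iff abs_le_iff)
      then show False using L[OF k(2)] False by linarith
    qed
    then show ?thesis using K0 by (auto intro!: sum_nonneg)
  qed
  have "seq_norm \<tau> (conv (fejer n c) \<phi>) \<le> \<tau> (\<lambda>j. \<Sum>t<N. K t / real N * cmod (conv c (\<psi> t) j))"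
    unfolding seq_norm_def by (intro bfn_mono[OF bfn] dom) auto
  also have "\<dots> \<le> (\<Sum>t<N. \<tau> (\<lambda>j. K t / real N * cmod (conv c (\<psi> t) j)))"
    using K0 by (intro bfn_sum_le[OF bfn]) auto
  also have "\<dots> = (\<Sum>t<N. ennreal (K t / real N) * seq_norm \<tau> (conv c (\<psi> t)))"
    unfolding seq_norm_def using K0 by (intro sum.cong refl bfn_scale[OF bfn]) auto
  also have "\<dots> \<le> (\<Sum>t<N. ennreal (K t / real N) * (ennreal A * seq_norm \<tau> \<phi>))"
  proof (intro sum_mono mult_left_mono)
    fix t
    have "finsupp (\<psi> t)" using \<phi> by (simp add: supp\<psi>)
    then show "seq_norm \<tau> (conv c (\<psi> t)) \<le> ennreal A * seq_norm \<tau> \<phi>"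
      using assms norm\<psi>[of t] unfolding conv_bounded_def by metis
  qed auto
  also have "\<dots> = ennreal (\<Sum>t<N. K t / real N) * (ennreal A * seq_norm \<tau> \<phi>)"
    using K0 by (simp add: sum_distrib_right[symmetric] sum_ennreal)
  also have "(\<Sum>t<N. K t / real N) = 1"
    using sumK Npos by (simp add: sum_divide_distrib[symmetric])
  finally show "seq_norm \<tau> (conv (fejer n c) \<phi>) \<le> ennreal A * seq_norm \<tau> \<phi>" by simp
qed

text \<open>Convolution with \<open>unit_seq m\<close> is the shift by m. The locale provides the
  shift by 1, composition its positive powers, and conjugate reflection the negative ones.\<close>

lemma conv_bounded_unit_seq: "\<exists>A. conv_bounded A (unit_seq m)"
proof -
  obtain C where C: "0 \<le> C" "\<And>f. (\<And>k. 0 \<le> f k) \<Longrightarrow> \<tau> (\<lambda>k. f (k - 1)) \<le> ennreal C * \<tau> f"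
    using shift by blast
  have one: "conv_bounded C (unit_seq 1)"
    unfolding conv_bounded_def seq_norm_def using C(1) by (auto simp: unit_seq_conv intro: C(2))
  have zero: "conv_bounded 1 (unit_seq 0)"
    unfolding conv_bounded_def seq_norm_def by (auto simp: unit_seq_conv)
  have step: "conv (unit_seq 1) (unit_seq m) = unit_seq (m + 1)" for m
    by (auto simp: fun_eq_iff conv_unit_seq) (auto simp: unit_seq_def)
  have pos: "\<exists>A. conv_bounded A (unit_seq (int n))" for n
  proof (induction n)
    case 0
    then show ?case using zero by auto
  next
    case (Suc n)
    then obtain A where "conv_bounded A (unit_seq (int n))" by auto
    then have "conv_bounded (C * A) (conv (unit_seq 1) (unit_seq (int n)))"
      by (intro conv_bounded_conv[OF one]) (auto simp: unit_seq_def)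
    then show ?case by (auto simp: step add.commute)
  qed
  obtain A where A: "conv_bounded A (unit_seq (int (nat \<bar>m\<bar>)))" using pos by blast
  show ?thesis
  proof (cases "m \<ge> 0")
    case True
    then show ?thesis using A by auto
  next
    case False
    have "(\<lambda>k. cnj (unit_seq (int (nat \<bar>m\<bar>)) (- k))) = unit_seq m"
      using False by (auto simp: fun_eq_iff unit_seq_def)
    then show ?thesis using conv_bounded_cnj_reflect[OF A] by auto
  qed
qed

text \<open>The constant B depends on S alone. It therefore serves a whole sequence of polynomials
  supported in S, and their coefficients tending to 0 makes their norms tend to 0.\<close>

lemma conv_bounded_on_finite:
  assumes "finite S"
  shows "\<exists>B\<ge>0. \<forall>c M. (\<forall>k. k \<notin> S \<longrightarrow> c k = 0) \<longrightarrow> (\<forall>k. cmod (c k) \<le> M) \<longrightarrow> conv_bounded (B * M) c"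
  using assms
proof (induction rule: finite_induct)
  case empty
  have "conv_bounded 0 c" if "\<forall>k. c k = 0" for c
    using that conv_bounded_zero by (metis ext zero_fun_apply)
  then show ?case by (intro exI[of _ 0]) auto
next
  case (insert s S)
  then obtain B where B: "B \<ge> 0" "\<And>c M. (\<And>k. k \<notin> S \<Longrightarrow> c k = 0) \<Longrightarrow> (\<And>k. cmod (c k) \<le> M) \<Longrightarrow> conv_bounded (B * M) c"
    by blast
  obtain A where A: "conv_bounded A (unit_seq s)" using conv_bounded_unit_seq by blast
  show ?case
  proof (intro exI[of _ "B + A"] conjI allI impI)
    show "0 \<le> B + A" using B conv_bounded_nonneg[OF A] by auto
    fix c M assume c: "\<forall>k. k \<notin> insert s S \<longrightarrow> c k = 0" "\<forall>k. cmod (c k) \<le> M"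
    have M: "0 \<le> M" using c(2)[rule_format, of 0] norm_ge_zero order.trans by blast
    have "conv_bounded (B * M) (c(s := 0))"
      using c M by (intro B) auto
    moreover have "conv_bounded (A * M) (\<lambda>k. c s * unit_seq s k)"
      by (rule conv_bounded_mono[OF conv_bounded_scale[OF A]])
        (use c(2) conv_bounded_nonneg[OF A] in \<open>simp add: mult.commute mult_left_mono\<close>)
    ultimately have "conv_bounded (B * M + A * M) (c(s := 0) + (\<lambda>k. c s * unit_seq s k))"
      by (rule conv_bounded_add)
    moreover have "c(s := 0) + (\<lambda>k. c s * unit_seq s k) = c"
      by (auto simp: fun_eq_iff unit_seq_def)
    ultimately show "conv_bounded ((B + A) * M) c" by (simp add: distrib_right)
  qed
qed

lemma conv_bounded_finsupp:
  assumes "finsupp c"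
  shows "\<exists>A. conv_bounded A c"
proof -
  obtain B where "\<forall>d M. (\<forall>k. k \<notin> {k. c k \<noteq> 0} \<longrightarrow> d k = 0) \<longrightarrow> (\<forall>k. cmod (d k) \<le> M) \<longrightarrow> conv_bounded (B * M) d"
    using conv_bounded_on_finite[OF assms] by blast
  moreover have "cmod (c k) \<le> (\<Sum>k | c k \<noteq> 0. cmod (c k))" for k
    using assms by (cases "c k = 0") (auto intro: sum_nonneg member_le_sum)
  ultimately show ?thesis by blast
qed

text \<open>A Fejer mean does not enlarge the support, so the error stays in one finite-dimensional
  space, where coefficientwise convergence is convergence in norm.\<close>

lemma fejer_approx:
  assumes "finsupp q" "\<epsilon> > 0"
  shows "\<exists>n. conv_bounded \<epsilon> (q - fejer n q)"
proof -
  let ?S = "{k. q k \<noteq> 0}"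
  obtain B where B: "B \<ge> 0" "\<forall>c M. (\<forall>k. k \<notin> ?S \<longrightarrow> c k = 0) \<longrightarrow> (\<forall>k. cmod (c k) \<le> M) \<longrightarrow> conv_bounded (B * M) c"
    using conv_bounded_on_finite[OF assms(1)] by blast
  have "(\<lambda>n. B * (\<Sum>k\<in>?S. cmod ((q - fejer n q) k))) \<longlonglongrightarrow> B * (\<Sum>k\<in>?S. cmod (q k - q k))"
    unfolding minus_apply by (intro tendsto_intros fejer_tendsto)
  then have "(\<lambda>n. B * (\<Sum>k\<in>?S. cmod ((q - fejer n q) k))) \<longlonglongrightarrow> 0" by simp
  then have "eventually (\<lambda>n. B * (\<Sum>k\<in>?S. cmod ((q - fejer n q) k)) < \<epsilon>) sequentially"
    using assms(2) by (rule order_tendstoD)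
  then obtain n where n: "B * (\<Sum>k\<in>?S. cmod ((q - fejer n q) k)) < \<epsilon>"
    by (auto simp: eventually_sequentially)
  have "cmod ((q - fejer n q) k) \<le> (\<Sum>k\<in>?S. cmod ((q - fejer n q) k))" for k
  proof (cases "k \<in> ?S")
    case True
    show ?thesis by (rule member_le_sum[OF True]) (use assms in auto)
  qed (auto simp: fejer_def intro!: sum_nonneg)
  then have "conv_bounded (B * (\<Sum>k\<in>?S. cmod ((q - fejer n q) k))) (q - fejer n q)"
    using B(2) by (auto simp: fejer_def)
  then show ?thesis using n conv_bounded_mono by (meson less_imp_le)
qed

end

subsection \<open>Sequences almost vanishing on an index set\<close>

context sequence_norm
begin

text \<open>Coefficients are dominated by the norm, so they form Cauchy sequences; the bound on the
  tails survives in the coefficientwise limit.\<close>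

lemma conv_bounded_complete:
  assumes step: "\<And>N. conv_bounded (C * (1/2)^N) (P (Suc N) - P N)"
  shows "\<exists>y. \<forall>N. conv_bounded (2 * C * (1/2)^N) (y - P N)"
proof -
  have C: "0 \<le> C" using conv_bounded_nonneg[OF step[of 0]] by simp
  \<comment> \<open>The factor 1 - (1/2)^m records the exact geometric partial sum; the bound
    without it would not reproduce itself in the induction.\<close>
  have tail: "conv_bounded (2 * C * (1/2)^N * (1 - (1/2)^m)) (P (N + m) - P N)" for N m
  proof (induction m)
    case 0
    show ?case using conv_bounded_zero by (simp add: zero_fun_def fun_diff_def)
  next
    case (Suc m)
    have "conv_bounded (2 * C * (1/2)^N * (1 - (1/2)^m) + C * (1/2)^(N + m)) ((P (N + m) - P N) + (P (Suc (N + m)) - P (N + m)))"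
      by (rule conv_bounded_add[OF Suc step])
    moreover have "(P (N + m) - P N) + (P (Suc (N + m)) - P (N + m)) = P (N + Suc m) - P N"
      by (auto simp: fun_eq_iff)
    moreover have "2 * C * (1/2)^N * (1 - (1/2)^m) + C * (1/2)^(N + m) = 2 * C * (1/2)^N * (1 - (1/2)^Suc m)"
      by (simp add: power_add algebra_simps)
    ultimately show ?case by (simp only: add_Suc_right)
  qed
  have tail': "conv_bounded (2 * C * (1/2)^N) (P (N + m) - P N)" for N m
    by (rule conv_bounded_mono[OF tail]) (use C in \<open>simp add: mult_left_le\<close>)
  have "\<exists>l. (\<lambda>n. P n k) \<longlonglongrightarrow> l" for k
  proof -
    have "Cauchy (\<lambda>n. P n k)"
    proof (rule metric_CauchyI)
      fix e :: real assume "e > 0"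
      have "(\<lambda>N. 4 * C * (1/2)^N) \<longlonglongrightarrow> 4 * C * 0"
        by (intro tendsto_intros LIMSEQ_power_zero) auto
      then have "eventually (\<lambda>N. 4 * C * (1/2)^N < e) sequentially"
        using \<open>e > 0\<close> by (intro order_tendstoD(2)[of _ 0]) auto
      then obtain N where N: "4 * C * (1/2)^N < e" by (auto simp: eventually_sequentially)
      have d: "dist (P n k) (P N k) \<le> 2 * C * (1/2)^N" if "n \<ge> N" for n
        using conv_bounded_coeff[OF tail'[of N "n - N"], of k] that by (simp add: dist_norm)
      have "dist (P m k) (P n k) < e" if "m \<ge> N" "n \<ge> N" for m n
        using d[OF that(1)] d[OF that(2)] N dist_triangle2[of "P m k" "P n k" "P N k"] by linarith
      then show "\<exists>M. \<forall>m\<ge>M. \<forall>n\<ge>M. dist (P m k) (P n k) < e" by blast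
    qed
    then show ?thesis by (auto simp: Cauchy_convergent_iff convergent_def)
  qed
  then obtain y where y: "\<And>k. (\<lambda>n. P n k) \<longlonglongrightarrow> y k" by metis
  have "conv_bounded (2 * C * (1/2)^N) (y - P N)" for N
  proof (rule conv_bounded_lim[OF tail'])
    have "(\<lambda>n. P (N + n) k) \<longlonglongrightarrow> y k" for k
      using LIMSEQ_ignore_initial_segment[OF y[of k], of N] by (simp only: add.commute)
    then show "(\<lambda>n. (P (N + n) - P N) k) \<longlonglongrightarrow> (y - P N) k" for k
      unfolding minus_apply by (intro tendsto_intros)
  qed
  then show ?thesis by blast
qed

section \<open>Polynomials, one-sided sequences and their closures on the coefficient side\<close>

definition bounded_convolvers :: "(int \<Rightarrow> complex) set" where
  "bounded_convolvers = {c. \<exists>A. conv_bounded A c}"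

lemma bounded_convolvers_add: "c \<in> bounded_convolvers \<Longrightarrow> d \<in> bounded_convolvers \<Longrightarrow> c + d \<in> bounded_convolvers"
  unfolding bounded_convolvers_def using conv_bounded_add by blast

lemma bounded_convolvers_diff: "c \<in> bounded_convolvers \<Longrightarrow> d \<in> bounded_convolvers \<Longrightarrow> c - d \<in> bounded_convolvers"
  unfolding bounded_convolvers_def using conv_bounded_diff by blast

lemma bounded_convolvers_finsupp: "finsupp c \<Longrightarrow> c \<in> bounded_convolvers"
  unfolding bounded_convolvers_def using conv_bounded_finsupp by blast

definition poly_limits :: "(int \<Rightarrow> complex) set" where
  "poly_limits = {y \<in> bounded_convolvers. \<forall>\<epsilon>>0. \<exists>q. finsupp q \<and> conv_bounded \<epsilon> (y - q)}"

text \<open>For I the negative or the positive integers these are the coefficients of a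
  trigonometric polynomial plus a one-sided multiplier: the finitely many nonzero coefficients on I
  form the polynomial.\<close>

definition almost_vanishing :: "int set \<Rightarrow> (int \<Rightarrow> complex) set" where
  "almost_vanishing I = {d \<in> bounded_convolvers. finite {n \<in> I. d n \<noteq> 0}}"

text \<open>Being a closure, this set is closed by construction; the work lies in showing that it is
  no larger than the sum of \<open>poly_limits\<close> and the bounded convolvers vanishing on
  I.\<close>

definition approx_vanishing :: "int set \<Rightarrow> (int \<Rightarrow> complex) set" where
  "approx_vanishing I = {c \<in> bounded_convolvers. \<forall>\<epsilon>>0. \<exists>d \<in> almost_vanishing I. conv_bounded \<epsilon> (c - d)}"

lemma almost_vanishing_diff:
  assumes "c \<in> almost_vanishing I" "d \<in> almost_vanishing I"
  shows "c - d \<in> almost_vanishing I"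
proof -
  have "finite {n \<in> I. (c - d) n \<noteq> 0}"
    by (rule finite_subset[of _ "{n \<in> I. c n \<noteq> 0} \<union> {n \<in> I. d n \<noteq> 0}"])
      (use assms in \<open>auto simp: almost_vanishing_def\<close>)
  then show ?thesis using assms bounded_convolvers_diff by (auto simp: almost_vanishing_def)
qed

lemma almost_vanishing_add:
  assumes "c \<in> almost_vanishing I" "d \<in> almost_vanishing I"
  shows "c + d \<in> almost_vanishing I"
proof -
  have "finite {n \<in> I. (c + d) n \<noteq> 0}"
    by (rule finite_subset[of _ "{n \<in> I. c n \<noteq> 0} \<union> {n \<in> I. d n \<noteq> 0}"])
      (use assms in \<open>auto simp: almost_vanishing_def\<close>)
  then show ?thesis using assms bounded_convolvers_add by (auto simp: almost_vanishing_def)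
qed

text \<open>The Fejer mean of \<open>d\<close> is as small as \<open>d\<close>; replacing its coefficients on \<open>I\<close> by those of \<open>d\<close>
  costs only the small error of the Fejer mean of a trigonometric polynomial.\<close>

lemma almost_vanishing_lift:
  assumes "conv_bounded A d" "finite {n \<in> I. d n \<noteq> 0}" "\<epsilon> > 0"
  shows "\<exists>q. finsupp q \<and> conv_bounded (A + \<epsilon>) q \<and> (\<forall>n\<in>I. q n = d n)"
proof -
  define p where "p n = (if n \<in> I then d n else 0)" for n
  have "{n. p n \<noteq> 0} = {n \<in> I. d n \<noteq> 0}" by (auto simp: p_def)
  then have p: "finsupp p" using assms(2) by simp
  obtain m where m: "conv_bounded \<epsilon> (p - fejer m p)" using fejer_approx[OF p assms(3)] by blast
  show ?thesis
  proof (intro exI conjI)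
    show "finsupp (fejer m d + (p - fejer m p))"
      using p by (intro finsupp_add finsupp_diff finsupp_fejer)
    show "conv_bounded (A + \<epsilon>) (fejer m d + (p - fejer m p))"
      by (intro conv_bounded_add conv_bounded_fejer assms m)
    \<comment> \<open>On I the sequences d and p coincide, hence so do their Fejer means; these
      cancel and leave p = d.\<close>
    show "\<forall>n\<in>I. (fejer m d + (p - fejer m p)) n = d n"
      by (auto simp: fejer_def p_def)
  qed
qed

text \<open>Successive approximants of c differ by small sequences, and each difference is lifted to
  a polynomial of comparable norm with the same values on I. The lifts are therefore summable, and y
  agrees with c on I because each coefficient depends continuously on the sequence.\<close>

lemma approx_vanishing_poly_part:
  assumes c: "c \<in> approx_vanishing I"
  shows "\<exists>y \<in> poly_limits. \<forall>n\<in>I. y n = c n"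
proof -
  have "\<exists>d. d \<in> almost_vanishing I \<and> conv_bounded ((1/2)^N) (c - d)" for N
  proof -
    have "(1/2::real)^N > 0" by simp
    then show ?thesis using c unfolding approx_vanishing_def by blast
  qed
  then obtain d where d: "\<And>N. d N \<in> almost_vanishing I" "\<And>N. conv_bounded ((1/2)^N) (c - d N)"
    by metis
  \<comment> \<open>The difference has norm at most 3/2 times (1/2)^N, rounded up to 2; the lift is
    allowed to add one more (1/2)^N.\<close>
  have lift: "\<exists>q. finsupp q \<and> conv_bounded (3 * (1/2)^N) q \<and> (\<forall>n\<in>I. q n = (d (Suc N) - d N) n)" for N
  proof -
    have "conv_bounded ((1/2)^N + (1/2)^Suc N) ((c - d N) - (c - d (Suc N)))"
      by (rule conv_bounded_diff[OF d(2) d(2)])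
    moreover have "(c - d N) - (c - d (Suc N)) = d (Suc N) - d N" by (auto simp: fun_eq_iff)
    ultimately have "conv_bounded (2 * (1/2)^N) (d (Suc N) - d N)"
      by (simp only:) (erule conv_bounded_mono, simp)
    moreover have "finite {n \<in> I. (d (Suc N) - d N) n \<noteq> 0}"
      using almost_vanishing_diff[OF d(1) d(1)] by (auto simp: almost_vanishing_def)
    ultimately have "\<exists>q. finsupp q \<and> conv_bounded (2 * (1/2)^N + (1/2)^N) q \<and> (\<forall>n\<in>I. q n = (d (Suc N) - d N) n)"
      by (rule almost_vanishing_lift) auto
    then show ?thesis by simp
  qed
  \<comment> \<open>The invariant is agreement of P N with d N on I; it holds at the start by
    lifting d 0 with some bound, whose size is irrelevant, and each step adds a lifted
    difference.\<close>
  have "\<exists>P. \<forall>N. (finsupp (P N) \<and> (\<forall>n\<in>I. P N n = d N n)) \<and> conv_bounded (3 * (1/2)^N) (P (Suc N) - P N)"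
  proof (rule dependent_nat_choice)
    have "finite {n \<in> I. d 0 n \<noteq> 0}" using d(1)[of 0] by (simp add: almost_vanishing_def)
    moreover obtain A where "conv_bounded A (d 0)"
      using d(1)[of 0] by (auto simp: almost_vanishing_def bounded_convolvers_def)
    ultimately show "\<exists>p. finsupp p \<and> (\<forall>n\<in>I. p n = d 0 n)"
      using almost_vanishing_lift[of A "d 0" I 1] by auto
    fix p N assume p: "finsupp p \<and> (\<forall>n\<in>I. p n = d N n)"
    obtain q where q: "finsupp q" "conv_bounded (3 * (1/2)^N) q" "\<forall>n\<in>I. q n = (d (Suc N) - d N) n"
      using lift by blast
    then show "\<exists>p'. (finsupp p' \<and> (\<forall>n\<in>I. p' n = d (Suc N) n)) \<and> conv_bounded (3 * (1/2)^N) (p' - p)"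
      using p finsupp_add by (intro exI[of _ "p + q"]) auto
  qed
  then obtain P where P: "\<And>N. finsupp (P N)" "\<And>N n. n \<in> I \<Longrightarrow> P N n = d N n"
      "\<And>N. conv_bounded (3 * (1/2)^N) (P (Suc N) - P N)" by blast
  obtain y where y: "\<And>N. conv_bounded (2 * 3 * (1/2)^N) (y - P N)"
    using conv_bounded_complete[OF P(3)] by blast
  have small: "\<exists>N. B * (1/2)^N < \<epsilon>" if "\<epsilon> > 0" for \<epsilon> B :: real
  proof -
    have "(\<lambda>N. B * (1/2)^N) \<longlonglongrightarrow> B * 0"
      by (intro tendsto_intros LIMSEQ_power_zero) auto
    then have "eventually (\<lambda>N. B * (1/2)^N < \<epsilon>) sequentially"
      using that by (intro order_tendstoD(2)[of _ 0]) auto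
    then show ?thesis by (auto simp: eventually_sequentially)
  qed
  have "y = P 0 + (y - P 0)" by (auto simp: fun_eq_iff)
  moreover have "y - P 0 \<in> bounded_convolvers" using y by (auto simp: bounded_convolvers_def)
  ultimately have "y \<in> bounded_convolvers"
    using bounded_convolvers_add[OF bounded_convolvers_finsupp[OF P(1)]] by metis
  moreover have "\<exists>q. finsupp q \<and> conv_bounded \<epsilon> (y - q)" if \<epsilon>: "\<epsilon> > 0" for \<epsilon>
  proof -
    obtain N where "2 * 3 * (1/2)^N < \<epsilon>" using small[OF \<epsilon>] by blast
    then show ?thesis using y P(1) conv_bounded_mono by (meson less_imp_le)
  qed
  ultimately have "y \<in> poly_limits" by (auto simp: poly_limits_def)
  moreover have "y n = c n" if n: "n \<in> I" for n
  proof (rule ccontr)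
    assume "y n \<noteq> c n"
    \<comment> \<open>7 = 6 + 1: the distance from y to P N and the one from c to d N, where P N and
      d N agree at n.\<close>
    then obtain N where N: "7 * (1/2)^N < cmod (y n - c n)" using small[of "cmod (y n - c n)"] by auto
    have "cmod (y n - P N n) \<le> 6 * (1/2)^N" using conv_bounded_coeff[OF y[of N], of n] by simp
    moreover have "cmod (c n - d N n) \<le> (1/2)^N" using conv_bounded_coeff[OF d(2)[of N], of n] by simp
    ultimately show False
      using N norm_triangle_ineq4[of "y n - P N n" "c n - d N n"] P(2)[OF n, of N] by simp
  qed
  ultimately show ?thesis by blast
qed

text \<open>Forwards, c minus its polynomial part vanishes on I. Backwards, y is replaced by a
  nearby polynomial, and adding h leaves only finitely many nonzero coefficients on I. So the
  closure equals the sum, which is the closedness claim.\<close>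

lemma approx_vanishing_iff:
  "c \<in> approx_vanishing I \<longleftrightarrow>
     (\<exists>y h. c = y + h \<and> y \<in> poly_limits \<and> h \<in> bounded_convolvers \<and> (\<forall>n\<in>I. h n = 0))"
proof
  assume c: "c \<in> approx_vanishing I"
  then obtain y where y: "y \<in> poly_limits" "\<forall>n\<in>I. y n = c n" using approx_vanishing_poly_part by blast
  have "c - y \<in> bounded_convolvers"
    using c y by (intro bounded_convolvers_diff) (auto simp: approx_vanishing_def poly_limits_def)
  then show "\<exists>y h. c = y + h \<and> y \<in> poly_limits \<and> h \<in> bounded_convolvers \<and> (\<forall>n\<in>I. h n = 0)"
  proof (intro exI conjI)
    show "c = y + (c - y)" by (auto simp: fun_eq_iff)
  qed (use y in auto)
next
  assume "\<exists>y h. c = y + h \<and> y \<in> poly_limits \<and> h \<in> bounded_convolvers \<and> (\<forall>n\<in>I. h n = 0)"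
  then obtain y h where c: "c = y + h" "y \<in> poly_limits" "h \<in> bounded_convolvers" "\<forall>n\<in>I. h n = 0" by blast
  have "\<exists>d \<in> almost_vanishing I. conv_bounded \<epsilon> (c - d)" if "\<epsilon> > 0" for \<epsilon>
  proof -
    obtain q where q: "finsupp q" "conv_bounded \<epsilon> (y - q)" using c(2) \<open>\<epsilon> > 0\<close> unfolding poly_limits_def by blast
    have "finite {n \<in> I. (q + h) n \<noteq> 0}"
      by (rule finite_subset[OF _ q(1)]) (use c in auto)
    then have "q + h \<in> almost_vanishing I"
      using bounded_convolvers_add[OF bounded_convolvers_finsupp[OF q(1)] c(3)]
      by (simp add: almost_vanishing_def)
    moreover have "c - (q + h) = y - q" using c by (auto simp: fun_eq_iff)
    ultimately show ?thesis using q by metis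
  qed
  then show "c \<in> approx_vanishing I"
    using c bounded_convolvers_add by (auto simp: approx_vanishing_def poly_limits_def)
qed

lemma approx_vanishing_closed:
  assumes "c \<in> bounded_convolvers" "\<And>\<epsilon>. \<epsilon> > 0 \<Longrightarrow> \<exists>d \<in> approx_vanishing I. conv_bounded \<epsilon> (c - d)"
  shows "c \<in> approx_vanishing I"
proof -
  have "\<exists>d \<in> almost_vanishing I. conv_bounded \<epsilon> (c - d)" if "\<epsilon> > 0" for \<epsilon>
  proof -
    obtain d where d: "d \<in> approx_vanishing I" "conv_bounded (\<epsilon>/2) (c - d)"
      using assms(2)[of "\<epsilon>/2"] \<open>\<epsilon> > 0\<close> by auto
    have "\<epsilon> / 2 > 0" using \<open>\<epsilon> > 0\<close> by simp
    then obtain e where e: "e \<in> almost_vanishing I" "conv_bounded (\<epsilon>/2) (d - e)"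
      using d(1) unfolding approx_vanishing_def by blast
    have "(c - d) + (d - e) = c - e" by (auto simp: fun_eq_iff)
    then show ?thesis using conv_bounded_add[OF d(2) e(2)] e(1) by auto
  qed
  then show ?thesis using assms(1) by (auto simp: approx_vanishing_def)
qed

lemma approx_vanishing_add:
  assumes "c \<in> approx_vanishing I" "d \<in> approx_vanishing I"
  shows "c + d \<in> approx_vanishing I"
proof -
  have "\<exists>e \<in> almost_vanishing I. conv_bounded \<epsilon> (c + d - e)" if "\<epsilon> > 0" for \<epsilon>
  proof -
    have "\<epsilon> / 2 > 0" using that by simp
    then obtain c' d' where cd: "c' \<in> almost_vanishing I" "conv_bounded (\<epsilon>/2) (c - c')"
        "d' \<in> almost_vanishing I" "conv_bounded (\<epsilon>/2) (d - d')"
      using assms unfolding approx_vanishing_def by blast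
    have "(c - c') + (d - d') = c + d - (c' + d')" by (auto simp: fun_eq_iff)
    then show ?thesis
      using conv_bounded_add[OF cd(2,4)] almost_vanishing_add[OF cd(1,3)] by (intro bexI[of _ "c' + d'"]) (simp_all only: field_sum_of_halves)
  qed
  then show ?thesis using assms bounded_convolvers_add by (auto simp: approx_vanishing_def)
qed

lemma bounded_convolvers_scale: "c \<in> bounded_convolvers \<Longrightarrow> (\<lambda>k. z * c k) \<in> bounded_convolvers"
  unfolding bounded_convolvers_def using conv_bounded_scale by blast

lemma approx_vanishing_scale:
  assumes "c \<in> approx_vanishing I"
  shows "(\<lambda>k. z * c k) \<in> approx_vanishing I"
proof -
  have "\<exists>e \<in> almost_vanishing I. conv_bounded \<epsilon> ((\<lambda>k. z * c k) - e)" if "\<epsilon> > 0" for \<epsilon>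
  proof -
    \<comment> \<open>The added 1 covers z = 0.\<close>
    have "\<epsilon> / (cmod z + 1) > 0" using that by (simp add: add_nonneg_pos)
    then obtain d where d: "d \<in> almost_vanishing I" "conv_bounded (\<epsilon> / (cmod z + 1)) (c - d)"
      using assms unfolding approx_vanishing_def by blast
    have "finite {n \<in> I. z * d n \<noteq> 0}"
      by (rule finite_subset[of _ "{n \<in> I. d n \<noteq> 0}"]) (use d in \<open>auto simp: almost_vanishing_def\<close>)
    then have "(\<lambda>k. z * d k) \<in> almost_vanishing I"
      using d(1) bounded_convolvers_scale by (auto simp: almost_vanishing_def)
    moreover have "(\<lambda>k. z * c k) - (\<lambda>k. z * d k) = (\<lambda>k. z * (c - d) k)"
      by (auto simp: fun_eq_iff algebra_simps)
    moreover have "conv_bounded \<epsilon> (\<lambda>k. z * (c - d) k)"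
    proof (rule conv_bounded_mono[OF conv_bounded_scale[OF d(2)]])
      have "cmod z * \<epsilon> \<le> \<epsilon> * (cmod z + 1)" using that by (simp add: algebra_simps)
      then show "cmod z * (\<epsilon> / (cmod z + 1)) \<le> \<epsilon>"
        using norm_ge_zero[of z] by (simp add: pos_divide_le_eq add_nonneg_pos)
    qed
    ultimately show ?thesis by metis
  qed
  then show ?thesis using assms bounded_convolvers_scale by (auto simp: approx_vanishing_def)
qed

text \<open>The coefficients of a product of symbols; a Fejer limit needs no summability of \<open>c\<close> and \<open>d\<close>.\<close>

definition is_conv_limit :: "(int \<Rightarrow> complex) \<Rightarrow> (int \<Rightarrow> complex) \<Rightarrow> (int \<Rightarrow> complex) \<Rightarrow> bool" where
  "is_conv_limit c d e \<longleftrightarrow> (\<forall>m. (\<lambda>n. conv c (fejer n d) m) \<longlonglongrightarrow> e m)"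

lemma conv_limit_bounded:
  assumes "is_conv_limit c d e" "conv_bounded A c" "conv_bounded B d"
  shows "conv_bounded (A * B) e"
proof (rule conv_bounded_lim)
  show "conv_bounded (A * B) (conv c (fejer n d))" for n
    by (intro conv_bounded_conv conv_bounded_fejer assms finsupp_fejer)
  show "(\<lambda>n. conv c (fejer n d) k) \<longlonglongrightarrow> e k" for k
    using assms by (simp add: is_conv_limit_def)
qed

text \<open>The splitting cd - c'd' = (c - c')d + c'(d - d') is applied to the finite convolutions,
  before passing to the limit.\<close>

lemma conv_limit_diff_bounded:
  assumes "is_conv_limit c d e" "is_conv_limit c' d' e'"
    and "conv_bounded a (c - c')" "conv_bounded B d" "conv_bounded A c'" "conv_bounded b (d - d')"
  shows "conv_bounded (a * B + A * b) (e - e')"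
proof (rule conv_bounded_lim)
  fix n
  have eq: "conv c (fejer n d) - conv c' (fejer n d')
      = conv (c - c') (fejer n d) + conv c' (fejer n (d - d'))"
    by (auto simp: fun_eq_iff conv_diff_left fejer_diff conv_diff_right finsupp_fejer)
  show "conv_bounded (a * B + A * b) (conv c (fejer n d) - conv c' (fejer n d'))"
    unfolding eq
    by (intro conv_bounded_add conv_bounded_conv conv_bounded_fejer assms finsupp_fejer)
next
  show "(\<lambda>n. (conv c (fejer n d) - conv c' (fejer n d')) k) \<longlonglongrightarrow> (e - e') k" for k
    unfolding minus_apply using assms by (intro tendsto_diff) (auto simp: is_conv_limit_def)
qed

text \<open>Each factor vanishes far out on the half-line s n < 0, and support bounds add under
  convolution, uniformly in the Fejer index. The sign s treats both half-lines at once.\<close>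

lemma conv_limit_almost_vanishing:
  assumes s: "s = 1 \<or> s = - 1" and I: "I = {n. s * n < 0}"
    and c: "c \<in> almost_vanishing I" and d: "d \<in> almost_vanishing I" and e: "is_conv_limit c d e"
  shows "e \<in> almost_vanishing I"
proof -
  have bound: "\<exists>M. \<forall>n. s * n < - M \<longrightarrow> f n = 0" if f: "f \<in> almost_vanishing I" for f
  proof -
    have fin: "finite ((\<lambda>n. nat \<bar>n\<bar>) ` {n \<in> I. f n \<noteq> 0})" using f by (simp add: almost_vanishing_def)
    then obtain M where M: "\<forall>x \<in> (\<lambda>n. nat \<bar>n\<bar>) ` {n \<in> I. f n \<noteq> 0}. x \<le> M"
      using finite_nat_set_iff_bounded_le by blast
    have "f n = 0" if "s * n < - int M" for n
    proof (rule ccontr)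
      assume "f n \<noteq> 0"
      moreover have "n \<in> I" using that by (simp add: I)
      ultimately have "nat \<bar>n\<bar> \<le> M" using M by blast
      then show False using that s by auto
    qed
    then show ?thesis by blast
  qed
  obtain M N where M: "\<And>n. s * n < - M \<Longrightarrow> c n = 0" and N: "\<And>n. s * n < - N \<Longrightarrow> d n = 0"
    using bound[OF c] bound[OF d] by blast
  have zero: "e n = 0" if n: "s * n < - M - N" for n
  proof -
    have "conv c (fejer i d) n = 0" for i
    proof (rule ccontr)
      assume "conv c (fejer i d) n \<noteq> 0"
      then obtain k where "c (n - k) \<noteq> 0" "fejer i d k \<noteq> 0" by (rule conv_supp)
      then have "\<not> s * (n - k) < - M" "\<not> s * k < - N" using M N by (auto simp: fejer_def)
      then show False using n by (simp add: algebra_simps)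
    qed
    moreover have "(\<lambda>i. conv c (fejer i d) n) \<longlonglongrightarrow> e n" using e by (simp add: is_conv_limit_def)
    ultimately show ?thesis by (simp add: LIMSEQ_const_iff)
  qed
  have "finite {n \<in> I. e n \<noteq> 0}"
  proof (rule finite_subset)
    show "{n \<in> I. e n \<noteq> 0} \<subseteq> {- \<bar>M + N\<bar>..\<bar>M + N\<bar>}"
    proof
      fix n assume "n \<in> {n \<in> I. e n \<noteq> 0}"
      then have "s * n < 0" "\<not> s * n < - M - N" using zero by (auto simp: I)
      then show "n \<in> {- \<bar>M + N\<bar>..\<bar>M + N\<bar>}" using s by auto
    qed
  qed simp
  moreover have "e \<in> bounded_convolvers"
    using conv_limit_bounded[OF e] c d by (auto simp: almost_vanishing_def bounded_convolvers_def)
  ultimately show ?thesis by (simp add: almost_vanishing_def)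
qed

text \<open>The approximants of c and d must have a product too, and for arbitrary sequences the
  Fejer limit might not exist. The assumption \<open>ex\<close> closes this gap; bounded symbols
  discharge it later.\<close>

lemma approx_vanishing_conv_limit:
  assumes s: "s = 1 \<or> s = - 1" and I: "I = {n. s * n < 0}"
    and c: "c \<in> approx_vanishing I" and d: "d \<in> approx_vanishing I" and e: "is_conv_limit c d e"
    and ex: "\<And>c d. c \<in> bounded_convolvers \<Longrightarrow> d \<in> bounded_convolvers \<Longrightarrow> \<exists>e. is_conv_limit c d e"
  shows "e \<in> approx_vanishing I"
proof -
  obtain A B where AB: "conv_bounded A c" "conv_bounded B d"
    using c d by (auto simp: approx_vanishing_def bounded_convolvers_def)
  have AB0: "0 \<le> A" "0 \<le> B" using AB conv_bounded_nonneg by auto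
  have "\<exists>e' \<in> almost_vanishing I. conv_bounded \<epsilon> (e - e')" if "\<epsilon> > 0" for \<epsilon>
  proof -
    \<comment> \<open>The bound 1 gives c' the norm bound A + 1; the total error of the product is
      then \<delta> (A + B + 1).\<close>
    define \<delta> where "\<delta> = min 1 (\<epsilon> / (A + B + 1))"
    have \<delta>: "\<delta> > 0" "\<delta> \<le> 1" using that AB0 by (auto simp: \<delta>_def)
    have "\<delta> \<le> \<epsilon> / (A + B + 1)" by (simp add: \<delta>_def)
    then have le: "\<delta> * B + (A + 1) * \<delta> \<le> \<epsilon>"
      using AB0 by (simp add: field_simps)
    obtain c' d' where cd: "c' \<in> almost_vanishing I" "conv_bounded \<delta> (c - c')"
        "d' \<in> almost_vanishing I" "conv_bounded \<delta> (d - d')"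
      using c d \<delta> unfolding approx_vanishing_def by blast
    have "c - (c - c') = c'" by (auto simp: fun_eq_iff)
    then have c': "conv_bounded (A + 1) c'"
      using conv_bounded_mono[OF conv_bounded_diff[OF AB(1) cd(2)], of "A + 1"] \<delta> by simp
    obtain e' where e': "is_conv_limit c' d' e'"
      using ex cd(1,3) unfolding almost_vanishing_def by blast
    have "conv_bounded (\<delta> * B + (A + 1) * \<delta>) (e - e')"
      by (rule conv_limit_diff_bounded[OF e e' cd(2) AB(2) c' cd(4)])
    then show ?thesis
      using conv_limit_almost_vanishing[OF s I cd(1,3) e'] le conv_bounded_mono by blast
  qed
  moreover have "e \<in> bounded_convolvers"
    using conv_limit_bounded[OF e AB] by (auto simp: bounded_convolvers_def)
  ultimately show ?thesis by (auto simp: approx_vanishing_def)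
qed

end

subsection \<open>Trigonometric polynomials\<close>

text \<open>For infinite support the sum is 0 by convention, so continuity, periodicity and
  smoothness hold for every c.\<close>

definition trig_eval :: "(int \<Rightarrow> complex) \<Rightarrow> real \<Rightarrow> complex" where
  "trig_eval c \<theta> = (\<Sum>k | c k \<noteq> 0. c k * cis (of_int k * \<theta>))"

lemma trig_eval_eq_sum:
  assumes "finite A" "{k. c k \<noteq> 0} \<subseteq> A"
  shows "trig_eval c \<theta> = (\<Sum>k\<in>A. c k * cis (of_int k * \<theta>))"
  unfolding trig_eval_def by (rule sum.mono_neutral_left) (use assms in auto)

lemma trig_eval_add:
  assumes "finsupp c" "finsupp d"
  shows "trig_eval (c + d) \<theta> = trig_eval c \<theta> + trig_eval d \<theta>"
proof -
  let ?A = "{k. c k \<noteq> 0} \<union> {k. d k \<noteq> 0}"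
  have A: "finite ?A" using assms by auto
  have "trig_eval c \<theta> = (\<Sum>k\<in>?A. c k * cis (of_int k * \<theta>))" "trig_eval d \<theta> = (\<Sum>k\<in>?A. d k * cis (of_int k * \<theta>))"
    "trig_eval (c + d) \<theta> = (\<Sum>k\<in>?A. (c + d) k * cis (of_int k * \<theta>))"
    by (rule trig_eval_eq_sum[OF A]; auto)+
  then show ?thesis by (simp add: sum.distrib algebra_simps)
qed

lemma trig_eval_diff:
  assumes "finsupp c" "finsupp d"
  shows "trig_eval (c - d) \<theta> = trig_eval c \<theta> - trig_eval d \<theta>"
proof -
  have "(c - d) + d = c" by (simp add: fun_eq_iff)
  then show ?thesis
    using trig_eval_add[OF finsupp_diff[OF assms] assms(2), of \<theta>] by (simp only: add_diff_cancel_right')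
qed

text \<open>Characters are eigenvectors of convolution: convolving e with f multiplies e by
  \<open>trig_eval f \<theta>\<close>. Associativity applied to e, c and d, read at index 0, then
  gives multiplicativity.\<close>

lemma trig_eval_conv:
  assumes "finsupp c" "finsupp d"
  shows "trig_eval (conv c d) \<theta> = trig_eval c \<theta> * trig_eval d \<theta>"
proof -
  define e where "e k = cis (- of_int k * \<theta>)" for k :: int
  have ev: "conv e f j = e j * trig_eval f \<theta>" for f j
    by (auto simp: conv_def e_def trig_eval_def sum_distrib_left cis_mult algebra_simps intro!: sum.cong)
  have "e 0 * trig_eval (conv c d) \<theta> = conv (conv e c) d 0"
    using conv_assoc[OF assms, of e] by (simp add: ev[symmetric])
  also have "conv e c = (\<lambda>j. trig_eval c \<theta> * e j)"
    by (simp add: fun_eq_iff ev)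
  also have "conv \<dots> d 0 = trig_eval c \<theta> * (e 0 * trig_eval d \<theta>)"
    by (simp add: conv_scale_left ev)
  finally show ?thesis by (simp add: e_def)
qed

lemma trig_eval_unit_seq: "trig_eval (\<lambda>k. z * unit_seq m k) \<theta> = z * cis (of_int m * \<theta>)"
  by (subst trig_eval_eq_sum[of "{m}"]) (auto simp: unit_seq_def)

lemma trig_eval_periodic: "trig_eval c (\<theta> + 2 * pi) = trig_eval c \<theta>"
proof -
  have "cis (of_int k * (\<theta> + 2 * pi)) = cis (of_int k * \<theta>)" for k
  proof -
    have "cis (of_int k * (\<theta> + 2 * pi)) = cis (of_int k * \<theta>) * cis (2 * pi * of_int k)"
      by (simp add: cis_mult algebra_simps)
    then show ?thesis by (simp add: cis_multiple_2pi)
  qed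
  then show ?thesis by (simp add: trig_eval_def)
qed

lemma continuous_on_trig_eval: "continuous_on S (trig_eval c)"
  unfolding trig_eval_def by (intro continuous_intros)

subsection \<open>Uniform approximation\<close>

text \<open>Sums and products of trigonometric polynomials are sums and convolutions of
  coefficients, so only constants and linear functionals have to be computed.\<close>

lemma real_polynomial_function_cis:
  fixes p :: "complex \<Rightarrow> real"
  assumes "real_polynomial_function p"
  shows "\<exists>c. finsupp c \<and> (\<forall>\<theta>. complex_of_real (p (cis \<theta>)) = trig_eval c \<theta>)"
  using assms
proof (induction rule: real_polynomial_function.induct)
  case (linear f)
  interpret bounded_linear f by fact
  \<comment> \<open>Euler's formulas for the cosine and sine in f (cis \<theta>) = cos \<theta> f(1)
    + sin \<theta> f(i).\<close>
  define c where "c k = (if k = 1 then (f 1 - \<i> * f \<i>) / 2 else if k = - 1 then (f 1 + \<i> * f \<i>) / 2 else 0)" for k :: int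
  have "f (cis \<theta>) = cos \<theta> * f 1 + sin \<theta> * f \<i>" for \<theta>
  proof -
    have "cis \<theta> = cos \<theta> *\<^sub>R 1 + sin \<theta> *\<^sub>R \<i>" by (simp add: complex_eq_iff)
    then show ?thesis by (simp add: add scaleR)
  qed
  moreover have "trig_eval c \<theta> = of_real (cos \<theta>) * f 1 + of_real (sin \<theta>) * f \<i>" for \<theta>
    by (subst trig_eval_eq_sum[of "{1, - 1}"]) (auto simp: c_def complex_eq_iff field_simps)
  moreover have "finsupp c"
    by (rule finite_subset[of _ "{1, - 1}"]) (auto simp: c_def)
  ultimately show ?case by (intro exI[of _ c]) auto
next
  case (const z)
  show ?case
    by (intro exI[of _ "\<lambda>k. of_real z * unit_seq 0 k"])
      (auto simp only: trig_eval_unit_seq, auto simp: unit_seq_def)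
next
  case (add f g)
  then show ?case using finsupp_add trig_eval_add by (metis of_real_add)
next
  case (mult f g)
  then show ?case using finsupp_conv trig_eval_conv by (metis of_real_mult)
qed

text \<open>Stone-Weierstrass on the unit circle, applied to u composed with \<open>Arg\<close>.
  Equality of u at both end points removes the jump at the cut of \<open>Arg\<close>.\<close>

lemma trig_approx:
  assumes cont: "continuous_on {- pi..pi} u" and per: "u (- pi) = u pi" and \<epsilon>: "\<epsilon> > 0"
  shows "\<exists>c. finsupp c \<and> (\<forall>\<theta>\<in>{- pi..pi}. cmod (u \<theta> - trig_eval c \<theta>) < \<epsilon>)"
proof -
  have inv: "u (Arg (cis \<theta>)) = u \<theta>" if "\<theta> \<in> {- pi..pi}" for \<theta>
  proof (cases "\<theta> = - pi")
    case True
    have "cis (- pi) = cis pi" by (simp add: complex_eq_iff)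
    then have "Arg (cis (- pi)) = pi" by (simp add: Arg_cis del: cis_pi)
    then show ?thesis using True per by simp
  next
    case False
    then show ?thesis using that by (simp add: Arg_cis)
  qed
  \<comment> \<open>\<open>Arg\<close> itself is discontinuous at -1, so continuity is read off from
    preimages of closed sets, which are images of compact sets under \<open>cis\<close>.\<close>
  have "continuous_on (sphere 0 1) (\<lambda>z. u (Arg z))"
  proof (rule continuous_on_closed_vimage[OF closed_sphere, THEN iffD2, rule_format])
    fix B :: "complex set" assume B: "closed B"
    have "(\<lambda>z. u (Arg z)) -` B \<inter> sphere 0 1 = cis ` ({- pi..pi} \<inter> u -` B)"
    proof (intro equalityI subsetI)
      fix z assume "z \<in> (\<lambda>z. u (Arg z)) -` B \<inter> sphere 0 1"
      then have "u (Arg z) \<in> B" "cmod z = 1" by auto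
      moreover from \<open>cmod z = 1\<close> have "z \<noteq> 0" by auto
      ultimately show "z \<in> cis ` ({- pi..pi} \<inter> u -` B)"
        using Arg_bounded[of z] cis_Arg[of z] by (intro image_eqI[of _ _ "Arg z"]) (auto simp: sgn_div_norm)
    qed (auto simp: inv)
    moreover have "compact ({- pi..pi} \<inter> u -` B)"
      using continuous_closed_preimage[OF cont closed_atLeastAtMost B]
      by (meson bounded_closed_interval bounded_subset compact_eq_bounded_closed inf_le1)
    ultimately show "closed ((\<lambda>z. u (Arg z)) -` B \<inter> sphere 0 1)"
      by (simp add: compact_imp_closed compact_continuous_image continuous_on_cis)
  qed
  then obtain g where g: "polynomial_function g" "\<And>z. z \<in> sphere 0 1 \<Longrightarrow> cmod (u (Arg z) - g z) < \<epsilon>"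
    using Stone_Weierstrass_polynomial_function[OF compact_sphere _ \<epsilon>, of 0 1 "\<lambda>z. u (Arg z)"] by blast
  have "real_polynomial_function (Re \<circ> g)" "real_polynomial_function (Im \<circ> g)"
    using g(1) bounded_linear_Re bounded_linear_Im unfolding polynomial_function_def by blast+
  then obtain a b where a: "finsupp a" "\<And>\<theta>. complex_of_real (Re (g (cis \<theta>))) = trig_eval a \<theta>"
      and b: "finsupp b" "\<And>\<theta>. complex_of_real (Im (g (cis \<theta>))) = trig_eval b \<theta>"
    using real_polynomial_function_cis[of "Re \<circ> g"] real_polynomial_function_cis[of "Im \<circ> g"] by auto
  define c where "c = a + conv (\<lambda>k. \<i> * unit_seq 0 k) b"
  have i: "finsupp (\<lambda>k. \<i> * unit_seq 0 k)" by (simp add: unit_seq_def)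
  have "trig_eval c \<theta> = g (cis \<theta>)" for \<theta>
  proof -
    have "trig_eval c \<theta> = trig_eval a \<theta> + \<i> * trig_eval b \<theta>"
      unfolding c_def trig_eval_add[OF a(1) finsupp_conv[OF i b(1)]] trig_eval_conv[OF i b(1)] trig_eval_unit_seq by simp
    also have "\<dots> = g (cis \<theta>)"
      unfolding a(2)[symmetric] b(2)[symmetric] by (simp add: complex_eq_iff)
    finally show ?thesis .
  qed
  moreover have "cmod (u \<theta> - g (cis \<theta>)) < \<epsilon>" if "\<theta> \<in> {- pi..pi}" for \<theta>
    using g(2)[of "cis \<theta>"] inv[OF that] by simp
  moreover have "finsupp c"
    unfolding c_def by (intro finsupp_add finsupp_conv a b i)
  ultimately show ?thesis by auto
qed

subsection \<open>Smooth periodic functions\<close>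

lemma periodic_reduce:
  assumes "\<And>t. f (t + 2 * pi) = f t"
  shows "\<exists>s\<in>{- pi..pi}. f t = f s"
proof -
  have nat: "f (t + 2 * pi * real n) = f t" for n t
  proof (induction n)
    case (Suc n)
    have "f (t + 2 * pi * real (Suc n)) = f (t + 2 * pi * real n + 2 * pi)"
      by (simp add: algebra_simps)
    then show ?case using Suc assms by simp
  qed simp
  have int: "f (t + 2 * pi * of_int m) = f t" for m :: int and t
  proof (cases "m \<ge> 0")
    case True
    then show ?thesis using nat[of t "nat m"] by simp
  next
    case False
    then show ?thesis using nat[of "t + 2 * pi * of_int m" "nat (- m)"] by simp
  qed
  define s where "s = t + 2 * pi * of_int (- \<lfloor>(t + pi) / (2 * pi)\<rfloor>)"
  have "of_int \<lfloor>(t + pi) / (2 * pi)\<rfloor> \<le> (t + pi) / (2 * pi)" "(t + pi) / (2 * pi) < of_int \<lfloor>(t + pi) / (2 * pi)\<rfloor> + 1"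
    by linarith+
  then have "of_int \<lfloor>(t + pi) / (2 * pi)\<rfloor> * (2 * pi) \<le> t + pi" "t + pi < (of_int \<lfloor>(t + pi) / (2 * pi)\<rfloor> + 1) * (2 * pi)"
    using pos_le_divide_eq[of "2 * pi"] pos_divide_less_eq[of "2 * pi"] pi_gt_zero
    by (metis mult_pos_pos zero_less_numeral)+
  then have "s \<in> {- pi..pi}" by (simp add: s_def algebra_simps)
  moreover have "f s = f t" unfolding s_def by (rule int)
  ultimately show ?thesis by metis
qed

lemma periodic_continuous_bounded:
  fixes f :: "real \<Rightarrow> complex"
  assumes "\<And>t. f (t + 2 * pi) = f t" "continuous_on UNIV f"
  shows "\<exists>B. \<forall>t. cmod (f t) \<le> B"
proof -
  have "bounded (f ` {- pi..pi})"
    using assms(2) by (intro compact_imp_bounded compact_continuous_image) (auto intro: continuous_on_subset)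
  then obtain B where "\<And>s. s \<in> {- pi..pi} \<Longrightarrow> cmod (f s) \<le> B" by (metis bounded_iff imageI)
  then show ?thesis using periodic_reduce[of f, OF assms(1)] by metis
qed

lemma vderiv_has_vector_derivative:
  "f differentiable (at t) \<Longrightarrow> (f has_vector_derivative vderiv f t) (at t)"
  by (simp add: vderiv_def vector_derivative_works)

lemma vderiv_eqI: "(\<And>t. (f has_vector_derivative g t) (at t)) \<Longrightarrow> vderiv f = g"
  by (auto simp: vderiv_def fun_eq_iff intro: vector_derivative_at)

lemma vderiv_periodic:
  assumes "\<And>t. f (t + 2 * pi) = f t" "\<And>t. f differentiable (at t)"
  shows "vderiv f (t + 2 * pi) = vderiv f t"
proof -
  have "((\<lambda>s. f (s + 2 * pi)) has_vector_derivative 1 *\<^sub>R vderiv f (t + 2 * pi)) (at t)"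
  proof -
    have "((\<lambda>s. s + 2 * pi) has_vector_derivative 1) (at t)"
      by (auto intro!: derivative_eq_intros)
    then show ?thesis
      using vector_diff_chain_at[OF _ vderiv_has_vector_derivative[OF assms(2)], of "\<lambda>s. s + 2 * pi" 1 t]
      by (simp add: o_def)
  qed
  then show ?thesis
    using assms(1) by (simp add: vderiv_def vector_derivative_at)
qed

lemma periodic_smooth_vderiv:
  assumes "u \<in> periodic_smooth"
  shows "vderiv u \<in> periodic_smooth"
proof -
  have "u differentiable (at t)" for t
    using assms unfolding periodic_smooth_def by (auto dest: spec[of _ 0])
  moreover have "(vderiv ^^ k) (vderiv u) differentiable (at t)" for k t
  proof -
    have "(vderiv ^^ k) (vderiv u) = (vderiv ^^ Suc k) u" by (simp only: funpow_Suc_right o_apply)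
    then show ?thesis using assms unfolding periodic_smooth_def by (simp del: funpow.simps)
  qed
  ultimately show ?thesis
    using assms vderiv_periodic[of u] by (auto simp: periodic_smooth_def)
qed

lemma periodic_smooth_funpow: "u \<in> periodic_smooth \<Longrightarrow> (vderiv ^^ k) u \<in> periodic_smooth"
  by (induction k) (auto intro: periodic_smooth_vderiv)

lemma periodic_smooth_periodic: "u \<in> periodic_smooth \<Longrightarrow> u (t + 2 * pi) = u t"
  by (simp add: periodic_smooth_def)

lemma periodic_smooth_differentiable: "u \<in> periodic_smooth \<Longrightarrow> u differentiable (at t)"
  unfolding periodic_smooth_def by (auto dest: spec[of _ 0])

lemma periodic_smooth_continuous: "u \<in> periodic_smooth \<Longrightarrow> continuous_on UNIV u"
  using periodic_smooth_differentiable
  by (metis continuous_at_imp_continuous_on differentiable_imp_continuous_within)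

lemma funpow_vderiv_add:
  assumes "u \<in> periodic_smooth" "v \<in> periodic_smooth"
  shows "(vderiv ^^ k) (\<lambda>t. u t + v t) = (\<lambda>t. (vderiv ^^ k) u t + (vderiv ^^ k) v t)"
proof (induction k)
  case (Suc k)
  have "vderiv (\<lambda>t. (vderiv ^^ k) u t + (vderiv ^^ k) v t) = (\<lambda>t. vderiv ((vderiv ^^ k) u) t + vderiv ((vderiv ^^ k) v) t)"
    using periodic_smooth_differentiable[OF periodic_smooth_funpow] assms
    by (intro vderiv_eqI has_vector_derivative_add vderiv_has_vector_derivative) auto
  then show ?case using Suc by simp
qed simp

lemma funpow_vderiv_scale:
  assumes "u \<in> periodic_smooth"
  shows "(vderiv ^^ k) (\<lambda>t. c * u t) = (\<lambda>t. c * (vderiv ^^ k) u t)"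
proof (induction k)
  case (Suc k)
  have "vderiv (\<lambda>t. c * (vderiv ^^ k) u t) = (\<lambda>t. c * vderiv ((vderiv ^^ k) u) t)"
    using periodic_smooth_differentiable[OF periodic_smooth_funpow] assms
    by (intro vderiv_eqI has_vector_derivative_mult_right vderiv_has_vector_derivative) auto
  then show ?case using Suc by simp
qed simp

lemma periodic_smooth_add:
  assumes "u \<in> periodic_smooth" "v \<in> periodic_smooth"
  shows "(\<lambda>t. u t + v t) \<in> periodic_smooth"
  unfolding periodic_smooth_def
  using assms periodic_smooth_differentiable[OF periodic_smooth_funpow]
  by (auto simp: funpow_vderiv_add periodic_smooth_periodic)

lemma periodic_smooth_scale:
  assumes "u \<in> periodic_smooth"
  shows "(\<lambda>t. c * u t) \<in> periodic_smooth"
  unfolding periodic_smooth_def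
  using assms periodic_smooth_differentiable[OF periodic_smooth_funpow]
  by (auto simp: funpow_vderiv_scale periodic_smooth_periodic)

lemma periodic_smooth_diff:
  assumes "u \<in> periodic_smooth" "v \<in> periodic_smooth"
  shows "(\<lambda>t. u t - v t) \<in> periodic_smooth"
  using periodic_smooth_add[OF assms(1) periodic_smooth_scale[OF assms(2), of "-1"]] by simp

lemma funpow_vderiv_diff:
  assumes "u \<in> periodic_smooth" "v \<in> periodic_smooth"
  shows "(vderiv ^^ k) (\<lambda>t. u t - v t) = (\<lambda>t. (vderiv ^^ k) u t - (vderiv ^^ k) v t)"
  using funpow_vderiv_add[OF assms(1) periodic_smooth_scale[OF assms(2), of "-1"], of k]
  by (simp add: funpow_vderiv_scale[OF assms(2), of k "-1", simplified])

lemma trig_eval_has_vector_derivative: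
  "(trig_eval c has_vector_derivative trig_eval (\<lambda>k. \<i> * of_int k * c k) t) (at t)"
proof (cases "finsupp c")
  case True
  have "((\<lambda>t. \<Sum>k | c k \<noteq> 0. c k * cis (of_int k * t)) has_vector_derivative
      (\<Sum>k | c k \<noteq> 0. c k * (of_int k *\<^sub>R (\<i> * cis (of_int k * t))))) (at t)"
    unfolding has_vector_derivative_def
    by (auto intro!: derivative_eq_intros simp: sum_distrib_left scaleR_sum_right fun_eq_iff scaleR_conv_of_real intro!: sum.cong)
  moreover have "trig_eval (\<lambda>k. \<i> * of_int k * c k) t = (\<Sum>k | c k \<noteq> 0. c k * (of_int k *\<^sub>R (\<i> * cis (of_int k * t))))"
    using True by (subst trig_eval_eq_sum[of "{k. c k \<noteq> 0}"]) (auto intro!: sum.cong simp: scaleR_conv_of_real)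
  ultimately show ?thesis unfolding trig_eval_def[of c] by simp
next
  case False
  \<comment> \<open>Differentiation loses at most the index 0, so the derived sequence is infinitely
    supported as well and both evaluations take the default value 0.\<close>
  have "\<not> finsupp (\<lambda>k. \<i> * of_int k * c k)"
  proof
    assume "finsupp (\<lambda>k. \<i> * of_int k * c k)"
    then have "finite ({k. \<i> * of_int k * c k \<noteq> 0} \<union> {0})" by simp
    then have "finsupp c" by (rule rev_finite_subset) auto
    then show False using False by blast
  qed
  then have "trig_eval c = (\<lambda>t. 0)" "trig_eval (\<lambda>k. \<i> * of_int k * c k) = (\<lambda>t. 0)"
    using False by (auto simp: trig_eval_def fun_eq_iff simp del: mult_eq_0_iff)
  then show ?thesis by simp
qed

lemma funpow_vderiv_trig_eval: "\<exists>d. (vderiv ^^ k) (trig_eval c) = trig_eval d"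
proof (induction k)
  case (Suc k)
  then show ?case using vderiv_eqI[OF trig_eval_has_vector_derivative] by (metis comp_apply funpow.simps(2))
qed auto

lemma trig_eval_periodic_smooth: "trig_eval c \<in> periodic_smooth"
proof -
  have "(vderiv ^^ k) (trig_eval c) differentiable (at t)" for k t
    using funpow_vderiv_trig_eval[of k c] trig_eval_has_vector_derivative
    by (metis differentiableI_vector)
  then show ?thesis by (auto simp: periodic_smooth_def trig_eval_periodic)
qed

lemma cis_periodic_smooth: "(\<lambda>\<theta>. cis (of_int m * \<theta>)) \<in> periodic_smooth"
proof -
  have "(\<lambda>\<theta>. cis (of_int m * \<theta>)) = trig_eval (\<lambda>k. 1 * unit_seq m k)"
    using trig_eval_unit_seq[of 1 m] by (simp add: fun_eq_iff)
  then show ?thesis using trig_eval_periodic_smooth by metis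
qed

text \<open>Approximate the derivative first; its mean vanishes, and the error is integrated over one period.\<close>

lemma trig_dense_smooth:
  assumes "u \<in> periodic_smooth" "\<epsilon> > 0"
  shows "\<exists>c. finsupp c \<and> (\<forall>j\<le>n. \<forall>t. cmod ((vderiv ^^ j) (trig_eval c) t - (vderiv ^^ j) u t) < \<epsilon>)"
  using assms
proof (induction n arbitrary: u \<epsilon>)
  case 0
  have "u (- pi) = u pi" using periodic_smooth_periodic[OF 0(1), of "- pi"] by simp
  then obtain c where c: "finsupp c" "\<And>\<theta>. \<theta> \<in> {- pi..pi} \<Longrightarrow> cmod (u \<theta> - trig_eval c \<theta>) < \<epsilon>"
    using trig_approx[of u \<epsilon>] 0 periodic_smooth_continuous[OF 0(1)]
    by (meson continuous_on_subset subset_UNIV)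
  have "cmod (u t - trig_eval c t) < \<epsilon>" for t
    using periodic_reduce[of "\<lambda>t. u t - trig_eval c t" t] c(2) periodic_smooth_periodic[OF 0(1)] trig_eval_periodic
    by metis
  then show ?case using c(1) by (auto simp: norm_minus_commute)
next
  case (Suc n)
  \<comment> \<open>A derivative error of 2 \<eta>, integrated over a length of at most 2 pi,
    amounts to half of \<epsilon>.\<close>
  define \<eta> where "\<eta> = \<epsilon> / (8 * pi)"
  have \<eta>: "\<eta> > 0" "4 * pi * \<eta> < \<epsilon>" "2 * \<eta> < \<epsilon>"
    using Suc.prems(2) pi_gt3 by (auto simp: \<eta>_def field_simps)
  obtain c where c: "finsupp c" "\<And>j t. j \<le> n \<Longrightarrow> cmod ((vderiv ^^ j) (trig_eval c) t - (vderiv ^^ j) (vderiv u) t) < \<eta>"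
    using Suc.IH[OF periodic_smooth_vderiv[OF Suc.prems(1)] \<eta>(1)] by blast
  \<comment> \<open>Division by zero is 0, so the term k = 0 drops out and P is an antiderivative of
    the polynomial without its mean.\<close>
  define P where "P = trig_eval (\<lambda>k. c k / (\<i> * of_int k))"
  have sm: "vderiv u \<in> periodic_smooth" using periodic_smooth_vderiv Suc.prems(1) by blast
  have Pfin: "finsupp (\<lambda>k. c k / (\<i> * of_int k))"
    by (rule finite_subset[OF _ c(1)]) auto
  have c0: "c 0 = trig_eval (\<lambda>k. c 0 * unit_seq 0 k) t" for t
    by (simp only: trig_eval_unit_seq) simp
  have u0: "finsupp (\<lambda>k. c 0 * unit_seq 0 k)" by (rule finite_subset[of _ "{0}"]) (auto simp: unit_seq_def)
  have dP: "(P has_vector_derivative (trig_eval c t - c 0)) (at t)" for t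
  proof -
    have "(\<lambda>k. \<i> * of_int k * (c k / (\<i> * of_int k))) = c - (\<lambda>k. c 0 * unit_seq 0 k)"
      by (auto simp: fun_eq_iff unit_seq_def)
    then have "trig_eval (\<lambda>k. \<i> * of_int k * (c k / (\<i> * of_int k))) t = trig_eval c t - c 0"
      by (simp only: trig_eval_diff[OF c(1) u0] c0[of t, symmetric])
    then show ?thesis
      using trig_eval_has_vector_derivative[of "\<lambda>k. c k / (\<i> * of_int k)" t] unfolding P_def by simp
  qed
  have vP: "vderiv P = (\<lambda>t. trig_eval c t - c 0)" by (rule vderiv_eqI[OF dP])
  have du: "(u has_vector_derivative vderiv u t) (at t)" for t
    using Suc.prems(1) by (intro vderiv_has_vector_derivative periodic_smooth_differentiable)
  have bound: "cmod (f x - f y) \<le> B * \<bar>x - y\<bar>"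
    if "\<And>t. (f has_vector_derivative f' t) (at t)" "\<And>t. cmod (f' t) \<le> B" for f f' :: "real \<Rightarrow> complex" and B x y
  proof -
    have "norm (f x - f y) \<le> B * norm (x - y)"
    proof (rule differentiable_bound[where S = UNIV and f' = "\<lambda>t h. h *\<^sub>R f' t"])
      show "(f has_derivative (\<lambda>h. h *\<^sub>R f' t)) (at t within UNIV)" for t
        using that(1)[of t] by (simp add: has_vector_derivative_def)
      show "onorm (\<lambda>h. h *\<^sub>R f' t) \<le> B" for t
      proof (rule onorm_le)
        fix h :: real
        show "norm (h *\<^sub>R f' t) \<le> B * norm h"
          using mult_right_mono[OF that(2)[of t], of "\<bar>h\<bar>"] by (simp add: mult.commute)
      qed
    qed auto
    then show ?thesis by simp
  qed
  \<comment> \<open>P and u return to their values after one period, so P t + t c 0 - u t grows by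
    exactly 2 pi c 0, while its derivative is at most \<eta>.\<close>
  have mean: "cmod (c 0) \<le> \<eta>"
  proof -
    have "cmod ((P (2 * pi) + of_real (2 * pi) * c 0 - u (2 * pi)) - (P 0 + of_real 0 * c 0 - u 0)) \<le> \<eta> * \<bar>2 * pi - 0\<bar>"
    proof (rule bound[where f' = "\<lambda>t. trig_eval c t - vderiv u t"])
      show "((\<lambda>t. P t + of_real t * c 0 - u t) has_vector_derivative (trig_eval c t - vderiv u t)) (at t)" for t
        by (rule derivative_eq_intros dP du refl | simp)+
      show "cmod (trig_eval c t - vderiv u t) \<le> \<eta>" for t
        using c(2)[of 0 t] by simp
    qed
    moreover have "P (2 * pi) = P 0" "u (2 * pi) = u 0"
      using trig_eval_periodic[of _ 0] periodic_smooth_periodic[OF Suc.prems(1), of 0] by (simp_all add: P_def)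
    ultimately show ?thesis by (simp add: norm_mult)
  qed
  \<comment> \<open>This constant makes the error vanish at - pi, where the integration of the
    derivative error starts.\<close>
  define z where "z = u (- pi) - P (- pi)"
  define d where "d = (\<lambda>k. c k / (\<i> * of_int k)) + (\<lambda>k. z * unit_seq 0 k)"
  have zfin: "finsupp (\<lambda>k. z * unit_seq 0 k)" by (rule finite_subset[of _ "{0}"]) (auto simp: unit_seq_def)
  have dfin: "finsupp d" unfolding d_def using Pfin zfin by (rule finsupp_add)
  have dev: "trig_eval d = (\<lambda>t. P t + z)"
    unfolding d_def P_def using trig_eval_add[OF Pfin zfin] by (simp only: fun_eq_iff trig_eval_unit_seq) simp
  have dd: "(trig_eval d has_vector_derivative (trig_eval c t - c 0)) (at t)" for t
    unfolding dev by (rule derivative_eq_intros dP refl | simp)+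
  have small: "cmod (trig_eval c t - c 0 - vderiv u t) \<le> 2 * \<eta>" for t
    using c(2)[of 0 t] mean norm_triangle_ineq4[of "trig_eval c t - vderiv u t" "c 0"] by (simp add: algebra_simps)
  have base: "cmod (trig_eval d t - u t) < \<epsilon>" for t
  proof -
    have *: "cmod (trig_eval d s - u s) < \<epsilon>" if "s \<in> {- pi..pi}" for s
    proof -
      have "cmod ((trig_eval d s - u s) - (trig_eval d (- pi) - u (- pi))) \<le> 2 * \<eta> * \<bar>s - (- pi)\<bar>"
        by (rule bound[where f' = "\<lambda>t. trig_eval c t - c 0 - vderiv u t"])
          (auto intro!: has_vector_derivative_diff dd du small)
      also have "\<dots> \<le> 2 * \<eta> * (2 * pi)" using that \<eta>(1) by (intro mult_left_mono) auto
      finally show ?thesis using \<eta>(2) by (simp add: dev z_def mult_ac)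
    qed
    show ?thesis
      using periodic_reduce[of "\<lambda>t. trig_eval d t - u t" t] * periodic_smooth_periodic[OF Suc.prems(1)] trig_eval_periodic
      by metis
  qed
  have "cmod ((vderiv ^^ j) (trig_eval d) t - (vderiv ^^ j) u t) < \<epsilon>" if "j \<le> Suc n" for j t
  proof (cases j)
    case 0
    then show ?thesis using base by simp
  next
    case (Suc i)
    have vd: "vderiv (trig_eval d) = (\<lambda>t. trig_eval c t - trig_eval (\<lambda>k. c 0 * unit_seq 0 k) t)"
      using vderiv_eqI[OF dd] c0 by simp
    have eq: "(vderiv ^^ i) (vderiv (trig_eval d)) t
        = (vderiv ^^ i) (trig_eval c) t - (vderiv ^^ i) (trig_eval (\<lambda>k. c 0 * unit_seq 0 k)) t"
      unfolding vd by (simp add: funpow_vderiv_diff trig_eval_periodic_smooth)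
    have eq': "(vderiv ^^ i) (vderiv (trig_eval d)) t - (vderiv ^^ i) (vderiv u) t
        = (vderiv ^^ i) (trig_eval c) t - (vderiv ^^ i) (vderiv u) t - (vderiv ^^ i) (trig_eval (\<lambda>k. c 0 * unit_seq 0 k)) t"
      by (simp add: eq)
    have "cmod ((vderiv ^^ i) (trig_eval (\<lambda>k. c 0 * unit_seq 0 k)) t) \<le> \<eta>"
    proof -
      have const: "trig_eval (\<lambda>k. c 0 * unit_seq 0 k) = (\<lambda>t. c 0)" using c0 by (simp add: fun_eq_iff)
      show ?thesis
      proof (cases i)
        case 0
        then show ?thesis using mean const by simp
      next
        case (Suc l)
        have "(vderiv ^^ l) (\<lambda>t. 0) = (\<lambda>t. 0::complex)" by (induction l) (auto intro!: vderiv_eqI)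
        moreover have "vderiv (\<lambda>t. c 0) = (\<lambda>t. 0)" by (rule vderiv_eqI) simp
        ultimately show ?thesis using \<eta>(1) Suc by (simp add: const funpow_Suc_right del: funpow.simps)
      qed
    qed
    moreover have "cmod ((vderiv ^^ i) (trig_eval c) t - (vderiv ^^ i) (vderiv u) t) < \<eta>"
      using c(2) that Suc by simp
    ultimately have "cmod ((vderiv ^^ i) (vderiv (trig_eval d)) t - (vderiv ^^ i) (vderiv u) t) < 2 * \<eta>"
      unfolding eq'
      using norm_triangle_ineq4[of "(vderiv ^^ i) (trig_eval c) t - (vderiv ^^ i) (vderiv u) t" "(vderiv ^^ i) (trig_eval (\<lambda>k. c 0 * unit_seq 0 k)) t"]
      by linarith
    then show ?thesis using \<eta>(3) Suc by (simp add: funpow_Suc_right del: funpow.simps)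
  qed
  then show ?case using dfin by blast
qed

subsection \<open>Distributions\<close>

lemma topspace_periodic_smooth: "topspace periodic_smooth_topology = periodic_smooth"
proof -
  have "u \<in> {v \<in> periodic_smooth. smooth_seminorm 0 (\<lambda>t. v t - u t) < 1}" if "u \<in> periodic_smooth" for u
    using that by (simp add: smooth_seminorm_def)
  then have "periodic_smooth \<subseteq> \<Union>{{v \<in> periodic_smooth. smooth_seminorm k (\<lambda>t. v t - u t) < \<epsilon>} | k u \<epsilon>.
        u \<in> periodic_smooth \<and> 0 < \<epsilon>}"
    using zero_less_one by blast
  then show ?thesis
    unfolding periodic_smooth_topology_def topology_generated_by_topspace by blast
qed

lemma seminorm_bdd:
  assumes "u \<in> periodic_smooth"
  shows "bdd_above (range (\<lambda>t. cmod ((vderiv ^^ k) u t)))"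
proof -
  have "(vderiv ^^ k) u \<in> periodic_smooth" using assms by (rule periodic_smooth_funpow)
  then obtain B where "\<And>t. cmod ((vderiv ^^ k) u t) \<le> B"
    using periodic_continuous_bounded periodic_smooth_periodic periodic_smooth_continuous by metis
  then show ?thesis by (intro bdd_aboveI[of _ B]) auto
qed

lemma seminorm_ge: "u \<in> periodic_smooth \<Longrightarrow> cmod ((vderiv ^^ k) u t) \<le> smooth_seminorm k u"
  unfolding smooth_seminorm_def by (rule cSUP_upper[OF _ seminorm_bdd]) auto

text \<open>Each generating set restricts one derivative around a centre of its own. Induction over
  the generated topology yields finitely many derivatives uniformly close to those of u, the form in
  which \<open>trig_dense_smooth\<close> applies.\<close>

lemma periodic_smooth_nhd:
  assumes "openin periodic_smooth_topology U" "u \<in> U"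
  shows "\<exists>n. \<exists>\<epsilon>>0. \<forall>v\<in>periodic_smooth.
    (\<forall>j\<le>n. \<forall>t. cmod ((vderiv ^^ j) v t - (vderiv ^^ j) u t) < \<epsilon>) \<longrightarrow> v \<in> U"
proof -
  have u: "u \<in> periodic_smooth"
    using assms openin_subset topspace_periodic_smooth by blast
  have "generate_topology_on {{v \<in> periodic_smooth. smooth_seminorm k (\<lambda>t. v t - u t) < \<epsilon>} | k u \<epsilon>.
        u \<in> periodic_smooth \<and> 0 < \<epsilon>} U"
    using assms(1) unfolding periodic_smooth_topology_def openin_topology_generated_by_iff .
  then show ?thesis using assms(2)
  proof (induction rule: generate_topology_on.induct)
    case (Int A B)
    obtain n \<epsilon> where A: "\<epsilon> > 0" "\<forall>v\<in>periodic_smooth. (\<forall>j\<le>n. \<forall>t. cmod ((vderiv ^^ j) v t - (vderiv ^^ j) u t) < \<epsilon>) \<longrightarrow> v \<in> A"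
      using Int by auto
    obtain m \<delta> where B: "\<delta> > 0" "\<forall>v\<in>periodic_smooth. (\<forall>j\<le>m. \<forall>t. cmod ((vderiv ^^ j) v t - (vderiv ^^ j) u t) < \<delta>) \<longrightarrow> v \<in> B"
      using Int by auto
    show ?case
      by (rule exI[of _ "max n m"], rule exI[of _ "min \<epsilon> \<delta>"]) (use A B in auto)
  next
    case (UN K)
    then show ?case by (meson UnionE UnionI)
  next
    case (Basis S)
    then obtain k u0 \<epsilon> where S: "S = {v \<in> periodic_smooth. smooth_seminorm k (\<lambda>t. v t - u0 t) < \<epsilon>}"
        "u0 \<in> periodic_smooth" "0 < \<epsilon>" by blast
    \<comment> \<open>Half of the slack that u leaves inside S.\<close>
    define \<delta> where "\<delta> = (\<epsilon> - smooth_seminorm k (\<lambda>t. u t - u0 t)) / 2"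
    have \<delta>: "\<delta> > 0" using Basis S by (simp add: \<delta>_def)
    have "v \<in> S" if v: "v \<in> periodic_smooth" "\<forall>j\<le>k. \<forall>t. cmod ((vderiv ^^ j) v t - (vderiv ^^ j) u t) < \<delta>" for v
    proof -
      have "smooth_seminorm k (\<lambda>t. v t - u0 t) \<le> \<delta> + smooth_seminorm k (\<lambda>t. u t - u0 t)"
        unfolding smooth_seminorm_def[of k "\<lambda>t. v t - u0 t"]
      proof (rule cSUP_least)
        fix t
        have "cmod ((vderiv ^^ k) (\<lambda>t. v t - u0 t) t) \<le> cmod ((vderiv ^^ k) v t - (vderiv ^^ k) u t) + cmod ((vderiv ^^ k) (\<lambda>t. u t - u0 t) t)"
          unfolding funpow_vderiv_diff[OF v(1) S(2)] funpow_vderiv_diff[OF u S(2)]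
          using norm_triangle_ineq[of "(vderiv ^^ k) v t - (vderiv ^^ k) u t" "(vderiv ^^ k) u t - (vderiv ^^ k) u0 t"] by simp
        also have "\<dots> \<le> \<delta> + smooth_seminorm k (\<lambda>t. u t - u0 t)"
          using v(2)[rule_format, of k t] by (intro add_mono seminorm_ge periodic_smooth_diff u S(2)) auto
        finally show "cmod ((vderiv ^^ k) (\<lambda>t. v t - u0 t) t) \<le> \<delta> + smooth_seminorm k (\<lambda>t. u t - u0 t)" .
      qed simp
      also have "\<dots> < \<epsilon>" using \<delta> by (simp add: \<delta>_def field_simps)
      finally show ?thesis using v(1) S(1) by simp
    qed
    then show ?case using \<delta> by blast
  qed simp
qed

lemma
  assumes "a \<in> periodic_distributions"
  shows distribution_add: "u \<in> periodic_smooth \<Longrightarrow> v \<in> periodic_smooth \<Longrightarrow> a (\<lambda>t. u t + v t) = a u + a v"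
    and distribution_scale: "u \<in> periodic_smooth \<Longrightarrow> a (\<lambda>t. c * u t) = c * a u"
    and distribution_continuous: "continuous_map periodic_smooth_topology euclidean a"
    and distribution_outside: "u \<notin> periodic_smooth \<Longrightarrow> a u = 0"
  using assms unfolding periodic_distributions_def by simp_all

lemma distribution_sum:
  assumes a: "a \<in> periodic_distributions" and "finite A" "\<And>k. k \<in> A \<Longrightarrow> u k \<in> periodic_smooth"
  shows "(\<lambda>t. \<Sum>k\<in>A. c k * u k t) \<in> periodic_smooth \<and> a (\<lambda>t. \<Sum>k\<in>A. c k * u k t) = (\<Sum>k\<in>A. c k * a (u k))"
  using assms(2,3)
proof (induction rule: finite_induct)
  case empty
  have z: "(\<lambda>t. 0) \<in> periodic_smooth" using periodic_smooth_scale[OF cis_periodic_smooth, of 0] by simp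
  then show ?case using distribution_scale[OF a z, of 0] by simp
next
  case (insert k A)
  have 1: "(\<lambda>t. c k * u k t) \<in> periodic_smooth" using insert by (intro periodic_smooth_scale) auto
  have 2: "(\<lambda>t. \<Sum>k\<in>A. c k * u k t) \<in> periodic_smooth" "a (\<lambda>t. \<Sum>k\<in>A. c k * u k t) = (\<Sum>k\<in>A. c k * a (u k))"
    using insert by auto
  have "a (\<lambda>t. c k * u k t + (\<Sum>k\<in>A. c k * u k t)) = a (\<lambda>t. c k * u k t) + a (\<lambda>t. \<Sum>k\<in>A. c k * u k t)"
    using 1 2(1) by (rule distribution_add[OF a])
  also have "a (\<lambda>t. c k * u k t) = c k * a (u k)"
    using insert by (intro distribution_scale[OF a]) auto
  finally show ?case using insert 2 periodic_smooth_add[OF 1 2(1)] by simp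
qed

lemma distribution_trig_eval:
  assumes "a \<in> periodic_distributions" "finsupp c"
  shows "a (trig_eval c) = (\<Sum>k | c k \<noteq> 0. c k * fourier_coeff a (- k))"
  using distribution_sum[OF assms, of "\<lambda>k \<theta>. cis (of_int k * \<theta>)" c] cis_periodic_smooth
  unfolding trig_eval_def[abs_def] fourier_coeff_def by simp

text \<open>Trigonometric polynomials are dense and both functionals are continuous. This justifies
  working with coefficient sequences instead of distributions.\<close>

lemma distribution_eqI:
  assumes a: "a \<in> periodic_distributions" and b: "b \<in> periodic_distributions"
    and eq: "fourier_coeff a = fourier_coeff b"
  shows "a = b"
proof
  fix u
  show "a u = b u"
  proof (cases "u \<in> periodic_smooth")
    case False
    then show ?thesis using distribution_outside[OF a] distribution_outside[OF b] by simp
  next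
    case u: True
    have op: "openin periodic_smooth_topology {v \<in> periodic_smooth. d v \<in> ball (d u) \<epsilon>}"
      if "d \<in> periodic_distributions" for d \<epsilon>
      using that openin_continuous_map_preimage[of periodic_smooth_topology euclidean d "ball (d u) \<epsilon>"]
      by (simp add: distribution_continuous topspace_periodic_smooth)
    show ?thesis
    proof (rule ccontr)
      assume ne: "a u \<noteq> b u"
      define \<epsilon> where "\<epsilon> = dist (a u) (b u) / 2"
      have \<epsilon>: "\<epsilon> > 0" using ne by (simp add: \<epsilon>_def)
      let ?U = "{v \<in> periodic_smooth. a v \<in> ball (a u) \<epsilon>} \<inter> {v \<in> periodic_smooth. b v \<in> ball (b u) \<epsilon>}"
      have "openin periodic_smooth_topology ?U" "u \<in> ?U"
        using op[OF a] op[OF b] u \<epsilon> by auto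
      then obtain n \<delta> where nd: "\<delta> > 0" "\<forall>v\<in>periodic_smooth.
          (\<forall>j\<le>n. \<forall>t. cmod ((vderiv ^^ j) v t - (vderiv ^^ j) u t) < \<delta>) \<longrightarrow> v \<in> ?U"
        using periodic_smooth_nhd by meson
      obtain c where c: "finsupp c" "\<forall>j\<le>n. \<forall>t. cmod ((vderiv ^^ j) (trig_eval c) t - (vderiv ^^ j) u t) < \<delta>"
        using trig_dense_smooth[OF u nd(1)] by blast
      have "trig_eval c \<in> ?U" using nd(2) c(2) trig_eval_periodic_smooth by blast
      then have "dist (a u) (a (trig_eval c)) < \<epsilon>" "dist (b u) (b (trig_eval c)) < \<epsilon>" by auto
      moreover have "a (trig_eval c) = b (trig_eval c)"
        using a b c(1) eq by (simp add: distribution_trig_eval)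
      ultimately show False
        using dist_triangle_less_add[of "a u" "a (trig_eval c)" \<epsilon> "b u" \<epsilon>] by (simp add: \<epsilon>_def dist_commute)
    qed
  qed
qed

section \<open>Integration over one period\<close>

abbreviation circle_measure :: "real measure" where
  "circle_measure \<equiv> lebesgue_on {- pi<..<pi}"

interpretation circle: finite_measure circle_measure
  by (rule finite_measureI) (simp add: emeasure_restrict_space)

lemma circle_measurable_cont:
  fixes g :: "real \<Rightarrow> 'a::topological_space"
  assumes "continuous_on UNIV g"
  shows "g \<in> borel_measurable circle_measure"
  using borel_measurable_continuous_onI[OF assms] by (intro measurable_restrict_space1 measurable_completion) auto

lemma circle_integrable:
  fixes f :: "real \<Rightarrow> 'b::{banach, second_countable_topology}"
  assumes "f \<in> borel_measurable circle_measure" "AE t in circle_measure. norm (f t) \<le> C"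
  shows "integrable circle_measure f"
  using assms by (intro circle.integrable_const_bound[of _ C]) auto

lemma circle_integral_bound:
  fixes f :: "real \<Rightarrow> complex"
  assumes "f \<in> borel_measurable circle_measure" "AE t in circle_measure. cmod (f t) \<le> C"
  shows "cmod (integral\<^sup>L circle_measure f) \<le> 2 * pi * C"
proof -
  have int: "integrable circle_measure f" using assms by (rule circle_integrable)
  have "cmod (integral\<^sup>L circle_measure f) \<le> (\<integral>t. cmod (f t) \<partial>circle_measure)" by simp
  also have "\<dots> \<le> (\<integral>t. C \<partial>circle_measure)"
    using int assms(2) by (intro integral_mono_AE) auto
  also have "\<dots> = 2 * pi * C"
    by (simp add: measure_restrict_space)
  finally show ?thesis .
qed

lemma circle_integral_cis:
  "(\<integral>t. cis (of_int k * t) \<partial>circle_measure) = (if k = 0 then 2 * pi else 0)"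
proof (cases "k = 0")
  case True
  then show ?thesis by (simp add: measure_restrict_space scaleR_conv_of_real)
next
  case False
  have int: "integrable circle_measure (\<lambda>t. cis (of_int k * t))"
    by (rule circle_integrable[of _ 1]) (auto intro!: circle_measurable_cont continuous_intros)
  have "((\<lambda>t. cis (of_int k * t)) has_integral cis (of_int k * pi) / (\<i> * of_int k) - cis (of_int k * (- pi)) / (\<i> * of_int k)) {- pi..pi}"
  proof (rule fundamental_theorem_of_calculus)
    fix t assume "t \<in> {- pi..pi}"
    show "((\<lambda>t. cis (of_int k * t) / (\<i> * of_int k)) has_vector_derivative cis (of_int k * t)) (at t within {- pi..pi})"
      unfolding has_vector_derivative_def using False
      by (auto intro!: derivative_eq_intros simp: fun_eq_iff scaleR_conv_of_real field_simps)
  qed simp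
  moreover have "cis (of_int k * pi) = cis (of_int k * (- pi))"
  proof -
    have "cis (of_int k * pi) = cis (of_int k * (- pi)) * cis (2 * pi * of_int k)"
      by (simp add: cis_mult algebra_simps)
    then show ?thesis by (simp add: cis_multiple_2pi)
  qed
  ultimately have "((\<lambda>t. cis (of_int k * t)) has_integral 0) {- pi..pi}" by simp
  then have "((\<lambda>t. cis (of_int k * t)) has_integral 0) {- pi<..<pi}"
    by (simp add: has_integral_Icc_iff_Ioo)
  then show ?thesis
    using False by (simp add: lebesgue_integral_eq_integral[OF int] integral_unique)
qed

lemma circle_integral_mult_trig_eval:
  assumes f: "f \<in> borel_measurable circle_measure" "AE t in circle_measure. cmod (f t) \<le> C"
  shows "(\<integral>t. f t * trig_eval c t \<partial>circle_measure) = (\<Sum>k | c k \<noteq> 0. c k * (\<integral>t. f t * cis (of_int k * t) \<partial>circle_measure))"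
proof -
  have int: "integrable circle_measure (\<lambda>t. f t * cis (of_int k * t))" for k
  proof (rule circle_integrable)
    show "(\<lambda>t. f t * cis (of_int k * t)) \<in> borel_measurable circle_measure"
      by (intro borel_measurable_times f(1) circle_measurable_cont continuous_intros)
    show "AE t in circle_measure. cmod (f t * cis (of_int k * t)) \<le> C"
      using f(2) by (simp add: norm_mult)
  qed
  have "(\<integral>t. f t * trig_eval c t \<partial>circle_measure) = (\<integral>t. (\<Sum>k | c k \<noteq> 0. c k * (f t * cis (of_int k * t))) \<partial>circle_measure)"
    by (simp add: trig_eval_def sum_distrib_left mult.left_commute)
  also have "\<dots> = (\<Sum>k | c k \<noteq> 0. (\<integral>t. c k * (f t * cis (of_int k * t)) \<partial>circle_measure))"
    by (rule Bochner_Integration.integral_sum) (intro integrable_mult_right int)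
  also have "\<dots> = (\<Sum>k | c k \<noteq> 0. c k * (\<integral>t. f t * cis (of_int k * t) \<partial>circle_measure))"
    using int by simp
  finally show ?thesis .
qed

lemma circle_integral_trig_eval:
  fixes c :: "int \<Rightarrow> complex"
  assumes "finsupp c"
  shows "(\<integral>t. trig_eval c t \<partial>circle_measure) = of_real (2 * pi) * c 0"
proof -
  have "(\<integral>t. 1 * trig_eval c t \<partial>circle_measure) = (\<Sum>k | c k \<noteq> 0. c k * (\<integral>t. 1 * cis (of_int k * t) \<partial>circle_measure))"
    by (rule circle_integral_mult_trig_eval[of "\<lambda>_. 1" 1]) auto
  also have "\<dots> = (\<Sum>k | c k \<noteq> 0. if k = 0 then c 0 * (2 * pi) else 0)"
    by (intro sum.cong refl) (auto simp: circle_integral_cis)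
  also have "\<dots> = of_real (2 * pi) * c 0" using assms by simp
  finally show ?thesis by simp
qed

lemma distr_of_eq:
  assumes "u \<in> periodic_smooth"
  shows "distr_of f u = (\<integral>t. f t * u t \<partial>circle_measure) / (2 * pi)"
  using assms by (simp add: distr_of_def set_lebesgue_integral_def integral_restrict_space)

lemma fourier_coeff_distr_of:
  "fourier_coeff (distr_of f) n = (\<integral>t. f t * cis (of_int (- n) * t) \<partial>circle_measure) / (2 * pi)"
  unfolding fourier_coeff_def by (rule distr_of_eq[OF cis_periodic_smooth])

lemma fourier_coeff_trig_eval:
  assumes "finsupp c"
  shows "fourier_coeff (distr_of (trig_eval c)) n = c n"
proof -
  have fin: "finsupp (unit_seq (- n))" by (simp add: unit_seq_def)
  have "cis (of_int (- n) * t) = trig_eval (unit_seq (- n)) t" for t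
    using trig_eval_unit_seq[of 1 "- n" t] by simp
  then have "(\<integral>t. trig_eval c t * cis (of_int (- n) * t) \<partial>circle_measure) = (\<integral>t. trig_eval (conv c (unit_seq (- n))) t \<partial>circle_measure)"
    by (simp only: trig_eval_conv[OF assms fin])
  also have "\<dots> = of_real (2 * pi) * c n"
    by (subst circle_integral_trig_eval[OF finsupp_conv[OF assms fin]]) (simp add: conv_unit_seq)
  finally show ?thesis by (simp add: fourier_coeff_distr_of)
qed

text \<open>Continuity comes from the seminorm of order 0 alone, since the functional is bounded by
  |C| times the supremum of u.\<close>

lemma distr_of_distribution:
  assumes f: "f \<in> borel_measurable circle_measure" "AE t in circle_measure. cmod (f t) \<le> C"
  shows "distr_of f \<in> periodic_distributions"
proof -
  have meas: "u \<in> borel_measurable circle_measure" if "u \<in> periodic_smooth" for u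
    using that by (intro circle_measurable_cont periodic_smooth_continuous)
  have int: "integrable circle_measure (\<lambda>t. f t * u t)" if u: "u \<in> periodic_smooth" for u
  proof -
    obtain B where B: "\<And>t. cmod (u t) \<le> B"
      using periodic_continuous_bounded periodic_smooth_periodic[OF u] periodic_smooth_continuous[OF u] by metis
    show ?thesis
    proof (rule circle_integrable)
      show "AE t in circle_measure. cmod (f t * u t) \<le> \<bar>C\<bar> * B"
        using f(2) by eventually_elim (auto simp: norm_mult intro!: mult_mono B)
    qed (use f meas[OF u] in auto)
  qed
  have bound: "cmod (distr_of f u) \<le> \<bar>C\<bar> * B"
    if u: "u \<in> periodic_smooth" and B: "\<And>t. cmod (u t) \<le> B" for u B
  proof -
    have "cmod (\<integral>t. f t * u t \<partial>circle_measure) \<le> 2 * pi * (\<bar>C\<bar> * B)"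
    proof (rule circle_integral_bound)
      show "AE t in circle_measure. cmod (f t * u t) \<le> \<bar>C\<bar> * B"
        using f(2) by eventually_elim (auto simp: norm_mult intro!: mult_mono B)
    qed (use f meas[OF u] in auto)
    then show ?thesis by (simp add: distr_of_eq[OF u] norm_divide field_simps)
  qed
  have add: "distr_of f (\<lambda>t. u t + v t) = distr_of f u + distr_of f v" if "u \<in> periodic_smooth" "v \<in> periodic_smooth" for u v
    using that by (simp add: distr_of_eq periodic_smooth_add distrib_left int add_divide_distrib)
  have scale: "distr_of f (\<lambda>t. c * u t) = c * distr_of f u" if "u \<in> periodic_smooth" for c u
    using that by (simp add: distr_of_eq periodic_smooth_scale mult.left_commute)
  have diff: "distr_of f v - distr_of f u = distr_of f (\<lambda>t. v t - u t)" if "u \<in> periodic_smooth" "v \<in> periodic_smooth" for u v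
    using that by (simp add: distr_of_eq periodic_smooth_diff right_diff_distrib int diff_divide_distrib)
  have "continuous_map periodic_smooth_topology euclidean (distr_of f)"
    unfolding continuous_map_def topspace_periodic_smooth
  proof (intro conjI allI impI)
    fix U :: "complex set" assume "openin euclidean U"
    then have U: "open U" by simp
    show "openin periodic_smooth_topology {u \<in> periodic_smooth. distr_of f u \<in> U}"
    proof (subst openin_subopen, intro ballI)
      fix u assume "u \<in> {u \<in> periodic_smooth. distr_of f u \<in> U}"
      then have u: "u \<in> periodic_smooth" "distr_of f u \<in> U" by auto
      obtain e where e: "e > 0" "ball (distr_of f u) e \<subseteq> U" using U u(2) open_contains_ball by blast
      define \<delta> where "\<delta> = e / (\<bar>C\<bar> + 1)"
      have \<delta>: "\<delta> > 0" using e by (simp add: \<delta>_def)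
      let ?S = "{v \<in> periodic_smooth. smooth_seminorm 0 (\<lambda>t. v t - u t) < \<delta>}"
      have "openin periodic_smooth_topology ?S"
        unfolding periodic_smooth_topology_def using u(1) \<delta> by (intro topology_generated_by_Basis) blast
      moreover have "u \<in> ?S" using u(1) \<delta> by (simp add: smooth_seminorm_def)
      moreover have "?S \<subseteq> {u \<in> periodic_smooth. distr_of f u \<in> U}"
      proof
        fix v assume v: "v \<in> ?S"
        then have vp: "v \<in> periodic_smooth" by simp
        have "cmod (v t - u t) \<le> \<delta>" for t
        proof -
          have "cmod (v t - u t) \<le> smooth_seminorm 0 (\<lambda>t. v t - u t)"
            using seminorm_ge[OF periodic_smooth_diff[OF vp u(1)], of 0 t] by simp
          also have "\<dots> \<le> \<delta>" using v by simp
          finally show ?thesis .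
        qed
        then have "cmod (distr_of f (\<lambda>t. v t - u t)) \<le> \<bar>C\<bar> * \<delta>"
          by (intro bound periodic_smooth_diff vp u)
        also have "\<dots> < e" using e(1) by (simp add: \<delta>_def field_simps)
        finally have "distr_of f v \<in> ball (distr_of f u) e"
          by (simp add: dist_norm norm_minus_commute diff[OF u(1) vp, symmetric])
        then show "v \<in> {u \<in> periodic_smooth. distr_of f u \<in> U}" using e(2) vp by auto
      qed
      ultimately show "\<exists>T. openin periodic_smooth_topology T \<and> u \<in> T \<and> T \<subseteq> {u \<in> periodic_smooth. distr_of f u \<in> U}" by blast
    qed
  qed auto
  then show ?thesis
    unfolding periodic_distributions_def using add scale by (auto simp: distr_of_def)
qed

subsection \<open>Bounded symbols\<close>

text \<open>By uniform approximation h annihilates every continuous u with equal end values. Such u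
  approximate the conjugate of h boundedly and almost everywhere, so the integral of |h|^2
  vanishes.\<close>

lemma Linf_coeff_zero:
  assumes h: "h \<in> borel_measurable circle_measure" "AE t in circle_measure. cmod (h t) \<le> C"
    and zero: "\<And>k. (\<integral>t. h t * cis (of_int k * t) \<partial>circle_measure) = 0"
  shows "AE t in circle_measure. h t = 0"
proof -
  define K where "K = \<bar>C\<bar> + 1"
  have K: "K > 0" "AE t in circle_measure. cmod (h t) \<le> K"
    using h(2) by (auto simp: K_def elim: eventually_mono)
  have "(\<lambda>t. cnj (h t)) \<in> borel_measurable circle_measure"
    using h(1) by (rule measurable_compose) (intro borel_measurable_continuous_onI continuous_intros)
  then have "(\<lambda>t. cnj (h t)) measurable_on {- pi<..<pi}"
    by (subst measurable_on_iff_borel_measurable) auto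
  then obtain N g where N: "negligible N" and g: "\<And>n. continuous_on UNIV (g n)"
      and lim: "\<And>x. x \<notin> N \<Longrightarrow> (\<lambda>n. g n x) \<longlonglongrightarrow> (if x \<in> {- pi<..<pi} then cnj (h x) else 0)"
    unfolding measurable_on_def by blast
  \<comment> \<open>The radial retraction onto the disc of radius K bounds the approximants, as
    dominated convergence requires, and fixes almost all values of the conjugate of h.\<close>
  define cl where "cl z = z * of_real (K / max K (cmod z))" for z
  have cl_cont: "continuous_on UNIV cl"
    unfolding cl_def using K(1) by (intro continuous_intros) auto
  have cl_id: "cl z = z" if "cmod z \<le> K" for z
    using that K(1) by (simp add: cl_def)
  have cl_le: "cmod (cl z) \<le> K" for z
    using K(1) by (auto simp: cl_def norm_mult norm_divide max_def field_simps)
  \<comment> \<open>A taper that is 0 at both end points, so that \<open>trig_approx\<close>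
    applies, and eventually 1 at each interior point.\<close>
  define cut where "cut n t = min 1 (real n * (pi - \<bar>t\<bar>))" for n t
  define u where "u n t = of_real (cut n t) * cl (g n t)" for n t
  have cut_cont: "continuous_on S (cut n)" for n S
    unfolding cut_def by (intro continuous_intros)
  have u_cont: "continuous_on UNIV (u n)" for n
    unfolding u_def by (intro continuous_intros cut_cont continuous_on_compose2[OF cl_cont g]) auto
  have u_le: "cmod (u n t) \<le> K" if "t \<in> {- pi..pi}" for n t
  proof -
    have "\<bar>cut n t\<bar> \<le> 1" using that by (auto simp: cut_def abs_le_iff)
    then have "\<bar>cut n t\<bar> * cmod (cl (g n t)) \<le> 1 * K" using cl_le by (intro mult_mono) auto
    then show ?thesis by (simp add: u_def norm_mult)
  qed
  have u_meas: "u n \<in> borel_measurable circle_measure" for n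
    by (rule circle_measurable_cont[OF u_cont])
  have in_circle: "AE t in circle_measure. t \<in> {- pi<..<pi}"
    using AE_space[of circle_measure] by simp
  have u_zero: "(\<integral>t. h t * u n t \<partial>circle_measure) = 0" for n
  proof (rule ccontr)
    assume ne: "(\<integral>t. h t * u n t \<partial>circle_measure) \<noteq> 0"
    \<comment> \<open>Chosen so that the error bound 2 pi K \<epsilon> is half of the integral that
      is to be excluded.\<close>
    define \<epsilon> where "\<epsilon> = cmod (\<integral>t. h t * u n t \<partial>circle_measure) / (4 * pi * K)"
    have \<epsilon>: "\<epsilon> > 0" using ne K(1) by (simp add: \<epsilon>_def)
    have "u n (- pi) = u n pi" by (simp add: u_def cut_def)
    then obtain c where c: "finsupp c" "\<And>t. t \<in> {- pi..pi} \<Longrightarrow> cmod (u n t - trig_eval c t) < \<epsilon>"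
      using trig_approx[of "u n" \<epsilon>] u_cont \<epsilon> by (meson continuous_on_subset subset_UNIV)
    have ev_meas: "trig_eval c \<in> borel_measurable circle_measure"
      by (intro circle_measurable_cont continuous_on_trig_eval)
    have "(\<integral>t. h t * trig_eval c t \<partial>circle_measure) = 0"
      by (simp add: circle_integral_mult_trig_eval[OF h] zero)
    moreover have "(\<integral>t. h t * (u n t - trig_eval c t) \<partial>circle_measure) = (\<integral>t. h t * u n t \<partial>circle_measure) - (\<integral>t. h t * trig_eval c t \<partial>circle_measure)"
    proof -
      have "integrable circle_measure (\<lambda>t. h t * u n t)"
      proof (rule circle_integrable)
        show "AE t in circle_measure. cmod (h t * u n t) \<le> K * K"
          using K(2) in_circle by eventually_elim (use K(1) in \<open>auto simp: norm_mult intro!: mult_mono u_le\<close>)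
      qed (use h u_meas in auto)
      moreover obtain B where B: "\<And>t. cmod (trig_eval c t) \<le> B"
        using periodic_continuous_bounded[of "trig_eval c"] trig_eval_periodic continuous_on_trig_eval by metis
      have "integrable circle_measure (\<lambda>t. h t * trig_eval c t)"
      proof (rule circle_integrable)
        show "AE t in circle_measure. cmod (h t * trig_eval c t) \<le> K * B"
          using K(2) by eventually_elim (use K(1) B in \<open>auto simp: norm_mult intro!: mult_mono\<close>)
      qed (use h ev_meas in auto)
      ultimately show ?thesis by (simp add: right_diff_distrib)
    qed
    moreover have "cmod (\<integral>t. h t * (u n t - trig_eval c t) \<partial>circle_measure) \<le> 2 * pi * (K * \<epsilon>)"
    proof (rule circle_integral_bound)
      show "AE t in circle_measure. cmod (h t * (u n t - trig_eval c t)) \<le> K * \<epsilon>"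
        using K(2) in_circle
      proof eventually_elim
        case (elim t)
        then have "cmod (u n t - trig_eval c t) \<le> \<epsilon>" using c(2)[of t] by auto
        then show ?case using elim K(1) by (auto simp: norm_mult intro!: mult_mono)
      qed
    qed (use h u_meas ev_meas in auto)
    ultimately have "cmod (\<integral>t. h t * u n t \<partial>circle_measure) \<le> 2 * pi * (K * \<epsilon>)" by simp
    also have "\<dots> = cmod (\<integral>t. h t * u n t \<partial>circle_measure) / 2" using K(1) by (simp add: \<epsilon>_def)
    finally show False using ne by simp
  qed
  have notN: "AE t in circle_measure. t \<notin> N"
  proof -
    have "AE t in lebesgue. t \<notin> N"
      using N negligible_iff_null_sets AE_not_in by blast
    then show ?thesis by (subst AE_restrict_space_iff) auto
  qed
  have "(\<lambda>n. \<integral>t. h t * u n t \<partial>circle_measure) \<longlonglongrightarrow> (\<integral>t. h t * cnj (h t) \<partial>circle_measure)"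
  proof (rule integral_dominated_convergence[where w = "\<lambda>_. K * K"])
    show "AE t in circle_measure. (\<lambda>n. h t * u n t) \<longlonglongrightarrow> h t * cnj (h t)"
      using K(2) in_circle notN
    proof eventually_elim
      case (elim t)
      have "(\<lambda>n. g n t) \<longlonglongrightarrow> cnj (h t)" using lim[of t] elim by simp
      then have "(\<lambda>n. cl (g n t)) \<longlonglongrightarrow> cl (cnj (h t))"
        using cl_cont by (metis UNIV_I continuous_on_tendsto_compose eventually_sequentiallyI)
      moreover have "cl (cnj (h t)) = cnj (h t)" using elim by (intro cl_id) simp
      moreover have "(\<lambda>n. cut n t) \<longlonglongrightarrow> 1"
      proof (rule tendsto_eventually)
        have pos: "pi - \<bar>t\<bar> > 0" using elim by auto
        obtain M :: nat where "1 / (pi - \<bar>t\<bar>) < M" using reals_Archimedean2 by blast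
        then have M: "1 \<le> real M * (pi - \<bar>t\<bar>)" using pos by (simp add: field_simps)
        have "cut n t = 1" if "n \<ge> M" for n
        proof -
          have "real M * (pi - \<bar>t\<bar>) \<le> real n * (pi - \<bar>t\<bar>)" using that pos by (intro mult_right_mono) auto
          then show ?thesis using M by (simp add: cut_def)
        qed
        then show "\<forall>\<^sub>F n in sequentially. cut n t = 1" by (auto simp: eventually_sequentially)
      qed
      ultimately have "(\<lambda>n. h t * (of_real (cut n t) * cl (g n t))) \<longlonglongrightarrow> h t * (of_real 1 * cnj (h t))"
        by (intro tendsto_intros) auto
      then show ?case by (simp add: u_def)
    qed
    show "AE t in circle_measure. cmod (h t * u n t) \<le> K * K" for n
      using K(2) in_circle by eventually_elim (use K(1) in \<open>auto simp: norm_mult intro!: mult_mono u_le\<close>)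
    show "(\<lambda>t. h t * cnj (h t)) \<in> borel_measurable circle_measure"
      using h(1) \<open>(\<lambda>t. cnj (h t)) \<in> borel_measurable circle_measure\<close> by (rule borel_measurable_times)
  qed (use h u_meas in auto)
  then have "(\<integral>t. h t * cnj (h t) \<partial>circle_measure) = 0"
    by (simp add: u_zero LIMSEQ_const_iff)
  then have "(\<integral>t. complex_of_real ((cmod (h t))\<^sup>2) \<partial>circle_measure) = 0"
    by (simp only: complex_norm_square)
  then have "(\<integral>t. (cmod (h t))\<^sup>2 \<partial>circle_measure) = 0"
    by (simp only: integral_complex_of_real of_real_eq_0_iff)
  moreover have "integrable circle_measure (\<lambda>t. (cmod (h t))\<^sup>2)"
  proof (rule circle_integrable)
    show "AE t in circle_measure. norm ((cmod (h t))\<^sup>2) \<le> K\<^sup>2"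
      using K(2) by eventually_elim (auto intro: power_mono)
  qed (use h in auto)
  ultimately have "AE t in circle_measure. (cmod (h t))\<^sup>2 = 0"
    by (subst (asm) integral_nonneg_eq_0_iff_AE) auto
  then show ?thesis by eventually_elim simp
qed


lemma Linf_eqI:
  assumes f: "f \<in> borel_measurable circle_measure" "AE t in circle_measure. cmod (f t) \<le> A"
    and g: "g \<in> borel_measurable circle_measure" "AE t in circle_measure. cmod (g t) \<le> B"
    and eq: "fourier_coeff (distr_of f) = fourier_coeff (distr_of g)"
  shows "AE t in circle_measure. f t = g t"
proof -
  have cis_meas: "(\<lambda>t. cis (of_int k * t)) \<in> borel_measurable circle_measure" for k
    by (intro circle_measurable_cont continuous_intros)
  have int: "integrable circle_measure (\<lambda>t. h t * cis (of_int k * t))"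
    if "h \<in> borel_measurable circle_measure" "AE t in circle_measure. cmod (h t) \<le> C" for h C k
    by (rule circle_integrable[of _ C]) (use that cis_meas in \<open>auto simp: norm_mult\<close>)
  have "AE t in circle_measure. f t - g t = 0"
  proof (rule Linf_coeff_zero)
    show "AE t in circle_measure. cmod (f t - g t) \<le> A + B"
      using f(2) g(2) by eventually_elim (metis add_mono norm_triangle_ineq4 order.trans)
    fix k
    have "(\<integral>t. f t * cis (of_int k * t) \<partial>circle_measure) = (\<integral>t. g t * cis (of_int k * t) \<partial>circle_measure)"
      using fun_cong[OF eq, of "- k"] by (simp add: fourier_coeff_distr_of)
    then show "(\<integral>t. (f t - g t) * cis (of_int k * t) \<partial>circle_measure) = 0"
      by (simp add: left_diff_distrib int[OF f] int[OF g])
  qed (use f g in auto)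
  then show ?thesis by eventually_elim simp
qed

lemma circle_integral_L1_tendsto:
  assumes f: "f \<in> borel_measurable circle_measure" "AE t in circle_measure. cmod (f t) \<le> A"
    and p: "\<And>n. p n \<in> borel_measurable circle_measure" "\<And>n. AE t in circle_measure. cmod (p n t) \<le> B n"
    and g: "g \<in> borel_measurable circle_measure" "AE t in circle_measure. cmod (g t) \<le> C"
    and lim: "(\<lambda>n. \<integral>t. cmod (p n t - f t) \<partial>circle_measure) \<longlonglongrightarrow> 0"
  shows "(\<lambda>n. \<integral>t. g t * p n t \<partial>circle_measure) \<longlonglongrightarrow> (\<integral>t. g t * f t \<partial>circle_measure)"
proof -
  have int: "integrable circle_measure (\<lambda>t. g t * h t)"
    if "h \<in> borel_measurable circle_measure" "AE t in circle_measure. cmod (h t) \<le> D" for h D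
  proof (rule circle_integrable)
    show "AE t in circle_measure. cmod (g t * h t) \<le> \<bar>C\<bar> * D"
      using that(2) g(2) by eventually_elim (auto simp: norm_mult intro!: mult_mono)
  qed (use that g in auto)
  have int': "integrable circle_measure (\<lambda>t. cmod (p n t - f t))" for n
  proof (rule circle_integrable)
    show "AE t in circle_measure. norm (cmod (p n t - f t)) \<le> B n + A"
      using p(2)[of n] f(2)
    proof eventually_elim
      case (elim t)
      then show ?case using norm_triangle_ineq4[of "p n t" "f t"] by simp
    qed
  qed (use p f in auto)
  have "cmod ((\<integral>t. g t * p n t \<partial>circle_measure) - (\<integral>t. g t * f t \<partial>circle_measure)) \<le> \<bar>C\<bar> * (\<integral>t. cmod (p n t - f t) \<partial>circle_measure)" for n
  proof -
    have "(\<integral>t. g t * p n t \<partial>circle_measure) - (\<integral>t. g t * f t \<partial>circle_measure) = (\<integral>t. g t * p n t - g t * f t \<partial>circle_measure)"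
      using int[OF p] int[OF f] by simp
    also have "cmod \<dots> \<le> (\<integral>t. cmod (g t * p n t - g t * f t) \<partial>circle_measure)" by simp
    also have "\<dots> \<le> (\<integral>t. \<bar>C\<bar> * cmod (p n t - f t) \<partial>circle_measure)"
    proof (rule integral_mono_AE)
      show "integrable circle_measure (\<lambda>t. cmod (g t * p n t - g t * f t))"
        using int[OF p] int[OF f] by auto
      show "AE t in circle_measure. cmod (g t * p n t - g t * f t) \<le> \<bar>C\<bar> * cmod (p n t - f t)"
        using g(2) by eventually_elim (auto simp: norm_mult right_diff_distrib[symmetric] intro!: mult_right_mono)
    qed (use int' in auto)
    finally show ?thesis by simp
  qed
  then have "\<forall>\<^sub>F n in sequentially. cmod ((\<integral>t. g t * p n t \<partial>circle_measure) - (\<integral>t. g t * f t \<partial>circle_measure)) \<le> \<bar>C\<bar> * (\<integral>t. cmod (p n t - f t) \<partial>circle_measure)"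
    by simp
  moreover have "(\<lambda>n. \<bar>C\<bar> * (\<integral>t. cmod (p n t - f t) \<partial>circle_measure)) \<longlonglongrightarrow> 0"
    using tendsto_mult_left[OF lim, of "\<bar>C\<bar>"] by simp
  ultimately have "(\<lambda>n. (\<integral>t. g t * p n t \<partial>circle_measure) - (\<integral>t. g t * f t \<partial>circle_measure)) \<longlonglongrightarrow> 0"
    by (rule Lim_null_comparison)
  then show ?thesis by (simp add: LIM_zero_iff)
qed

section \<open>Uniform bounds and L1 limits of Fejer means\<close>

definition cnj_reflect :: "(int \<Rightarrow> complex) \<Rightarrow> int \<Rightarrow> complex" where
  "cnj_reflect c k = cnj (c (- k))"

lemma cnj_reflect_supp: "{k. cnj_reflect c k \<noteq> 0} = uminus ` {k. c k \<noteq> 0}"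
  by (force simp: cnj_reflect_def image_iff)

lemma trig_eval_cnj_reflect: "trig_eval (cnj_reflect c) t = cnj (trig_eval c t)"
  unfolding trig_eval_def cnj_reflect_supp
  by (subst sum.reindex) (auto simp: cnj_reflect_def cis_cnj intro!: sum.cong)

text \<open>The mean of |c|^2 is the coefficient of index 0 of a convolution. The range A is left
  free so that Fejer means of different order can be compared over one range.\<close>

lemma trig_eval_Parseval:
  assumes c: "finsupp c" and A: "finite A" "{k. c k \<noteq> 0} \<subseteq> A"
  shows "(\<integral>t. (cmod (trig_eval c t))\<^sup>2 \<partial>circle_measure) = 2 * pi * (\<Sum>k\<in>A. (cmod (c k))\<^sup>2)"
proof -
  have fin: "finsupp (cnj_reflect c)" using c by (simp add: cnj_reflect_supp)
  have "complex_of_real (\<integral>t. (cmod (trig_eval c t))\<^sup>2 \<partial>circle_measure) = (\<integral>t. trig_eval c t * cnj (trig_eval c t) \<partial>circle_measure)"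
    by (simp only: integral_complex_of_real[symmetric] complex_norm_square)
  also have "\<dots> = (\<integral>t. trig_eval (conv (cnj_reflect c) c) t \<partial>circle_measure)"
    by (simp add: trig_eval_conv[OF fin c] trig_eval_cnj_reflect mult.commute)
  also have "\<dots> = of_real (2 * pi) * conv (cnj_reflect c) c 0"
    by (rule circle_integral_trig_eval[OF finsupp_conv[OF fin c]])
  also have "conv (cnj_reflect c) c 0 = (\<Sum>k\<in>A. complex_of_real ((cmod (c k))\<^sup>2))"
    by (subst conv_eq_sum[OF A]) (simp only: complex_norm_square, simp add: cnj_reflect_def mult.commute)
  finally have "complex_of_real (\<integral>t. (cmod (trig_eval c t))\<^sup>2 \<partial>circle_measure) = complex_of_real (2 * pi * (\<Sum>k\<in>A. (cmod (c k))\<^sup>2))"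
    by simp
  then show ?thesis by (simp only: of_real_eq_iff)
qed

context sequence_norm
begin

text \<open>The even powers of \<open>\<bar>q\<bar>\<close> are convolvers, so their means grow at most like powers of \<open>A\<close>.\<close>

lemma conv_bounded_sup:
  assumes q: "finsupp q" and A: "conv_bounded A q"
  shows "cmod (trig_eval q \<theta>) \<le> A"
proof (rule ccontr)
  assume "\<not> cmod (trig_eval q \<theta>) \<le> A"
  then obtain s where s: "s \<in> {- pi..pi}" "A < cmod (trig_eval q s)"
    using periodic_reduce[of "trig_eval q" \<theta>] trig_eval_periodic by (metis not_le)
  have A0: "0 \<le> A" using A by (rule conv_bounded_nonneg)
  \<comment> \<open>On a whole interval the modulus exceeds B, so the integrals of its even powers
    grow at least like powers of B^2, while their coefficient of index 0 is at most the same power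
    of A^2.\<close>
  obtain B where B: "A < B" "B < cmod (trig_eval q s)" using s(2) dense by blast
  define r where "r = conv (cnj_reflect q) q"
  have fin: "finsupp (cnj_reflect q)" using q by (simp add: cnj_reflect_supp)
  have r: "finsupp r" "conv_bounded (A * A) r"
    unfolding r_def using finsupp_conv[OF fin q] conv_bounded_conv[OF conv_bounded_cnj_reflect[OF A] A q]
    by (simp_all add: cnj_reflect_def[abs_def])
  have rev: "trig_eval r t = of_real ((cmod (trig_eval q t))\<^sup>2)" for t
    unfolding r_def trig_eval_conv[OF fin q] trig_eval_cnj_reflect complex_norm_square by (rule mult.commute)
  have pow: "\<exists>p. finsupp p \<and> conv_bounded ((A * A) ^ Suc n) p \<and> (\<forall>t. trig_eval p t = of_real ((cmod (trig_eval q t))\<^sup>2 ^ Suc n))" for n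
  proof (induction n)
    case 0
    then show ?case using r rev by auto
  next
    case (Suc n)
    then obtain p where p: "finsupp p" "conv_bounded ((A * A) ^ Suc n) p" "\<And>t. trig_eval p t = of_real ((cmod (trig_eval q t))\<^sup>2 ^ Suc n)"
      by blast
    have "trig_eval (conv r p) t = of_real ((cmod (trig_eval q t))\<^sup>2 ^ Suc (Suc n))" for t
      unfolding trig_eval_conv[OF r(1) p(1)] rev p(3) by simp
    moreover have "conv_bounded ((A * A) ^ Suc (Suc n)) (conv r p)"
      using conv_bounded_conv[OF r(2) p(2,1)] by simp
    ultimately show ?case using finsupp_conv[OF r(1) p(1)] by blast
  qed
  have open_B: "open {t. B < cmod (trig_eval q t)}"
    by (intro open_Collect_less continuous_intros continuous_on_trig_eval)
  then obtain \<delta> where \<delta>: "\<delta> > 0" "ball s \<delta> \<subseteq> {t. B < cmod (trig_eval q t)}"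
    using B(2) open_contains_ball by blast
  \<comment> \<open>The interval around s is clipped to one period; it keeps positive length even if
    s is an end point.\<close>
  define a where "a = max (- pi) (s - \<delta>)"
  define b where "b = min pi (s + \<delta>)"
  have ab: "a < b" "- pi \<le> a" "b \<le> pi" using s(1) \<delta>(1) by (auto simp: a_def b_def)
  have in_ab: "B < cmod (trig_eval q t)" if "t \<in> {a<..<b}" for t
    using that \<delta>(2) by (auto simp: a_def b_def ball_def dist_real_def subset_iff abs_less_iff)
  have le: "(B * B) ^ Suc n * (b - a) \<le> 2 * pi * (A * A) ^ Suc n" for n
  proof -
    obtain p where p: "finsupp p" "conv_bounded ((A * A) ^ Suc n) p" "\<And>t. trig_eval p t = of_real ((cmod (trig_eval q t))\<^sup>2 ^ Suc n)"
      using pow by blast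
    obtain M where M: "\<And>t. cmod (trig_eval p t) \<le> M"
      using periodic_continuous_bounded[of "trig_eval p"] trig_eval_periodic continuous_on_trig_eval by metis
    have pt: "(cmod (trig_eval q t))\<^sup>2 ^ Suc n = cmod (trig_eval p t)" for t
      by (simp only: p(3) norm_of_real) simp
    have "(B * B) ^ Suc n * (b - a) = (\<integral>t. (B * B) ^ Suc n * indicator {a<..<b} t \<partial>circle_measure)"
    proof -
      have "measure circle_measure {a<..<b} = measure lebesgue {a<..<b}"
        using ab by (intro measure_restrict_space) auto
      moreover have "{a<..<b} \<inter> {- pi<..<pi} = {a<..<b}" using ab by auto
      ultimately show ?thesis using ab by simp
    qed
    also have "\<dots> \<le> (\<integral>t. cmod (trig_eval p t) \<partial>circle_measure)"
    proof (rule integral_mono)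
      have "(\<lambda>t. indicator {a<..<b} t :: real) \<in> borel_measurable circle_measure"
        by (intro measurable_restrict_space1 measurable_completion) auto
      then show "integrable circle_measure (\<lambda>t. (B * B) ^ Suc n * indicator {a<..<b} t)"
        by (intro integrable_mult_right circle_integrable[of _ 1]) (auto simp: indicator_def)
      show "integrable circle_measure (\<lambda>t. cmod (trig_eval p t))"
        by (intro integrable_norm circle_integrable[of _ M] circle_measurable_cont continuous_on_trig_eval) (simp add: M)
      fix t
      show "(B * B) ^ Suc n * indicator {a<..<b} t \<le> cmod (trig_eval p t)"
      proof (cases "t \<in> {a<..<b}")
        case True
        have "(B * B) ^ Suc n \<le> (cmod (trig_eval q t))\<^sup>2 ^ Suc n"
          unfolding power2_eq_square using in_ab[OF True] A0 B(1) by (intro power_mono mult_mono) auto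
        then show ?thesis using True by (simp add: pt del: power_Suc)
      qed simp
    qed
    also have "\<dots> = cmod (\<integral>t. trig_eval p t \<partial>circle_measure)"
    proof -
      have "trig_eval p t = of_real (cmod (trig_eval p t))" for t
        using p(3)[of t] unfolding pt .
      then have "(\<integral>t. trig_eval p t \<partial>circle_measure) = of_real (\<integral>t. cmod (trig_eval p t) \<partial>circle_measure)"
        by (metis (no_types, lifting) Bochner_Integration.integral_cong integral_complex_of_real)
      then show ?thesis by simp
    qed
    also have "\<dots> \<le> 2 * pi * (A * A) ^ Suc n"
      unfolding circle_integral_trig_eval[OF p(1)] using conv_bounded_coeff[OF p(2), of 0] by (simp add: norm_mult del: power_Suc)
    finally show ?thesis .
  qed
  have B0: "B > 0" using A0 B(1) by simp
  have ratio: "(A * A) / (B * B) < 1" "0 \<le> (A * A) / (B * B)"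
    using A0 B(1) B0 by (auto intro!: mult_strict_mono simp: divide_less_eq)
  have "(\<lambda>n. 2 * pi * ((A * A) / (B * B)) ^ Suc n) \<longlonglongrightarrow> 2 * pi * 0"
    using ratio by (intro tendsto_intros LIMSEQ_Suc LIMSEQ_power_zero) auto
  then have "eventually (\<lambda>n. 2 * pi * ((A * A) / (B * B)) ^ Suc n < b - a) sequentially"
    using ab by (intro order_tendstoD(2)[of _ 0]) auto
  then obtain n where "2 * pi * ((A * A) / (B * B)) ^ Suc n < b - a" by (auto simp: eventually_sequentially)
  then have "2 * pi * (A * A) ^ Suc n < (B * B) ^ Suc n * (b - a)"
    using B0 by (simp add: power_divide pos_divide_less_eq mult.commute del: power_Suc)
  then show False using le[of n] by simp
qed

text \<open>The sums S n of squared coefficients increase, because the Fejer weights do, and are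
  bounded by A^2. For weights y \<le> x one has (x - y)^2 \<le> x^2 - y^2, so S m - S n controls the
  L2 distance and with it the L1 distance.\<close>

lemma fejer_Cauchy_L1:
  assumes A: "conv_bounded A c" and "\<epsilon> > 0"
  shows "\<exists>N. \<forall>i\<ge>N. \<forall>j\<ge>N. (\<integral>t. cmod (trig_eval (fejer i c) t - trig_eval (fejer j c) t) \<partial>circle_measure) < \<epsilon>"
proof -
  have bound: "cmod (trig_eval (fejer n c) t) \<le> A" for n t
    by (intro conv_bounded_sup finsupp_fejer conv_bounded_fejer A)
  have A0: "0 \<le> A" using A by (rule conv_bounded_nonneg)
  define S where "S n = (\<Sum>k\<in>{- int n..int n}. (cmod (fejer n c k))\<^sup>2)" for n
  have S_bound: "S n \<le> A\<^sup>2" for n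
  proof -
    have "2 * pi * S n = (\<integral>t. (cmod (trig_eval (fejer n c) t))\<^sup>2 \<partial>circle_measure)"
      unfolding S_def by (rule trig_eval_Parseval[symmetric]) (auto simp: finsupp_fejer fejer_supp)
    also have "\<dots> \<le> (\<integral>t. A\<^sup>2 \<partial>circle_measure)"
    proof (rule integral_mono)
      show "integrable circle_measure (\<lambda>t. (cmod (trig_eval (fejer n c) t))\<^sup>2)"
      proof (rule circle_integrable)
        show "(\<lambda>t. (cmod (trig_eval (fejer n c) t))\<^sup>2) \<in> borel_measurable circle_measure"
          by (intro circle_measurable_cont continuous_intros continuous_on_trig_eval)
        show "AE t in circle_measure. norm ((cmod (trig_eval (fejer n c) t))\<^sup>2) \<le> A\<^sup>2"
          by (auto intro!: power_mono bound)
      qed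
    qed (auto intro!: power_mono bound)
    also have "\<dots> = 2 * pi * A\<^sup>2" by (simp add: measure_restrict_space)
    finally show ?thesis by simp
  qed
  have S_ext: "S n = (\<Sum>k\<in>{- int m..int m}. (cmod (fejer n c k))\<^sup>2)" if "n \<le> m" for n m
    unfolding S_def using that fejer_supp[of n c]
    by (intro sum.mono_neutral_left) auto
  have L2: "(\<integral>t. (cmod (trig_eval (fejer m c) t - trig_eval (fejer n c) t))\<^sup>2 \<partial>circle_measure) \<le> 2 * pi * (S m - S n)"
    if nm: "n \<le> m" for n m
  proof -
    have "{k. (fejer m c - fejer n c) k \<noteq> 0} \<subseteq> {k. fejer m c k \<noteq> 0} \<union> {k. fejer n c k \<noteq> 0}" by auto
    also have "\<dots> \<subseteq> {- int m..int m} \<union> {- int n..int n}" by (intro Un_mono fejer_supp)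
    also have "\<dots> \<subseteq> {- int m..int m}" using nm by auto
    finally have "{k. (fejer m c - fejer n c) k \<noteq> 0} \<subseteq> {- int m..int m}" .
    then have "(\<integral>t. (cmod (trig_eval (fejer m c) t - trig_eval (fejer n c) t))\<^sup>2 \<partial>circle_measure)
        = 2 * pi * (\<Sum>k\<in>{- int m..int m}. (cmod ((fejer m c - fejer n c) k))\<^sup>2)"
      unfolding trig_eval_diff[OF finsupp_fejer finsupp_fejer, symmetric]
      by (intro trig_eval_Parseval finsupp_diff finsupp_fejer finite_atLeastAtMost_int)
    also have "\<dots> \<le> 2 * pi * (\<Sum>k\<in>{- int m..int m}. (cmod (fejer m c k))\<^sup>2 - (cmod (fejer n c k))\<^sup>2)"
    proof (intro mult_left_mono sum_mono)
      fix k
      let ?x = "fejer_coeff m k" and ?y = "fejer_coeff n k"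
      have xy: "0 \<le> ?y" "?y \<le> ?x" using fejer_coeff_nonneg fejer_coeff_mono[OF nm] by auto
      have "(?x - ?y)\<^sup>2 \<le> ?x\<^sup>2 - ?y\<^sup>2"
      proof -
        have "?x\<^sup>2 - ?y\<^sup>2 - (?x - ?y)\<^sup>2 = 2 * ?y * (?x - ?y)" by (simp add: power2_eq_square algebra_simps)
        also have "\<dots> \<ge> 0" using xy by simp
        finally show ?thesis by simp
      qed
      then have "(?x - ?y)\<^sup>2 * (cmod (c k))\<^sup>2 \<le> (?x\<^sup>2 - ?y\<^sup>2) * (cmod (c k))\<^sup>2" by (intro mult_right_mono) auto
      moreover have "(fejer m c - fejer n c) k = of_real (?x - ?y) * c k" by (simp add: fejer_def left_diff_distrib)
      ultimately show "(cmod ((fejer m c - fejer n c) k))\<^sup>2 \<le> (cmod (fejer m c k))\<^sup>2 - (cmod (fejer n c k))\<^sup>2"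
        by (simp only: norm_mult norm_of_real power_mult_distrib power2_abs fejer_def left_diff_distrib)
    qed auto
    also have "\<dots> = 2 * pi * (S m - S n)" by (simp add: S_ext[OF nm] S_def[of m] sum_subtractf)
    finally show ?thesis .
  qed
  have "incseq S"
  proof (rule monoI)
    fix n m :: nat assume "n \<le> m"
    then have "0 \<le> 2 * pi * (S m - S n)"
      using order.trans[OF Bochner_Integration.integral_nonneg L2] by simp
    then show "S n \<le> S m" using pi_gt_zero by (auto simp: zero_le_mult_iff not_le[symmetric])
  qed
  then obtain L where "S \<longlonglongrightarrow> L"
    using incseq_convergent[of S "A\<^sup>2"] S_bound by blast
  then have "Cauchy S" by (rule LIMSEQ_imp_Cauchy)
  \<comment> \<open>The final estimate is 2 pi \<delta>, that is half of \<epsilon>.\<close>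
  define \<delta> where "\<delta> = \<epsilon> / (4 * pi)"
  have \<delta>: "\<delta> > 0" using assms(2) by (simp add: \<delta>_def)
  then have "\<delta>\<^sup>2 > 0" by simp
  then obtain N where N: "\<And>i j. i \<ge> N \<Longrightarrow> j \<ge> N \<Longrightarrow> dist (S i) (S j) < \<delta>\<^sup>2"
    using metric_CauchyD[OF \<open>Cauchy S\<close>] by blast
  have less: "(\<integral>t. cmod (trig_eval (fejer i c) t - trig_eval (fejer j c) t) \<partial>circle_measure) < \<epsilon>"
    if "j \<le> i" "i \<ge> N" "j \<ge> N" for i j
  proof -
    let ?d = "\<lambda>t. cmod (trig_eval (fejer i c) t - trig_eval (fejer j c) t)"
    have d_le: "?d t \<le> 2 * A" for t
      using norm_triangle_ineq4[of "trig_eval (fejer i c) t" "trig_eval (fejer j c) t"] bound[of i t] bound[of j t] by linarith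
    have meas: "?d \<in> borel_measurable circle_measure"
      by (intro circle_measurable_cont continuous_intros continuous_on_trig_eval)
    have int2: "integrable circle_measure (\<lambda>t. (?d t)\<^sup>2)"
    proof (rule circle_integrable)
      show "(\<lambda>t. (?d t)\<^sup>2) \<in> borel_measurable circle_measure" using meas by simp
      have "(?d t)\<^sup>2 \<le> (2 * A)\<^sup>2" for t by (intro power_mono d_le) simp
      then show "AE t in circle_measure. norm ((?d t)\<^sup>2) \<le> (2 * A)\<^sup>2" by simp
    qed
    \<comment> \<open>The inequality d \<le> \<delta>/2 + d^2/(2 \<delta>) takes the place of
      Cauchy-Schwarz.\<close>
    have "(\<integral>t. ?d t \<partial>circle_measure) \<le> (\<integral>t. \<delta> / 2 + (?d t)\<^sup>2 / (2 * \<delta>) \<partial>circle_measure)"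
    proof (rule integral_mono)
      show "integrable circle_measure ?d" using meas d_le by (intro circle_integrable[of _ "2 * A"]) auto
      show "integrable circle_measure (\<lambda>t. \<delta> / 2 + (?d t)\<^sup>2 / (2 * \<delta>))" using int2 by auto
      fix t
      have "0 \<le> (?d t - \<delta>)\<^sup>2" by simp
      then have "2 * \<delta> * ?d t \<le> \<delta>\<^sup>2 + (?d t)\<^sup>2" by (simp add: power2_diff algebra_simps)
      then have "?d t \<le> (\<delta>\<^sup>2 + (?d t)\<^sup>2) / (2 * \<delta>)" using \<delta> by (subst pos_le_divide_eq) (simp_all add: mult_ac)
      also have "\<dots> = \<delta> / 2 + (?d t)\<^sup>2 / (2 * \<delta>)"
        using \<delta> by (simp add: add_divide_distrib power2_eq_square)
      finally show "?d t \<le> \<delta> / 2 + (?d t)\<^sup>2 / (2 * \<delta>)" .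
    qed
    also have "\<dots> = pi * \<delta> + (\<integral>t. (?d t)\<^sup>2 \<partial>circle_measure) / (2 * \<delta>)"
      using int2 by (simp add: measure_restrict_space)
    also have "\<dots> \<le> pi * \<delta> + (2 * pi * (S i - S j)) / (2 * \<delta>)"
      using L2[OF that(1)] \<delta> by (intro add_left_mono divide_right_mono) auto
    also have "\<dots> \<le> pi * \<delta> + (2 * pi * \<delta>\<^sup>2) / (2 * \<delta>)"
      using N[OF that(2,3)] \<delta> by (intro add_left_mono divide_right_mono mult_left_mono) (auto simp: dist_real_def)
    also have "\<dots> = 2 * pi * \<delta>" using \<delta> by (simp add: power2_eq_square)
    also have "\<dots> < \<epsilon>" using assms(2) by (simp add: \<delta>_def)
    finally show ?thesis .
  qed
  have "(\<integral>t. cmod (trig_eval (fejer i c) t - trig_eval (fejer j c) t) \<partial>circle_measure) < \<epsilon>" if "i \<ge> N" "j \<ge> N" for i j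
    using less[of j i] less[of i j] that by (cases "j \<le> i") (auto simp: norm_minus_commute)
  then show ?thesis by blast
qed

lemma periodic_Linf_circle:
  assumes "f \<in> periodic_Linf"
  obtains C where "f \<in> borel_measurable circle_measure" "AE t in circle_measure. cmod (f t) \<le> C"
proof -
  obtain C where "AE t in lebesgue. cmod (f t) \<le> C" "f \<in> borel_measurable lebesgue"
    using assms by (auto simp: periodic_Linf_def)
  then have "f \<in> borel_measurable circle_measure" "AE t in circle_measure. cmod (f t) \<le> C"
    by (auto simp: measurable_restrict_space1 AE_restrict_space_iff elim: eventually_mono)
  then show ?thesis by (rule that)
qed

text \<open>A subsequence of the L1 Cauchy sequence converges almost everywhere. Its limit inherits
  the bound A, and L1 convergence of the whole sequence identifies the coefficients.\<close>

lemma conv_bounded_symbol_exists: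
  assumes A: "conv_bounded A c"
  shows "\<exists>f\<in>periodic_Linf. fourier_coeff (distr_of f) = c \<and>
    (\<lambda>n. \<integral>t. cmod (trig_eval (fejer n c) t - f t) \<partial>circle_measure) \<longlonglongrightarrow> 0"
proof -
  define p where "p n = trig_eval (fejer n c)" for n
  have bound: "cmod (p n t) \<le> A" for n t
    unfolding p_def by (intro conv_bounded_sup finsupp_fejer conv_bounded_fejer A)
  have A0: "0 \<le> A" using A by (rule conv_bounded_nonneg)
  have pmeas: "p n \<in> borel_measurable lebesgue" for n
    unfolding p_def using borel_measurable_continuous_onI[OF continuous_on_trig_eval]
    by (intro measurable_completion) auto
  have pmeas': "p n \<in> borel_measurable circle_measure" for n
    using pmeas by (rule measurable_restrict_space1)
  have Cauchy: "\<exists>N. \<forall>i\<ge>N. \<forall>j\<ge>N. (\<integral>t. cmod (p i t - p j t) \<partial>circle_measure) < e" if "e > 0" for e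
    unfolding p_def using fejer_Cauchy_L1[OF A that] .
  have int: "integrable circle_measure (p n)" for n
    by (rule circle_integrable[of _ A]) (auto simp: bound pmeas')
  obtain r where r: "strict_mono r" "AE t in circle_measure. Cauchy (\<lambda>i. p (r i) t)"
    using cauchy_L1_AE_cauchy_subseq[of circle_measure p, OF int Cauchy] by blast
  \<comment> \<open>Defined at every real t, with 0 where the subsequence diverges, f is periodic
    and bounded by A everywhere and not only almost everywhere.\<close>
  define f where "f t = (if Cauchy (\<lambda>i. p (r i) t) then lim (\<lambda>i. p (r i) t) else 0)" for t
  have f_lim: "(\<lambda>i. p (r i) t) \<longlonglongrightarrow> f t" if "Cauchy (\<lambda>i. p (r i) t)" for t
    using that by (simp add: f_def Cauchy_convergent_iff convergent_LIMSEQ_iff)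
  have f_bound: "cmod (f t) \<le> A" for t
  proof (cases "Cauchy (\<lambda>i. p (r i) t)")
    case True
    show ?thesis
      by (rule Lim_bounded[OF tendsto_norm[OF f_lim[OF True]], of 0]) (auto simp: bound)
  qed (simp add: f_def A0)
  have f_meas: "f \<in> borel_measurable lebesgue"
    unfolding f_def
  proof (rule measurable_If)
    show "(\<lambda>t. lim (\<lambda>i. p (r i) t)) \<in> borel_measurable lebesgue"
      by (intro borel_measurable_lim_metric pmeas)
    show "{t \<in> space lebesgue. Cauchy (\<lambda>i. p (r i) t)} \<in> sets lebesgue"
      by (intro sets_Collect_Cauchy pmeas)
  qed simp
  have f_meas': "f \<in> borel_measurable circle_measure" using f_meas by (rule measurable_restrict_space1)
  have f_per: "f (t + 2 * pi) = f t" for t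
    by (simp add: f_def p_def trig_eval_periodic)
  have f_Linf: "f \<in> periodic_Linf"
    using f_meas f_per f_bound by (auto simp: periodic_Linf_def)
  have conv0: "(\<lambda>n. \<integral>t. cmod (p n t - f t) \<partial>circle_measure) \<longlonglongrightarrow> 0"
  proof (rule LIMSEQ_I)
    fix e :: real assume "e > 0"
    then obtain N where N: "\<And>i j. i \<ge> N \<Longrightarrow> j \<ge> N \<Longrightarrow> (\<integral>t. cmod (p i t - p j t) \<partial>circle_measure) < e / 2"
      using Cauchy[of "e / 2"] by auto
    have "(\<integral>t. cmod (p n t - f t) \<partial>circle_measure) \<le> e / 2" if "n \<ge> N" for n
    proof (rule LIMSEQ_le_const2)
      show "(\<lambda>i. \<integral>t. cmod (p n t - p (r i) t) \<partial>circle_measure) \<longlonglongrightarrow> (\<integral>t. cmod (p n t - f t) \<partial>circle_measure)"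
      proof (rule integral_dominated_convergence[where w = "\<lambda>_. 2 * A"])
        show "AE t in circle_measure. (\<lambda>i. cmod (p n t - p (r i) t)) \<longlonglongrightarrow> cmod (p n t - f t)"
          using r(2) by eventually_elim (intro tendsto_intros f_lim)
        show "AE t in circle_measure. norm (cmod (p n t - p (r i) t)) \<le> 2 * A" for i
        proof (rule AE_I2)
          fix t
          show "norm (cmod (p n t - p (r i) t)) \<le> 2 * A"
            using norm_triangle_ineq4[of "p n t" "p (r i) t"] bound[of n t] bound[of "r i" t] by simp
        qed
      qed (use pmeas' f_meas' in auto)
      have "(\<integral>t. cmod (p n t - p (r i) t) \<partial>circle_measure) \<le> e / 2" if "i \<ge> N" for i
        using N[OF \<open>n \<ge> N\<close>, of "r i"] strict_mono_imp_increasing[OF r(1), of i] that by simp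
      then show "\<exists>M. \<forall>i\<ge>M. (\<integral>t. cmod (p n t - p (r i) t) \<partial>circle_measure) \<le> e / 2" by blast
    qed
    moreover have "0 \<le> (\<integral>t. cmod (p n t - f t) \<partial>circle_measure)" for n by simp
    ultimately have "norm ((\<integral>t. cmod (p n t - f t) \<partial>circle_measure) - 0) < e" if "n \<ge> N" for n
      using that \<open>e > 0\<close> by (simp add: order.strict_trans1[of _ "e / 2"])
    then show "\<exists>N. \<forall>n\<ge>N. norm ((\<integral>t. cmod (p n t - f t) \<partial>circle_measure) - 0) < e" by blast
  qed
  have "fourier_coeff (distr_of f) k = c k" for k
  proof (rule LIMSEQ_unique)
    have "(\<lambda>n. (\<integral>t. cis (of_int (- k) * t) * p n t \<partial>circle_measure)) \<longlonglongrightarrow> (\<integral>t. cis (of_int (- k) * t) * f t \<partial>circle_measure)"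
    proof (rule circle_integral_L1_tendsto[OF _ _ _ _ _ _ conv0])
      show "(\<lambda>t. cis (of_int (- k) * t)) \<in> borel_measurable circle_measure"
        by (intro circle_measurable_cont continuous_intros)
      show "AE t in circle_measure. cmod (f t) \<le> A" "AE t in circle_measure. cmod (cis (of_int (- k) * t)) \<le> 1"
        "\<And>n. AE t in circle_measure. cmod (p n t) \<le> A"
        by (auto simp: f_bound bound)
    qed (use f_meas' pmeas' in auto)
    then have "(\<lambda>n. (\<integral>t. cis (of_int (- k) * t) * p n t \<partial>circle_measure) / (2 * pi)) \<longlonglongrightarrow> (\<integral>t. cis (of_int (- k) * t) * f t \<partial>circle_measure) / (2 * pi)"
      by (intro tendsto_divide tendsto_const) auto
    then have "(\<lambda>n. fourier_coeff (distr_of (p n)) k) \<longlonglongrightarrow> fourier_coeff (distr_of f) k"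
      by (simp only: fourier_coeff_distr_of mult.commute)
    then show "(\<lambda>n. fejer n c k) \<longlonglongrightarrow> fourier_coeff (distr_of f) k"
      by (simp add: p_def fourier_coeff_trig_eval[OF finsupp_fejer])
  qed (rule fejer_tendsto)
  then show ?thesis using f_Linf conv0 unfolding p_def by blast
qed

text \<open>Bounded functions with equal coefficients agree almost everywhere. The statement covers
  every symbol of c because \<open>symbol_fun\<close> is an arbitrary choice among them.\<close>

lemma conv_bounded_symbol_L1:
  assumes A: "conv_bounded A c" and f: "f \<in> periodic_Linf" "fourier_coeff (distr_of f) = c"
  shows "(\<lambda>n. \<integral>t. cmod (trig_eval (fejer n c) t - f t) \<partial>circle_measure) \<longlonglongrightarrow> 0"
proof -
  obtain g where g: "g \<in> periodic_Linf" "fourier_coeff (distr_of g) = c"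
      "(\<lambda>n. \<integral>t. cmod (trig_eval (fejer n c) t - g t) \<partial>circle_measure) \<longlonglongrightarrow> 0"
    using conv_bounded_symbol_exists[OF A] by blast
  obtain F where F: "f \<in> borel_measurable circle_measure" "AE t in circle_measure. cmod (f t) \<le> F"
    using periodic_Linf_circle[OF f(1)] .
  obtain G where G: "g \<in> borel_measurable circle_measure" "AE t in circle_measure. cmod (g t) \<le> G"
    using periodic_Linf_circle[OF g(1)] .
  have ae: "AE t in circle_measure. f t = g t"
    by (rule Linf_eqI[OF F G]) (simp add: f g)
  have ev: "trig_eval (fejer n c) \<in> borel_measurable circle_measure" for n
    by (intro circle_measurable_cont continuous_on_trig_eval)
  have "(\<integral>t. cmod (trig_eval (fejer n c) t - f t) \<partial>circle_measure) = (\<integral>t. cmod (trig_eval (fejer n c) t - g t) \<partial>circle_measure)" for n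
    by (rule integral_cong_AE) (use F G ev ae in \<open>auto elim: eventually_mono\<close>)
  then show ?thesis using g(3) by simp
qed

text \<open>The Fejer polynomials of g converge to g in L1, and f times a character is bounded. With
  a polynomial in place of g the coefficient integral is a finite sum, namely a convolution.\<close>

lemma symbol_product:
  assumes f: "f \<in> periodic_Linf" and d: "conv_bounded B d" and g: "g \<in> periodic_Linf" "fourier_coeff (distr_of g) = d"
  shows "is_conv_limit (fourier_coeff (distr_of f)) d (fourier_coeff (distr_of (\<lambda>t. f t * g t)))"
  unfolding is_conv_limit_def
proof
  fix m
  obtain F where F: "f \<in> borel_measurable circle_measure" "AE t in circle_measure. cmod (f t) \<le> F"
    using periodic_Linf_circle[OF f] .
  obtain G where G: "g \<in> borel_measurable circle_measure" "AE t in circle_measure. cmod (g t) \<le> G"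
    using periodic_Linf_circle[OF g(1)] .
  define h where "h t = f t * cis (of_int (- m) * t)" for t
  have h: "h \<in> borel_measurable circle_measure"
    unfolding h_def by (intro borel_measurable_times F circle_measurable_cont continuous_intros)
  have h': "AE t in circle_measure. cmod (h t) \<le> F"
    using F(2) by (simp add: h_def norm_mult)
  have ev: "trig_eval (fejer n d) \<in> borel_measurable circle_measure" for n
    by (intro circle_measurable_cont continuous_on_trig_eval)
  have ev': "AE t in circle_measure. cmod (trig_eval (fejer n d) t) \<le> B" for n
    by (intro AE_I2 conv_bounded_sup finsupp_fejer conv_bounded_fejer d)
  have "(\<lambda>n. \<integral>t. h t * trig_eval (fejer n d) t \<partial>circle_measure) \<longlonglongrightarrow> (\<integral>t. h t * g t \<partial>circle_measure)"
    by (rule circle_integral_L1_tendsto[OF G ev ev' h h' conv_bounded_symbol_L1[OF d g]])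
  then have lim: "(\<lambda>n. (\<integral>t. h t * trig_eval (fejer n d) t \<partial>circle_measure) / (2 * pi)) \<longlonglongrightarrow> (\<integral>t. h t * g t \<partial>circle_measure) / (2 * pi)"
    by (intro tendsto_divide tendsto_const) auto
  have "(\<integral>t. h t * trig_eval (fejer n d) t \<partial>circle_measure) / (2 * pi) = conv (fourier_coeff (distr_of f)) (fejer n d) m" for n
  proof -
    have "h t * cis (of_int k * t) = f t * cis (of_int (- (m - k)) * t)" for k t
      by (simp add: h_def cis_mult mult.assoc algebra_simps)
    then have "(\<integral>t. h t * trig_eval (fejer n d) t \<partial>circle_measure)
        = (\<Sum>k | fejer n d k \<noteq> 0. fejer n d k * (\<integral>t. f t * cis (of_int (- (m - k)) * t) \<partial>circle_measure))"
      by (simp only: circle_integral_mult_trig_eval[OF h h'])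
    then show ?thesis
      by (simp add: conv_def fourier_coeff_distr_of sum_divide_distrib mult.commute)
  qed
  moreover have "(\<integral>t. h t * g t \<partial>circle_measure) / (2 * pi) = fourier_coeff (distr_of (\<lambda>t. f t * g t)) m"
    by (simp add: fourier_coeff_distr_of h_def mult_ac)
  ultimately show "(\<lambda>n. conv (fourier_coeff (distr_of f)) (fejer n d) m) \<longlonglongrightarrow> fourier_coeff (distr_of (\<lambda>t. f t * g t)) m"
    using lim by simp
qed

end

subsection \<open>Rearrangements\<close>

lemma distribution_fun_eq:
  "distribution_fun f s = (if finite {k. norm (f k) > s} then of_nat (card {k. norm (f k) > s}) else \<infinity>)"
  by (simp add: distribution_fun_def emeasure_count_space)

lemma distribution_fun_norm: "distribution_fun (\<lambda>k. norm (f k)) s = distribution_fun f s"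
  by (simp add: distribution_fun_def)

lemma distribution_fun_bij_betw:
  assumes "bij_betw e {k. norm (f k) > s} {k. norm (g k) > s}"
  shows "distribution_fun f s = distribution_fun g s"
  unfolding distribution_fun_eq using bij_betw_finite[OF assms] bij_betw_same_card[OF assms] by simp

lemma distribution_fun_bij:
  assumes "bij e"
  shows "distribution_fun (\<lambda>k. f (e k)) s = distribution_fun f s"
proof (rule distribution_fun_bij_betw[of e])
  show "bij_betw e {k. s < norm (f (e k))} {k. s < norm (f k)}"
    using assms unfolding bij_betw_def by (auto intro: inj_on_subset simp: image_iff surj_def)
qed

context
  fixes f :: "'s \<Rightarrow> 'b::real_normed_vector"
  assumes bdd: "bounded (range f)"
begin

lemma distribution_levels_nonempty: "{s. 0 \<le> s \<and> distribution_fun f s \<le> of_nat n} \<noteq> {}"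
proof -
  obtain B where B: "\<And>k. norm (f k) \<le> B" using bdd by (auto simp: bounded_iff)
  have "{k. norm (f k) > \<bar>B\<bar>} = {}" using order.trans[OF B abs_ge_self] by (auto simp: not_less)
  then have "distribution_fun f \<bar>B\<bar> = 0" by (simp add: distribution_fun_def)
  then have "\<bar>B\<bar> \<in> {s. 0 \<le> s \<and> distribution_fun f s \<le> of_nat n}" by simp
  then show ?thesis by blast
qed

lemma rearrangement_nonneg: "0 \<le> rearrangement f n"
  unfolding rearrangement_def by (rule cInf_greatest[OF distribution_levels_nonempty]) simp

lemma rearrangement_antimono: "antimono (rearrangement f)"
proof (rule antimonoI)
  fix m n :: nat assume "m \<le> n"
  then have "{s. 0 \<le> s \<and> distribution_fun f s \<le> of_nat m} \<subseteq> {s. 0 \<le> s \<and> distribution_fun f s \<le> of_nat n}"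
    by (auto intro: order.trans)
  then show "rearrangement f n \<le> rearrangement f m"
    unfolding rearrangement_def
    by (intro cInf_superset_mono distribution_levels_nonempty) (auto intro: bdd_belowI[of _ 0])
qed

text \<open>If more than n entries exceed s, the least of n + 1 such entries lies strictly above s
  and below every admissible level; hence the infimum does not drop to s.\<close>

lemma rearrangement_gt_iff:
  assumes s: "0 \<le> s"
  shows "rearrangement f n > s \<longleftrightarrow> \<not> distribution_fun f s \<le> of_nat n"
proof
  assume "rearrangement f n > s"
  then show "\<not> distribution_fun f s \<le> of_nat n"
    unfolding rearrangement_def using s
    by (metis (mono_tags, lifting) bdd_belowI cInf_lower leD mem_Collect_eq)
next
  assume gt: "\<not> distribution_fun f s \<le> of_nat n"
  have "\<exists>T. finite T \<and> card T = Suc n \<and> T \<subseteq> {k. norm (f k) > s}"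
  proof (cases "finite {k. norm (f k) > s}")
    case True
    then have "Suc n \<le> card {k. norm (f k) > s}" using gt by (simp add: distribution_fun_eq)
    then show ?thesis by (meson obtain_subset_with_card_n)
  next
    case False
    then show ?thesis using infinite_arbitrarily_large by blast
  qed
  then obtain T where T: "finite T" "card T = Suc n" "T \<subseteq> {k. norm (f k) > s}" by blast
  have Tne: "T \<noteq> {}" using T(2) by auto
  define m where "m = Min ((\<lambda>k. norm (f k)) ` T)"
  have "m > s" unfolding m_def using T Tne by (subst Min_gr_iff) auto
  moreover have "m \<le> rearrangement f n"
    unfolding rearrangement_def
  proof (rule cInf_greatest[OF distribution_levels_nonempty])
    fix t assume t: "t \<in> {s. 0 \<le> s \<and> distribution_fun f s \<le> of_nat n}"
    show "m \<le> t"
    proof (rule ccontr)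
      assume "\<not> m \<le> t"
      moreover have "m \<le> norm (f k)" if "k \<in> T" for k
        unfolding m_def using that T(1) by simp
      ultimately have sub: "T \<subseteq> {k. norm (f k) > t}" by force
      have "finite {k. norm (f k) > t}" "card {k. norm (f k) > t} \<le> n"
        using t by (auto simp: distribution_fun_eq top_unique split: if_splits)
      then show False using card_mono[OF _ sub] T(2) by simp
    qed
  qed
  ultimately show "rearrangement f n > s" by simp
qed

lemma distribution_fun_rearrangement:
  assumes s: "0 \<le> s"
  shows "distribution_fun (rearrangement f) s = distribution_fun f s"
proof -
  have eq: "{n. norm (rearrangement f n) > s} = {n. \<not> distribution_fun f s \<le> of_nat n}"
    using rearrangement_nonneg rearrangement_gt_iff[OF s] by auto
  show ?thesis
  proof (cases "finite {k. norm (f k) > s}")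
    case True
    then have "{n. \<not> distribution_fun f s \<le> of_nat n} = {..<card {k. norm (f k) > s}}"
      by (auto simp: distribution_fun_eq)
    then show ?thesis
      using True by (simp only: distribution_fun_eq[of "rearrangement f"] eq) (simp add: distribution_fun_eq)
  next
    case False
    then have "{n. \<not> distribution_fun f s \<le> of_nat n} = UNIV"
      by (auto simp: distribution_fun_eq top_unique)
    then show ?thesis
      using False by (simp only: distribution_fun_eq[of "rearrangement f"] eq) (simp add: distribution_fun_eq)
  qed
qed

end

lemma rearrangement_antimono_id:
  fixes g :: "nat \<Rightarrow> real"
  assumes g: "antimono g" "\<And>n. 0 \<le> g n"
  shows "rearrangement (\<lambda>k. complex_of_real (g k)) n = g n"
proof -
  have "distribution_fun (\<lambda>k. complex_of_real (g k)) s \<le> of_nat n \<longleftrightarrow> g n \<le> s" if "0 \<le> s" for s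
  proof
    assume le: "g n \<le> s"
    have "{k. norm (complex_of_real (g k)) > s} \<subseteq> {..<n}"
    proof
      fix k assume "k \<in> {k. norm (complex_of_real (g k)) > s}"
      then have "g k > s" using g(2)[of k] by simp
      then show "k \<in> {..<n}" using le antimonoD[OF g(1), of n k] by (cases "k < n") auto
    qed
    then have "finite {k. norm (complex_of_real (g k)) > s}" "card {k. norm (complex_of_real (g k)) > s} \<le> n"
      using finite_subset card_mono[of "{..<n}"] by auto
    then show "distribution_fun (\<lambda>k. complex_of_real (g k)) s \<le> of_nat n"
      by (simp add: distribution_fun_eq)
  next
    assume le: "distribution_fun (\<lambda>k. complex_of_real (g k)) s \<le> of_nat n"
    show "g n \<le> s"
    proof (rule ccontr)
      assume "\<not> g n \<le> s"
      then have sub: "{..n} \<subseteq> {k. norm (complex_of_real (g k)) > s}"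
        using antimonoD[OF g(1), of _ n] g(2) by (fastforce simp: abs_if)
      have "finite {k. norm (complex_of_real (g k)) > s}" "card {k. norm (complex_of_real (g k)) > s} \<le> n"
        using le by (auto simp: distribution_fun_eq top_unique split: if_splits)
      then show False using card_mono[OF _ sub] by simp
    qed
  qed
  then have "{s. 0 \<le> s \<and> distribution_fun (\<lambda>k. complex_of_real (g k)) s \<le> of_nat n} = {g n..}"
    using order.trans[OF g(2)[of n]] by auto
  then show ?thesis by (simp add: rearrangement_def)
qed

lemma ri_eq:
  assumes "rearrangement_invariant \<rho>" "\<And>k. 0 \<le> f k" "\<And>k. 0 \<le> g k"
    "\<And>s. 0 \<le> s \<Longrightarrow> distribution_fun f s = distribution_fun g s"
  shows "\<rho> f = \<rho> g"
  using assms unfolding rearrangement_invariant_def by blast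

lemma ri_bij:
  assumes "rearrangement_invariant \<rho>" "\<And>k. 0 \<le> f k" "bij e"
  shows "\<rho> (\<lambda>k. f (e k)) = \<rho> f"
  by (rule ri_eq[OF assms(1)]) (use assms distribution_fun_bij in auto)

text \<open>All one-point indicators have the same positive norm c by invariance, and f dominates f
  k times the indicator of k, so c f k is at most the norm of f. This matches the value infinity in
  \<open>luxemburg_rep\<close>.\<close>

lemma ri_finite_bounded:
  fixes \<rho> :: "('s \<Rightarrow> real) \<Rightarrow> ennreal"
  assumes \<rho>: "banach_function_norm \<rho>" "rearrangement_invariant \<rho>"
    and f: "\<And>k. 0 \<le> f k" "\<rho> f < \<infinity>"
  shows "bounded (range f)"
proof -
  fix k0 :: 's
  have ind: "\<rho> (indicator {k}) = \<rho> (indicator {k0})" for k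
  proof (rule ri_eq[OF \<rho>(2)])
    fix s :: real assume "0 \<le> s"
    have "{j. norm (indicator {k} j :: real) > s} = (if s < 1 then {k} else {})" for k :: 's
      using \<open>0 \<le> s\<close> by (auto simp: indicator_def split: if_splits)
    then show "distribution_fun (indicator {k} :: 's \<Rightarrow> real) s = distribution_fun (indicator {k0} :: 's \<Rightarrow> real) s"
      unfolding distribution_fun_eq by (simp only:) simp
  qed auto
  define c where "c = enn2real (\<rho> (indicator {k0}))"
  have fin: "\<rho> (indicator {k0}) < \<infinity>" using bfn_indicator[OF \<rho>(1)] by simp
  have "\<rho> (indicator {k0}) \<noteq> 0"
    using bfn_zero_iff[OF \<rho>(1), of "indicator {k0}"] by (auto simp: indicator_def split: if_splits)
  then have c: "c > 0" "\<rho> (indicator {k0}) = ennreal c"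
    using fin by (auto simp: c_def enn2real_positive_iff zero_less_iff_neq_zero less_top)
  define F where "F = enn2real (\<rho> f)"
  have F: "\<rho> f = ennreal F" "F \<ge> 0" using f(2) by (auto simp: F_def less_top)
  have "f k \<le> F / c" for k
  proof -
    have "\<rho> (\<lambda>j. f k * indicator {k} j) = ennreal (f k) * \<rho> (indicator {k})"
      by (rule bfn_scale[OF \<rho>(1)]) (auto simp: f(1))
    then have "ennreal (f k * c) = \<rho> (\<lambda>j. f k * indicator {k} j)"
      unfolding ind[of k] c(2) using c(1) f(1)[of k] by (simp only: ennreal_mult less_imp_le)
    also have "\<dots> \<le> \<rho> f"
      by (rule bfn_mono[OF \<rho>(1)]) (use f in \<open>auto simp: indicator_def\<close>)
    finally have "f k * c \<le> F" using F by simp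
    then show ?thesis using c by (simp add: pos_le_divide_eq)
  qed
  then have "norm (f k) \<le> F / c" for k using f(1)[of k] by simp
  then show ?thesis by (auto simp: bounded_iff)
qed

text \<open>\<open>luxemburg_norm\<close> is a choice, so some representation has to be exhibited.
  Transport along \<open>int_encode\<close> gives one, since a bounded f and its transported
  rearrangement have the same distribution.\<close>

lemma luxemburg_rep_exists:
  assumes \<rho>: "banach_function_norm \<rho>" "rearrangement_invariant \<rho>"
  shows "luxemburg_rep \<rho> (luxemburg_norm \<rho>)"
proof -
  define \<sigma> where "\<sigma> g = \<rho> (\<lambda>k. g (int_encode k))" for g :: "nat \<Rightarrow> real"
  have surj: "\<exists>k. int_encode k = n" for n by (metis int_decode_inverse)
  have "banach_function_norm \<sigma>"
    unfolding banach_function_norm_def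
  proof (intro conjI allI impI)
    fix f :: "nat \<Rightarrow> real" assume "\<forall>k. 0 \<le> f k"
    then show "(\<sigma> f = 0) = (\<forall>k. f k = 0)"
      unfolding \<sigma>_def using bfn_zero_iff[OF \<rho>(1), of "\<lambda>k. f (int_encode k)"] surj by metis
  next
    fix f :: "nat \<Rightarrow> real" and c :: real assume "\<forall>k. 0 \<le> f k" "0 \<le> c"
    then show "\<sigma> (\<lambda>k. c * f k) = ennreal c * \<sigma> f"
      unfolding \<sigma>_def by (intro bfn_scale[OF \<rho>(1)]) auto
  next
    fix f g :: "nat \<Rightarrow> real" assume "\<forall>k. 0 \<le> f k" "\<forall>k. 0 \<le> g k"
    then show "\<sigma> (\<lambda>k. f k + g k) \<le> \<sigma> f + \<sigma> g"
      unfolding \<sigma>_def by (intro bfn_add[OF \<rho>(1)]) auto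
  next
    fix f g :: "nat \<Rightarrow> real" assume "\<forall>k. 0 \<le> g k \<and> g k \<le> f k"
    then show "\<sigma> g \<le> \<sigma> f"
      unfolding \<sigma>_def by (intro bfn_mono[OF \<rho>(1)]) auto
  next
    fix F :: "nat \<Rightarrow> nat \<Rightarrow> real" and f
    assume F: "\<forall>n k. 0 \<le> F n k" "\<forall>k. incseq (\<lambda>n. F n k)" "\<forall>k. (\<lambda>n. F n k) \<longlonglongrightarrow> f k"
    show "incseq (\<lambda>n. \<sigma> (F n))"
      unfolding \<sigma>_def using F by (intro monoI bfn_mono[OF \<rho>(1)]) (auto simp: incseq_def)
    show "(\<lambda>n. \<sigma> (F n)) \<longlonglongrightarrow> \<sigma> f"
      unfolding \<sigma>_def by (rule bfn_Fatou[OF \<rho>(1)]) (use F in auto)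
  next
    fix E :: "nat set" assume E: "finite E"
    have "(\<lambda>k. indicator E (int_encode k) :: real) = indicator (int_decode ` E)"
      by (auto simp: indicator_def fun_eq_iff image_iff)
    then show "\<sigma> (indicator E) < \<infinity>"
      unfolding \<sigma>_def using bfn_indicator[OF \<rho>(1), of "int_decode ` E"] E by simp
  next
    fix E :: "nat set" assume E: "finite E"
    then obtain C where C: "C > 0" "\<And>f. (\<And>k. 0 \<le> f k) \<Longrightarrow> ennreal (\<Sum>k\<in>int_decode ` E. f k) \<le> ennreal C * \<rho> f"
      using bfn_sum_bound[OF \<rho>(1), of "int_decode ` E"] by auto
    have "ennreal (\<Sum>k\<in>E. f k) \<le> ennreal C * \<sigma> f" if "\<forall>k. 0 \<le> f k" for f
    proof -
      have "(\<Sum>k\<in>int_decode ` E. f (int_encode k)) = (\<Sum>k\<in>E. f k)"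
        by (subst sum.reindex) (auto intro: inj_on_subset[OF inj_int_decode])
      then show ?thesis using C(2)[of "\<lambda>k. f (int_encode k)"] that by (simp add: \<sigma>_def)
    qed
    then show "\<exists>C>0. \<forall>f. (\<forall>k. 0 \<le> f k) \<longrightarrow> ennreal (\<Sum>k\<in>E. f k) \<le> ennreal C * \<sigma> f"
      using C(1) by blast
  qed
  moreover have "rearrangement_invariant \<sigma>"
    unfolding rearrangement_invariant_def
  proof (intro allI impI)
    fix f g :: "nat \<Rightarrow> real"
    assume fg: "\<forall>k. 0 \<le> f k" "\<forall>k. 0 \<le> g k" "\<forall>s\<ge>0. distribution_fun f s = distribution_fun g s"
    show "\<sigma> f = \<sigma> g"
      unfolding \<sigma>_def
      by (rule ri_eq[OF \<rho>(2)]) (use fg in \<open>auto simp: distribution_fun_bij[OF bij_int_encode]\<close>)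
  qed
  moreover have "\<rho> f = (if bounded (range f) then \<sigma> (rearrangement f) else \<infinity>)" if f: "\<forall>k. 0 \<le> f k" for f
  proof (cases "bounded (range f)")
    case True
    have "\<rho> f = \<rho> (\<lambda>k. rearrangement f (int_encode k))"
      by (rule ri_eq[OF \<rho>(2)])
        (use f True in \<open>auto simp: distribution_fun_bij[OF bij_int_encode] distribution_fun_rearrangement rearrangement_nonneg\<close>)
    then show ?thesis using True by (simp add: \<sigma>_def)
  next
    case False
    then show ?thesis using ri_finite_bounded[OF \<rho>, of f] f by (auto simp: less_top)
  qed
  ultimately have "luxemburg_rep \<rho> \<sigma>" by (auto simp: luxemburg_rep_def)
  then show ?thesis unfolding luxemburg_norm_def by (rule someI[of "luxemburg_rep \<rho>"])
qed

subsection \<open>Boyd indices\<close>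

text \<open>Fekete's argument along powers: j lies between consecutive powers of m, and monotonicity
  bridges the gap. Convergence matters because the Boyd indices are defined by \<open>lim\<close>,
  which has no meaning without it.\<close>

lemma submultiplicative_limit:
  fixes f :: "nat \<Rightarrow> real"
  assumes nonneg: "\<And>j. 1 \<le> j \<Longrightarrow> 0 \<le> f j" and mono: "\<And>i j. 1 \<le> i \<Longrightarrow> i \<le> j \<Longrightarrow> f i \<le> f j"
    and sub: "\<And>i j. 1 \<le> i \<Longrightarrow> 1 \<le> j \<Longrightarrow> f (i * j) \<le> f i + f j"
  shows "convergent (\<lambda>j. f j / ln (real j))"
proof -
  define L where "L = (INF m\<in>{2..}. f m / ln (real m))"
  have bdd: "bdd_below ((\<lambda>m. f m / ln (real m)) ` {2..})"
    using nonneg by (intro bdd_belowI[of _ 0]) auto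
  have pow: "f (m ^ r) \<le> real r * f m + f 1" if "1 \<le> m" for m r
  proof (induction r)
    case (Suc r)
    have "f (m ^ Suc r) \<le> f m + f (m ^ r)" using sub[of m "m ^ r"] that by simp
    then show ?case using Suc by (simp add: algebra_simps)
  qed simp
  have f1: "f 1 \<le> f m" if "1 \<le> m" for m using mono[of 1 m] that by simp
  \<comment> \<open>Of the two extra terms f m, one comes from the exponent r + 1 and the other
    bounds f 1, the start of the estimate for powers.\<close>
  have upper: "f j / ln (real j) \<le> f m / ln (real m) + 2 * f m / ln (real j)" if m: "2 \<le> m" and j: "2 \<le> j" for m j
  proof -
    obtain r where r: "m ^ r \<le> j" "j < m ^ (r + 1)" using ex_power_ivl1[of m j] m j by auto
    have lnm: "ln (real m) > 0" and lnj: "ln (real j) > 0" using m j by auto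
    have "real (m ^ r) \<le> real j" using r(1) by (simp only: of_nat_le_iff)
    then have "ln (real m ^ r) \<le> ln (real j)" using m by (intro ln_mono) auto
    then have rle: "real r * ln (real m) \<le> ln (real j)" using m by (simp add: ln_realpow)
    have "f j \<le> f (m ^ (r + 1))" using r j by (intro mono) auto
    also have "\<dots> \<le> real (r + 1) * f m + f 1" using m by (intro pow) auto
    also have "\<dots> \<le> real r * f m + 2 * f m" using f1[of m] m by (simp add: algebra_simps)
    also have "\<dots> \<le> (ln (real j) / ln (real m)) * f m + 2 * f m"
      using rle lnm nonneg[of m] m by (intro add_right_mono mult_right_mono) (auto simp: pos_le_divide_eq)
    finally have "f j / ln (real j) \<le> ((ln (real j) / ln (real m)) * f m + 2 * f m) / ln (real j)"
      using lnj by (intro divide_right_mono) auto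
    also have "\<dots> = f m / ln (real m) + 2 * f m / ln (real j)"
      using lnj lnm by (simp add: field_simps)
    finally show ?thesis .
  qed
  have "(\<lambda>j. f j / ln (real j)) \<longlonglongrightarrow> L"
  proof (rule order_tendstoI)
    fix a assume "a < L"
    then show "\<forall>\<^sub>F j in sequentially. a < f j / ln (real j)"
      using cINF_lower[OF bdd] unfolding L_def[symmetric] eventually_sequentially
      by (intro exI[of _ 2]) (force intro: less_le_trans)
  next
    fix a assume "L < a"
    then obtain m where m: "2 \<le> m" "f m / ln (real m) < a"
      unfolding L_def by (subst (asm) cINF_less_iff[OF _ bdd]) auto
    have "(\<lambda>j. 2 * f m / ln (real j)) \<longlonglongrightarrow> 0"
      by (intro real_tendsto_divide_at_top[OF tendsto_const]
          filterlim_compose[OF ln_at_top filterlim_real_sequentially])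
    then have "(\<lambda>j. f m / ln (real m) + 2 * f m / ln (real j)) \<longlonglongrightarrow> f m / ln (real m) + 0"
      by (intro tendsto_add tendsto_const)
    then have "\<forall>\<^sub>F j in sequentially. f m / ln (real m) + 2 * f m / ln (real j) < a"
      using m(2) by (intro order_tendstoD(2)) auto
    then show "\<forall>\<^sub>F j in sequentially. f j / ln (real j) < a"
      using eventually_ge_at_top[of 2] by eventually_elim (use upper[OF m(1)] in force)
  qed
  then show ?thesis by (rule convergentI)
qed

text \<open>The mirror image with a supremum, made finite by the logarithmic upper bound; it serves
  the negative logarithm of H.\<close>

lemma supermultiplicative_limit:
  fixes f :: "nat \<Rightarrow> real"
  assumes nonneg: "\<And>j. 1 \<le> j \<Longrightarrow> 0 \<le> f j" and mono: "\<And>i j. 1 \<le> i \<Longrightarrow> i \<le> j \<Longrightarrow> f i \<le> f j"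
    and super: "\<And>i j. 1 \<le> i \<Longrightarrow> 1 \<le> j \<Longrightarrow> f i + f j \<le> f (i * j)" and le: "\<And>j. 1 \<le> j \<Longrightarrow> f j \<le> ln (real j)"
  shows "convergent (\<lambda>j. f j / ln (real j))"
proof -
  define L where "L = (SUP m\<in>{2..}. f m / ln (real m))"
  have bdd: "bdd_above ((\<lambda>m. f m / ln (real m)) ` {2..})"
    using le by (intro bdd_aboveI[of _ 1]) auto
  have pow: "real r * f m \<le> f (m ^ r)" if "1 \<le> m" for m r
  proof (induction r)
    case (Suc r)
    have "f m + f (m ^ r) \<le> f (m ^ Suc r)" using super[of m "m ^ r"] that by simp
    then show ?case using Suc by (simp add: algebra_simps)
  qed (simp add: nonneg)
  have lower: "f m / ln (real m) - f m / ln (real j) \<le> f j / ln (real j)" if m: "2 \<le> m" and j: "2 \<le> j" for m j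
  proof -
    obtain r where r: "m ^ r \<le> j" "j < m ^ (r + 1)" using ex_power_ivl1[of m j] m j by auto
    have lnm: "ln (real m) > 0" and lnj: "ln (real j) > 0" using m j by auto
    have "real j \<le> real (m ^ (r + 1))" using r(2) by (simp only: of_nat_le_iff)
    then have "ln (real j) \<le> ln (real m ^ (r + 1))" using j by (intro ln_mono) auto
    then have rle: "ln (real j) \<le> real (r + 1) * ln (real m)" using m by (simp only: ln_realpow[of "real m"])
    have "(ln (real j) / ln (real m) - 1) * f m \<le> real r * f m"
      using rle lnm nonneg[of m] m by (intro mult_right_mono) (auto simp: field_simps)
    also have "\<dots> \<le> f (m ^ r)" using m by (intro pow) auto
    also have "\<dots> \<le> f j" using r m by (intro mono) auto
    finally have "((ln (real j) / ln (real m) - 1) * f m) / ln (real j) \<le> f j / ln (real j)"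
      using lnj by (intro divide_right_mono) auto
    moreover have "((ln (real j) / ln (real m) - 1) * f m) / ln (real j) = f m / ln (real m) - f m / ln (real j)"
      using lnj lnm by (simp add: field_simps)
    ultimately show ?thesis by simp
  qed
  have "(\<lambda>j. f j / ln (real j)) \<longlonglongrightarrow> L"
  proof (rule order_tendstoI)
    fix a assume "L < a"
    then show "\<forall>\<^sub>F j in sequentially. f j / ln (real j) < a"
      using cSUP_upper[OF _ bdd] unfolding L_def[symmetric] eventually_sequentially
      by (intro exI[of _ 2]) (force intro: le_less_trans)
  next
    fix a assume "a < L"
    then obtain m where m: "2 \<le> m" "a < f m / ln (real m)"
      unfolding L_def by (subst (asm) less_cSUP_iff[OF _ bdd]) auto
    have "(\<lambda>j. f m / ln (real j)) \<longlonglongrightarrow> 0"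
      by (intro real_tendsto_divide_at_top[OF tendsto_const]
          filterlim_compose[OF ln_at_top filterlim_real_sequentially])
    then have "(\<lambda>j. f m / ln (real m) - f m / ln (real j)) \<longlonglongrightarrow> f m / ln (real m) - 0"
      by (intro tendsto_diff tendsto_const)
    then have "\<forall>\<^sub>F j in sequentially. a < f m / ln (real m) - f m / ln (real j)"
      using m(2) by (intro order_tendstoD(1)) auto
    then show "\<forall>\<^sub>F j in sequentially. a < f j / ln (real j)"
      using eventually_ge_at_top[of 2] by eventually_elim (use lower[OF m(1)] in force)
  qed
  then show ?thesis by (rule convergentI)
qed

text \<open>With the index shift, $H(j,X)$ and $K(j,X)$ are the dilation norms for \<open>\<pi> k = j * (k + 1) - 1\<close>
  and \<open>\<pi> k = k div j\<close>; on decreasing sequences no rearrangement is needed.\<close>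

definition decreasing_ball :: "((nat \<Rightarrow> real) \<Rightarrow> ennreal) \<Rightarrow> (nat \<Rightarrow> real) set" where
  "decreasing_ball \<sigma> = {g. antimono g \<and> (\<forall>k. 0 \<le> g k) \<and> \<sigma> g \<le> 1}"

definition dilation_norm :: "((nat \<Rightarrow> real) \<Rightarrow> ennreal) \<Rightarrow> (nat \<Rightarrow> nat) \<Rightarrow> ennreal" where
  "dilation_norm \<sigma> \<pi> = (SUP g\<in>decreasing_ball \<sigma>. \<sigma> (\<lambda>k. g (\<pi> k)))"

context
  fixes \<sigma> :: "(nat \<Rightarrow> real) \<Rightarrow> ennreal"
  assumes bfn: "banach_function_norm \<sigma>" and ri: "rearrangement_invariant \<sigma>"
begin

text \<open>Invariance gives a sequence and its rearrangement the same norm, and a nonnegative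
  decreasing sequence is its own rearrangement.\<close>

lemma rearrangement_unit_ball:
  "rearrangement ` {f \<in> seq_space \<sigma>. seq_norm \<sigma> f \<le> 1} = decreasing_ball \<sigma>"
proof (intro equalityI subsetI)
  fix g assume "g \<in> rearrangement ` {f \<in> seq_space \<sigma>. seq_norm \<sigma> f \<le> 1}"
  then obtain f where f: "g = rearrangement f" "\<sigma> (\<lambda>k. cmod (f k)) < \<infinity>" "\<sigma> (\<lambda>k. cmod (f k)) \<le> 1"
    by (auto simp: seq_space_def seq_norm_def)
  have "bounded (range (\<lambda>k. cmod (f k)))" using f(2) by (intro ri_finite_bounded[OF bfn ri]) auto
  then have b: "bounded (range f)" by (auto simp: bounded_iff)
  have "\<sigma> (rearrangement f) = \<sigma> (\<lambda>k. cmod (f k))"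
    by (rule ri_eq[OF ri]) (auto simp: rearrangement_nonneg[OF b] distribution_fun_rearrangement[OF b] distribution_fun_norm)
  then show "g \<in> decreasing_ball \<sigma>"
    using f rearrangement_antimono[OF b] rearrangement_nonneg[OF b] by (auto simp: decreasing_ball_def)
next
  fix g assume g: "g \<in> decreasing_ball \<sigma>"
  then have "(\<lambda>k. cmod (complex_of_real (g k))) = g" by (auto simp: decreasing_ball_def)
  then have "(\<lambda>k. complex_of_real (g k)) \<in> {f \<in> seq_space \<sigma>. seq_norm \<sigma> f \<le> 1}"
    using g by (auto simp: seq_space_def seq_norm_def decreasing_ball_def intro: le_less_trans)
  moreover have "g = rearrangement (\<lambda>k. complex_of_real (g k))"
    using g rearrangement_antimono_id by (auto simp: decreasing_ball_def fun_eq_iff)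
  ultimately show "g \<in> rearrangement ` {f \<in> seq_space \<sigma>. seq_norm \<sigma> f \<le> 1}" by blast
qed

lemma SUP_unit_ball:
  "(SUP f\<in>{f \<in> seq_space \<sigma>. seq_norm \<sigma> f \<le> 1}. \<sigma> (\<lambda>k. rearrangement f (\<pi> k))) = dilation_norm \<sigma> \<pi>"
  unfolding dilation_norm_def rearrangement_unit_ball[symmetric] image_image ..

lemma dilation_norm_hom:
  assumes g: "antimono g" "\<And>k. 0 \<le> g k" "\<sigma> g < \<infinity>"
  shows "\<sigma> (\<lambda>k. g (\<pi> k)) \<le> dilation_norm \<sigma> \<pi> * \<sigma> g"
proof (cases "\<sigma> g = 0")
  case True
  then have "\<forall>k. g k = 0" using bfn_zero_iff[OF bfn, of g] g by simp
  then have "\<sigma> (\<lambda>k. g (\<pi> k)) = 0" using bfn_zero_iff[OF bfn, of "\<lambda>k. g (\<pi> k)"] by simp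
  then show ?thesis by simp
next
  case False
  define t where "t = enn2real (\<sigma> g)"
  have t: "t > 0" "\<sigma> g = ennreal t"
    using False g(3) by (auto simp: t_def enn2real_positive_iff zero_less_iff_neq_zero less_top)
  have "\<sigma> (\<lambda>k. inverse t * g k) = ennreal (inverse t) * ennreal t"
    using bfn_scale[OF bfn, of g "inverse t"] g t by simp
  also have "\<dots> = 1" using t by (simp add: ennreal_mult[symmetric])
  finally have "(\<lambda>k. inverse t * g k) \<in> decreasing_ball \<sigma>"
    using g t by (auto simp: decreasing_ball_def antimono_def intro!: mult_left_mono)
  then have "\<sigma> (\<lambda>k. inverse t * g (\<pi> k)) \<le> dilation_norm \<sigma> \<pi>"
    unfolding dilation_norm_def by (rule SUP_upper)
  then have "ennreal t * \<sigma> (\<lambda>k. inverse t * g (\<pi> k)) \<le> ennreal t * dilation_norm \<sigma> \<pi>"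
    by (rule mult_left_mono) auto
  moreover have "\<sigma> (\<lambda>k. t * (inverse t * g (\<pi> k))) = ennreal t * \<sigma> (\<lambda>k. inverse t * g (\<pi> k))"
    using g t by (intro bfn_scale[OF bfn]) auto
  moreover have "(\<lambda>k. t * (inverse t * g (\<pi> k))) = (\<lambda>k. g (\<pi> k))" using t by auto
  ultimately show ?thesis using t by (simp add: mult.commute)
qed

text \<open>Monotonicity of \<pi> keeps the dilated sequence decreasing, so the homogeneous estimate
  for \<pi>' applies to it.\<close>

lemma dilation_norm_comp:
  assumes "mono \<pi>" "dilation_norm \<sigma> \<pi> < \<infinity>"
  shows "dilation_norm \<sigma> (\<lambda>k. \<pi> (\<pi>' k)) \<le> dilation_norm \<sigma> \<pi>' * dilation_norm \<sigma> \<pi>"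
  unfolding dilation_norm_def[of \<sigma> "\<lambda>k. \<pi> (\<pi>' k)"]
proof (rule SUP_least)
  fix g assume g: "g \<in> decreasing_ball \<sigma>"
  then have le: "\<sigma> (\<lambda>k. g (\<pi> k)) \<le> dilation_norm \<sigma> \<pi>"
    unfolding dilation_norm_def by (rule SUP_upper)
  have "\<sigma> (\<lambda>k. g (\<pi> (\<pi>' k))) \<le> dilation_norm \<sigma> \<pi>' * \<sigma> (\<lambda>k. g (\<pi> k))"
    using g assms le dilation_norm_hom[of "\<lambda>k. g (\<pi> k)" \<pi>']
    by (auto simp: decreasing_ball_def antimono_def mono_def intro: le_less_trans)
  also have "\<dots> \<le> dilation_norm \<sigma> \<pi>' * dilation_norm \<sigma> \<pi>" using le by (rule mult_left_mono) auto
  finally show "\<sigma> (\<lambda>k. g (\<pi> (\<pi>' k))) \<le> dilation_norm \<sigma> \<pi>' * dilation_norm \<sigma> \<pi>" .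
qed

lemma dilation_norm_antimono:
  assumes "\<And>k. \<pi> k \<le> \<pi>' k"
  shows "dilation_norm \<sigma> \<pi>' \<le> dilation_norm \<sigma> \<pi>"
  unfolding dilation_norm_def
proof (rule SUP_mono)
  fix g assume g: "g \<in> decreasing_ball \<sigma>"
  then have "\<sigma> (\<lambda>k. g (\<pi>' k)) \<le> \<sigma> (\<lambda>k. g (\<pi> k))"
    using assms by (intro bfn_mono[OF bfn]) (auto simp: decreasing_ball_def antimono_def)
  then show "\<exists>h\<in>decreasing_ball \<sigma>. \<sigma> (\<lambda>k. g (\<pi>' k)) \<le> \<sigma> (\<lambda>k. h (\<pi> k))" using g by blast
qed

lemma dilation_norm_id: "dilation_norm \<sigma> (\<lambda>k. k) = 1"
proof (rule antisym)
  show "dilation_norm \<sigma> (\<lambda>k. k) \<le> 1"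
    unfolding dilation_norm_def by (rule SUP_least) (auto simp: decreasing_ball_def)
  let ?g = "indicator {0::nat} :: nat \<Rightarrow> real"
  have g: "antimono ?g" "\<And>k. 0 \<le> ?g k" "\<sigma> ?g < \<infinity>"
    using bfn_indicator[OF bfn, of "{0}"] by (auto simp: antimono_def indicator_def)
  have nz: "\<sigma> ?g \<noteq> 0"
    using bfn_zero_iff[OF bfn, of ?g] by (auto simp: indicator_def split: if_splits)
  have "1 * \<sigma> ?g \<le> dilation_norm \<sigma> (\<lambda>k. k) * \<sigma> ?g" using dilation_norm_hom[OF g, of "\<lambda>k. k"] by simp
  then show "1 \<le> dilation_norm \<sigma> (\<lambda>k. k)"
    using nz g(3) ennreal_mult_le_mult_iff[of "\<sigma> ?g" 1 "dilation_norm \<sigma> (\<lambda>k. k)"]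
    by (simp add: mult.commute less_top)
qed

text \<open>Splitting by residues modulo j writes the dilated sequence as a sum of j spread-out
  copies of g, each with the distribution of g.\<close>

lemma dilation_norm_div_le:
  assumes j: "1 \<le> j"
  shows "dilation_norm \<sigma> (\<lambda>k. k div j) \<le> of_nat j"
  unfolding dilation_norm_def
proof (rule SUP_least)
  fix g assume g: "g \<in> decreasing_ball \<sigma>"
  define h where "h r k = (if k mod j = r then g (k div j) else 0)" for r k
  have h0: "0 \<le> h r k" for r k using g by (auto simp: h_def decreasing_ball_def)
  have eq: "g (k div j) = (\<Sum>r\<in>{..<j}. h r k)" for k
    using j by (simp add: h_def)
  have "\<sigma> (h r) = \<sigma> g" if r: "r < j" for r
  proof (rule ri_eq[OF ri h0])
    fix s :: real assume s: "0 \<le> s"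
    show "distribution_fun (h r) s = distribution_fun g s"
    proof (rule distribution_fun_bij_betw[symmetric])
      show "bij_betw (\<lambda>m. m * j + r) {k. s < norm (g k)} {k. s < norm (h r k)}"
        unfolding bij_betw_def
      proof (intro conjI equalityI subsetI)
        show "inj_on (\<lambda>m. m * j + r) {k. s < norm (g k)}" using j by (auto simp: inj_on_def)
        fix k assume "k \<in> (\<lambda>m. m * j + r) ` {k. s < norm (g k)}"
        then show "k \<in> {k. s < norm (h r k)}" using r by (auto simp: h_def)
      next
        fix k assume "k \<in> {k. s < norm (h r k)}"
        then have "k mod j = r" "s < norm (g (k div j))" using s by (auto simp: h_def split: if_splits)
        then show "k \<in> (\<lambda>m. m * j + r) ` {k. s < norm (g k)}"
          by (intro image_eqI[of _ _ "k div j"]) auto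
      qed
    qed
  qed (use g in \<open>auto simp: decreasing_ball_def\<close>)
  then have "(\<Sum>r\<in>{..<j}. \<sigma> (h r)) \<le> (\<Sum>r\<in>{..<j}. 1)"
    using g by (intro sum_mono) (auto simp: decreasing_ball_def)
  moreover have "\<sigma> (\<lambda>k. g (k div j)) \<le> (\<Sum>r\<in>{..<j}. \<sigma> (h r))"
    unfolding eq by (rule bfn_sum_le[OF bfn]) (auto simp: h0)
  ultimately show "\<sigma> (\<lambda>k. g (k div j)) \<le> of_nat j" by simp
qed

end

text \<open>E_j undoes F_j, because (j (k + 1) - 1) div j = k. Hence 1 \<le> H(j) K(j), the negative
  logarithm of H is at most the logarithm of K, and the limits compare.\<close>

theorem lower_boyd_index_le_upper:
  assumes "banach_function_norm \<rho>" "rearrangement_invariant \<rho>"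
  shows "lower_boyd_index \<rho> \<le> upper_boyd_index \<rho>"
proof -
  define \<sigma> where "\<sigma> = luxemburg_norm \<rho>"
  have \<sigma>: "banach_function_norm \<sigma>" "rearrangement_invariant \<sigma>"
    using luxemburg_rep_exists[OF assms] by (auto simp: luxemburg_rep_def \<sigma>_def)
  define K where "K j = dilation_norm \<sigma> (\<lambda>k. k div j)" for j
  define H where "H j = dilation_norm \<sigma> (\<lambda>k. j * (k + 1) - 1)" for j
  have K: "boyd_K \<rho> j = K j" and H: "boyd_H \<rho> j = H j" for j
    unfolding boyd_K_def boyd_H_def \<sigma>_def[symmetric] K_def H_def SUP_unit_ball[OF \<sigma>, symmetric]
    by (simp_all add: dilation_F_def[abs_def] dilation_E_def[abs_def])
  have K_fin: "K j < \<infinity>" if "1 \<le> j" for j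
    using dilation_norm_div_le[OF \<sigma> that] unfolding K_def by (rule le_less_trans) (simp add: of_nat_less_top)
  have K1: "K 1 = 1" and H1: "H 1 = 1"
    using dilation_norm_id[OF \<sigma>] by (simp_all add: K_def H_def)
  have K_mono: "K i \<le> K j" if "1 \<le> i" "i \<le> j" for i j
    unfolding K_def by (rule dilation_norm_antimono[OF \<sigma>]) (use that in \<open>auto intro: div_le_mono2\<close>)
  have H_mono: "H j \<le> H i" if "1 \<le> i" "i \<le> j" for i j
    unfolding H_def by (rule dilation_norm_antimono[OF \<sigma>]) (use that in \<open>auto intro!: diff_le_mono add_mono mult_right_mono\<close>)
  have H_fin: "H j < \<infinity>" if "1 \<le> j" for j
    using H_mono[of 1 j] that H1 by (auto intro: le_less_trans)
  have K_sub: "K (i * j) \<le> K i * K j" if ij: "1 \<le> i" "1 \<le> j" for i j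
  proof -
    have "(\<lambda>k. k div (i * j)) = (\<lambda>k. (k div i) div j)" by (simp add: div_mult2_eq)
    then show ?thesis
      unfolding K_def using dilation_norm_comp[OF \<sigma>, of "\<lambda>k. k div j" "\<lambda>k. k div i"] K_fin[OF ij(2)]
      by (simp add: K_def mono_def div_le_mono)
  qed
  have H_sub: "H (i * j) \<le> H i * H j" if ij: "1 \<le> i" "1 \<le> j" for i j
  proof -
    \<comment> \<open>The index shift is compatible with composition: adding 1 turns each map into a
      multiplication.\<close>
    have eq: "(\<lambda>k. i * j * (k + 1) - 1) = (\<lambda>k. j * ((i * (k + 1) - 1) + 1) - 1)"
      using ij by (auto simp: fun_eq_iff algebra_simps)
    have "mono (\<lambda>k. j * (k + 1) - 1)" by (intro monoI diff_le_mono mult_left_mono add_right_mono) auto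
    then show ?thesis
      unfolding H_def eq using H_fin[OF ij(2)] unfolding H_def by (rule dilation_norm_comp[OF \<sigma>])
  qed
  have HK: "1 \<le> H j * K j" if j: "1 \<le> j" for j
  proof -
    have "(j * (k + 1) - 1) div j = k" for k
    proof -
      have "j * (k + 1) - 1 = (j - 1) + k * j" using j by (simp add: algebra_simps)
      then show ?thesis using j by (simp only: div_mult_self1) simp
    qed
    then have "dilation_norm \<sigma> (\<lambda>k. (j * (k + 1) - 1) div j) = 1" using dilation_norm_id[OF \<sigma>] by simp
    then show ?thesis
      using dilation_norm_comp[OF \<sigma>, of "\<lambda>k. k div j" "\<lambda>k. j * (k + 1) - 1"] K_fin[OF j]
      by (simp add: H_def K_def mono_def div_le_mono)
  qed
  define k where "k j = enn2real (K j)" for j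
  define h where "h j = enn2real (H j)" for j
  have Kk: "K j = ennreal (k j)" and Hh: "H j = ennreal (h j)" if "1 \<le> j" for j
    using K_fin[OF that] H_fin[OF that] by (auto simp: k_def h_def less_top)
  have k0: "0 \<le> k j" and h0: "0 \<le> h j" for j by (auto simp: k_def h_def)
  have k1: "1 \<le> k j" if "1 \<le> j" for j
    using K_mono[of 1 j] that k0 unfolding K1 Kk[OF that] by (simp add: ennreal_1[symmetric] del: ennreal_1)
  have k_le: "k j \<le> real j" if "1 \<le> j" for j
    using dilation_norm_div_le[OF \<sigma> that] unfolding K_def[symmetric] Kk[OF that]
    by (simp add: ennreal_of_nat_eq_real_of_nat)
  have hk: "1 \<le> h j * k j" if "1 \<le> j" for j
    using HK[OF that] k0 h0 unfolding Kk[OF that] Hh[OF that]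
    by (simp add: ennreal_mult[symmetric] ennreal_1[symmetric] del: ennreal_1)
  have hpos: "0 < h j" if "1 \<le> j" for j
    using hk[OF that] h0[of j] by (cases "h j = 0") auto
  have h1: "h j \<le> 1" if "1 \<le> j" for j
    using H_mono[of 1 j] that h0 unfolding H1 Hh[OF that] by (simp add: ennreal_1[symmetric] del: ennreal_1)
  have k_mono: "k i \<le> k j" if "1 \<le> i" "i \<le> j" for i j
    using K_mono[OF that] that k0 by (simp add: Kk)
  have h_mono: "h j \<le> h i" if "1 \<le> i" "i \<le> j" for i j
    using H_mono[OF that] that h0 by (simp add: Hh)
  have k_sub: "k (i * j) \<le> k i * k j" if "1 \<le> i" "1 \<le> j" for i j
    using K_sub[OF that] that k0 by (simp add: Kk ennreal_mult[symmetric])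
  have h_sub: "h (i * j) \<le> h i * h j" if "1 \<le> i" "1 \<le> j" for i j
    using H_sub[OF that] that h0 by (simp add: Hh ennreal_mult[symmetric])
  have ln_hk: "- ln (h j) \<le> ln (k j)" if "1 \<le> j" for j
  proof -
    have "0 \<le> ln (h j * k j)" using hk[OF that] by simp
    then show ?thesis using hpos[OF that] k1[OF that] by (simp add: ln_mult)
  qed
  have "convergent (\<lambda>j. ln (k j) / ln (real j))"
  proof (rule submultiplicative_limit)
    fix i j :: nat assume ij: "1 \<le> i" "1 \<le> j"
    have pos: "k i > 0" "k j > 0" "k (i * j) > 0" using k1 ij by (force intro: less_le_trans[of 0 1])+
    have "ln (k (i * j)) \<le> ln (k i * k j)" using k_sub[OF ij] pos(3) by (intro ln_mono) auto
    then show "ln (k (i * j)) \<le> ln (k i) + ln (k j)" using pos by (simp add: ln_mult)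
  next
    fix i j :: nat assume "1 \<le> i" "i \<le> j"
    then show "ln (k i) \<le> ln (k j)" using k1[of i] k_mono[of i j] by (intro ln_mono) auto
  qed (use k1 in auto)
  then have K_lim: "(\<lambda>j. ln (k j) / ln (real j)) \<longlonglongrightarrow> upper_boyd_index \<rho>"
    unfolding upper_boyd_index_def K k_def[symmetric] convergent_LIMSEQ_iff .
  have "convergent (\<lambda>j. - ln (h j) / ln (real j))"
  proof (rule supermultiplicative_limit)
    fix i j :: nat assume ij: "1 \<le> i" "1 \<le> j"
    have pos: "h i > 0" "h j > 0" "h (i * j) > 0" using hpos ij by auto
    then have "ln (h (i * j)) \<le> ln (h i * h j)"
      using h_sub[OF ij] by (intro ln_mono) auto
    then show "- ln (h i) + - ln (h j) \<le> - ln (h (i * j))"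
      using pos by (simp add: ln_mult)
  next
    fix i j :: nat assume "1 \<le> i" "i \<le> j"
    then show "- ln (h i) \<le> - ln (h j)" using hpos[of j] h_mono[of i j] by (simp add: ln_mono)
  next
    fix j :: nat assume j: "1 \<le> j"
    show "0 \<le> - ln (h j)" using hpos[OF j] h1[OF j] by simp
    have "ln (k j) \<le> ln (real j)" using k1[OF j] k_le[OF j] by (intro ln_mono) auto
    then show "- ln (h j) \<le> ln (real j)" using ln_hk[OF j] by simp
  qed
  then have H_lim: "(\<lambda>j. - ln (h j) / ln (real j)) \<longlonglongrightarrow> lower_boyd_index \<rho>"
    unfolding lower_boyd_index_def H h_def[symmetric] convergent_LIMSEQ_iff .
  show ?thesis
  proof (rule LIMSEQ_le[OF H_lim K_lim], intro exI[of _ 1] allI impI)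
    fix j :: nat assume "1 \<le> j"
    then show "- ln (h j) / ln (real j) \<le> ln (k j) / ln (real j)"
      using ln_hk by (intro divide_right_mono) auto
  qed
qed

subsection \<open>Weights\<close>

text \<open>The Muckenhoupt condition is tested on the two-point interval {k, k + 1}: the first sum
  is bounded below by w (k + 1), the second by 1 / w k, and the factor 2 is the length of the
  interval.\<close>

lemma muckenhoupt_doubling:
  assumes w: "w \<in> muckenhoupt p" and p: "1 < p"
  shows "\<exists>C\<ge>0. \<forall>k. w (k + 1) \<le> C * w k"
proof -
  define q where "q = p / (p - 1)"
  have q: "q > 0" using p by (simp add: q_def)
  have pos: "0 < w k" for k using w by (simp add: muckenhoupt_def)
  obtain M where M: "\<And>l n. l \<le> n \<Longrightarrow> 1 / real (card {l..n}) *
          (\<Sum>k=l..n. w k powr p) powr (1 / p) * (\<Sum>k=l..n. w k powr (- q)) powr (1 / q) \<le> M"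
    using w unfolding muckenhoupt_def Let_def q_def[symmetric] bdd_above_def by blast
  have "w (k + 1) / w k \<le> 2 * M" for k
  proof -
    have set: "{k..k + 1} = {k, k + 1}" by auto
    have "w (k + 1) = (w (k + 1) powr p) powr (1 / p)"
      using pos[of "k + 1"] p by (simp add: powr_powr)
    also have "\<dots> \<le> (w k powr p + w (k + 1) powr p) powr (1 / p)"
      using p by (intro powr_mono2) auto
    finally have 1: "w (k + 1) \<le> (w k powr p + w (k + 1) powr p) powr (1 / p)" .
    have "1 / w k = (w k powr (- q)) powr (1 / q)"
    proof -
      have "(w k powr (- q)) powr (1 / q) = w k powr (- 1)" using q by (simp only: powr_powr) simp
      then show ?thesis using pos[of k] by (simp add: powr_minus_divide)
    qed
    also have "\<dots> \<le> (w k powr (- q) + w (k + 1) powr (- q)) powr (1 / q)"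
      using q by (intro powr_mono2) auto
    finally have 2: "1 / w k \<le> (w k powr (- q) + w (k + 1) powr (- q)) powr (1 / q)" .
    have "w (k + 1) * (1 / w k) \<le> (w k powr p + w (k + 1) powr p) powr (1 / p) * (w k powr (- q) + w (k + 1) powr (- q)) powr (1 / q)"
      using 1 2 pos[of k] pos[of "k + 1"] by (intro mult_mono) auto
    also have "\<dots> \<le> 2 * M"
      using M[of k "k + 1"] by (simp add: set)
    finally show ?thesis by simp
  qed
  note ratio = this
  have "w (k + 1) \<le> \<bar>2 * M\<bar> * w k" for k
  proof -
    have "w (k + 1) \<le> 2 * M * w k" using ratio[of k] pos[of k] by (simp add: pos_divide_le_eq)
    also have "\<dots> \<le> \<bar>2 * M\<bar> * w k" using pos[of k] by (intro mult_right_mono) auto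
    finally show ?thesis .
  qed
  then show ?thesis by (intro exI[of _ "\<bar>2 * M\<bar>"]) auto
qed

lemma weighted_bfn:
  assumes \<rho>: "banach_function_norm \<rho>" and w: "\<And>k. 0 < w k"
  shows "banach_function_norm (weighted \<rho> w)"
  unfolding banach_function_norm_def
proof (intro conjI allI impI)
  fix f :: "'a \<Rightarrow> real" assume "\<forall>k. 0 \<le> f k"
  moreover have "w k \<noteq> 0" for k using w[of k] by simp
  ultimately show "(weighted \<rho> w f = 0) = (\<forall>k. f k = 0)"
    unfolding weighted_def using bfn_zero_iff[OF \<rho>, of "\<lambda>k. f k * w k"] w by (simp add: less_imp_le)
next
  fix f :: "'a \<Rightarrow> real" and c :: real assume "\<forall>k. 0 \<le> f k" "0 \<le> c"
  then show "weighted \<rho> w (\<lambda>k. c * f k) = ennreal c * weighted \<rho> w f"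
    unfolding weighted_def mult.assoc using w by (intro bfn_scale[OF \<rho>]) (auto simp: less_imp_le)
next
  fix f g :: "'a \<Rightarrow> real" assume "\<forall>k. 0 \<le> f k" "\<forall>k. 0 \<le> g k"
  then show "weighted \<rho> w (\<lambda>k. f k + g k) \<le> weighted \<rho> w f + weighted \<rho> w g"
    unfolding weighted_def distrib_right using w by (intro bfn_add[OF \<rho>]) (auto simp: less_imp_le)
next
  fix f g :: "'a \<Rightarrow> real" assume "\<forall>k. 0 \<le> g k \<and> g k \<le> f k"
  then show "weighted \<rho> w g \<le> weighted \<rho> w f"
    unfolding weighted_def using w by (intro bfn_mono[OF \<rho>]) (auto simp: less_imp_le intro!: mult_right_mono)
next
  fix F :: "nat \<Rightarrow> 'a \<Rightarrow> real" and f
  assume F: "\<forall>n k. 0 \<le> F n k" "\<forall>k. incseq (\<lambda>n. F n k)" "\<forall>k. (\<lambda>n. F n k) \<longlonglongrightarrow> f k"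
  show "incseq (\<lambda>n. weighted \<rho> w (F n))"
    unfolding weighted_def using F w by (intro monoI bfn_mono[OF \<rho>]) (auto simp: incseq_def less_imp_le intro!: mult_right_mono)
  show "(\<lambda>n. weighted \<rho> w (F n)) \<longlonglongrightarrow> weighted \<rho> w f"
    unfolding weighted_def
    by (rule bfn_Fatou[OF \<rho>]) (use F w in \<open>auto simp: incseq_def less_imp_le intro!: mult_right_mono tendsto_mult\<close>)
next
  fix E :: "'a set" assume E: "finite E"
  show "weighted \<rho> w (indicator E) < \<infinity>"
    unfolding weighted_def
    by (rule bfn_finite_supp[OF \<rho>]) (use E w in \<open>auto simp: less_imp_le indicator_def intro: finite_subset[OF _ E]\<close>)
next
  fix E :: "'a set" assume E: "finite E"
  obtain C where C: "C > 0" "\<And>f. (\<And>k. 0 \<le> f k) \<Longrightarrow> ennreal (\<Sum>k\<in>E. f k) \<le> ennreal C * \<rho> f"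
    using bfn_sum_bound[OF \<rho> E] by auto
  \<comment> \<open>W dominates each 1 / w k on E; the summand 1 keeps it positive when E is
    empty.\<close>
  define W where "W = 1 + (\<Sum>k\<in>E. 1 / w k)"
  have W: "W > 0" unfolding W_def using w by (auto intro!: add_pos_nonneg sum_nonneg simp: less_imp_le)
  have "ennreal (\<Sum>k\<in>E. f k) \<le> ennreal (W * C) * weighted \<rho> w f" if f: "\<forall>k. 0 \<le> f k" for f
  proof -
    have "f k \<le> W * (f k * w k)" if "k \<in> E" for k
    proof -
      have "1 / w k \<le> (\<Sum>k\<in>E. 1 / w k)" using E that w by (intro member_le_sum) (auto simp: less_imp_le)
      then have "1 \<le> W * w k" using w[of k] by (simp add: W_def field_simps)
      then have "f k * 1 \<le> f k * (W * w k)" using f by (intro mult_left_mono) auto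
      then show ?thesis by (simp add: mult_ac)
    qed
    then have "(\<Sum>k\<in>E. f k) \<le> W * (\<Sum>k\<in>E. f k * w k)" by (simp add: sum_distrib_left sum_mono)
    then have "ennreal (\<Sum>k\<in>E. f k) \<le> ennreal W * ennreal (\<Sum>k\<in>E. f k * w k)"
      using W f w by (simp add: ennreal_mult[symmetric] sum_nonneg less_imp_le)
    also have "\<dots> \<le> ennreal W * (ennreal C * weighted \<rho> w f)"
      unfolding weighted_def using f w by (intro mult_left_mono C(2)) (auto simp: less_imp_le)
    finally show ?thesis using W C(1) by (simp add: ennreal_mult mult.assoc)
  qed
  then show "\<exists>C>0. \<forall>f. (\<forall>k. 0 \<le> f k) \<longrightarrow> ennreal (\<Sum>k\<in>E. f k) \<le> ennreal C * weighted \<rho> w f"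
    using W C(1) by (intro exI[of _ "W * C"]) auto
qed

lemma weighted_sequence_norm:
  assumes \<rho>: "banach_function_norm \<rho>" "rearrangement_invariant \<rho>"
    and w: "w \<in> muckenhoupt_sym p" "1 < p"
  shows "sequence_norm (weighted \<rho> w)"
proof
  have pos: "0 < w k" and sym: "w (- k) = w k" for k
    using w by (auto simp: muckenhoupt_sym_def muckenhoupt_def)
  show "banach_function_norm (weighted \<rho> w)" using weighted_bfn[OF \<rho>(1)] pos by blast
  show "weighted \<rho> w (\<lambda>k. f (- k)) = weighted \<rho> w f" if "\<And>k. 0 \<le> f k" for f
    unfolding weighted_def using ri_bij[OF \<rho>(2), of "\<lambda>k. f k * w k" uminus] that pos
    by (simp add: sym less_imp_le bij_uminus)
  obtain C where C: "C \<ge> 0" "\<And>k. w (k + 1) \<le> C * w k"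
    using muckenhoupt_doubling[of w p] w by (auto simp: muckenhoupt_sym_def)
  have "weighted \<rho> w (\<lambda>k. f (k - 1)) \<le> ennreal C * weighted \<rho> w f" if f: "\<forall>k. 0 \<le> f k" for f
  proof -
    \<comment> \<open>Invariance moves the shift from f to the weight, where the doubling estimate
      applies.\<close>
    have "bij (\<lambda>k::int. k - 1)" by (rule bij_betwI[of _ _ _ "\<lambda>k. k + 1"]) auto
    then have "weighted \<rho> w (\<lambda>k. f (k - 1)) = \<rho> (\<lambda>k. f k * w (k + 1))"
      unfolding weighted_def using ri_bij[OF \<rho>(2), of "\<lambda>k. f k * w (k + 1)" "\<lambda>k. k - 1"] f pos by (simp add: less_imp_le)
    also have "\<dots> \<le> \<rho> (\<lambda>k. C * (f k * w k))"
    proof (rule bfn_mono[OF \<rho>(1)])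
      fix k
      show "0 \<le> f k * w (k + 1)" using f pos by (simp add: less_imp_le)
      have "f k * w (k + 1) \<le> f k * (C * w k)" using f C(2) by (intro mult_left_mono) auto
      then show "f k * w (k + 1) \<le> C * (f k * w k)" by (simp add: mult_ac)
    qed
    also have "\<dots> = ennreal C * weighted \<rho> w f"
      unfolding weighted_def using f pos C by (intro bfn_scale[OF \<rho>(1)]) (auto simp: less_imp_le)
    finally show ?thesis .
  qed
  then show "\<exists>C\<ge>0. \<forall>f. (\<forall>k. 0 \<le> f k) \<longrightarrow> weighted \<rho> w (\<lambda>k. f (k - 1)) \<le> ennreal C * weighted \<rho> w f"
    using C(1) by blast
qed

subsection \<open>The algebra of multipliers\<close>

lemma distributions_scale:
  assumes a: "a \<in> periodic_distributions"
  shows "(\<lambda>u. z * a u) \<in> periodic_distributions"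
proof -
  have "continuous_on UNIV ((*) z)" by (intro continuous_intros)
  then have "continuous_map euclidean euclidean ((*) z)" by simp
  then have "continuous_map periodic_smooth_topology euclidean (\<lambda>u. z * a u)"
    using continuous_map_compose[OF distribution_continuous[OF a], of euclidean "(*) z"] by (simp add: o_def)
  then show ?thesis
    unfolding periodic_distributions_def
    by (simp add: distribution_add[OF a] distribution_scale[OF a] distribution_outside[OF a] distrib_left mult.left_commute)
qed

lemma distributions_add:
  assumes a: "a \<in> periodic_distributions" and b: "b \<in> periodic_distributions"
  shows "a + b \<in> periodic_distributions"
proof -
  have "continuous_map periodic_smooth_topology euclidean (\<lambda>u. a u + b u)"
    by (intro continuous_map_add distribution_continuous a b)
  then show ?thesis
    unfolding periodic_distributions_def plus_fun_def
    by (simp add: distribution_add[OF a] distribution_scale[OF a] distribution_outside[OF a]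
        distribution_add[OF b] distribution_scale[OF b] distribution_outside[OF b] distrib_left)
qed

lemma distributions_zero: "0 \<in> periodic_distributions"
  by (simp add: periodic_distributions_def zero_fun_def)

lemma fourier_coeff_add: "fourier_coeff (a + b) = fourier_coeff a + fourier_coeff b"
  by (simp add: fourier_coeff_def fun_eq_iff)

lemma fourier_coeff_diff: "fourier_coeff (a - b) = fourier_coeff a - fourier_coeff b"
  by (simp add: fourier_coeff_def fun_eq_iff)

lemma fourier_coeff_scale: "fourier_coeff (\<lambda>u. z * a u) = (\<lambda>n. z * fourier_coeff a n)"
  by (simp add: fourier_coeff_def fun_eq_iff)

lemma distr_conv_eq: "distr_conv a = conv (fourier_coeff a)"
  by (simp add: distr_conv_def conv_def fun_eq_iff)

lemma trig_polys_eq: "trig_polys = {trig_eval c | c. finsupp c}"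
proof (intro equalityI subsetI)
  fix u assume "u \<in> trig_polys"
  then obtain n and c :: "int \<Rightarrow> complex" where u: "u = (\<lambda>\<theta>. \<Sum>k = - int n..int n. c k * cis (of_int k * \<theta>))"
    by (auto simp: trig_polys_def)
  define d where "d k = (if k \<in> {- int n..int n} then c k else 0)" for k
  have "finsupp d" by (rule finite_subset[of _ "{- int n..int n}"]) (auto simp: d_def)
  moreover have "u = trig_eval d"
    unfolding u by (rule ext, subst trig_eval_eq_sum[of "{- int n..int n}"]) (auto simp: d_def intro!: sum.cong)
  ultimately show "u \<in> {trig_eval c | c. finsupp c}" by blast
next
  fix u assume "u \<in> {trig_eval c | c. finsupp c}"
  then obtain c where c: "u = trig_eval c" "finsupp c" by blast
  define n where "n = (\<Sum>k | c k \<noteq> 0. nat \<bar>k\<bar>)"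
  have "{k. c k \<noteq> 0} \<subseteq> {- int n..int n}"
  proof
    fix k assume "k \<in> {k. c k \<noteq> 0}"
    then have "nat \<bar>k\<bar> \<le> n" unfolding n_def using c(2) by (intro member_le_sum) auto
    then show "k \<in> {- int n..int n}" by auto
  qed
  then have "u = (\<lambda>\<theta>. \<Sum>k = - int n..int n. c k * cis (of_int k * \<theta>))"
    unfolding c(1) by (intro ext trig_eval_eq_sum) auto
  then show "u \<in> trig_polys" unfolding trig_polys_def by blast
qed

context sequence_norm
begin

text \<open>Norms of nonzero finitely supported sequences are positive and finite, so the quotient
  can be cleared; \<phi> = 0, absent from the supremum, satisfies the product form
  trivially.\<close>

lemma multiplier_norm_le_iff:
  assumes "0 \<le> A"
  shows "multiplier_norm \<tau> a \<le> ennreal A \<longleftrightarrow> conv_bounded A (fourier_coeff a)"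
proof -
  have "multiplier_norm \<tau> a \<le> ennreal A \<longleftrightarrow>
      (\<forall>\<phi>. finsupp \<phi> \<and> \<phi> \<noteq> 0 \<longrightarrow> seq_norm \<tau> (conv (fourier_coeff a) \<phi>) / seq_norm \<tau> \<phi> \<le> ennreal A)"
    by (auto simp: multiplier_norm_def SUP_le_iff fin_supp_seqs_def distr_conv_eq)
  also have "\<dots> \<longleftrightarrow> (\<forall>\<phi>. finsupp \<phi> \<and> \<phi> \<noteq> 0 \<longrightarrow> seq_norm \<tau> (conv (fourier_coeff a) \<phi>) \<le> ennreal A * seq_norm \<tau> \<phi>)"
  proof (intro iff_allI imp_cong refl)
    fix \<phi> :: "int \<Rightarrow> complex" assume \<phi>: "finsupp \<phi> \<and> \<phi> \<noteq> 0"
    then have "seq_norm \<tau> \<phi> \<noteq> 0" "seq_norm \<tau> \<phi> < \<infinity>" using seq_norm_eq_0 seq_norm_finite by auto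
    then obtain r where r: "seq_norm \<tau> \<phi> = ennreal r" "r > 0"
      by (cases "seq_norm \<tau> \<phi>") (auto simp: less_le)
    show "(seq_norm \<tau> (conv (fourier_coeff a) \<phi>) / seq_norm \<tau> \<phi> \<le> ennreal A) =
        (seq_norm \<tau> (conv (fourier_coeff a) \<phi>) \<le> ennreal A * seq_norm \<tau> \<phi>)"
    proof (cases "seq_norm \<tau> (conv (fourier_coeff a) \<phi>)")
      case (real s)
      then show ?thesis using r assms by (simp add: divide_ennreal ennreal_mult[symmetric] pos_divide_le_eq)
    next
      case top
      then show ?thesis using r assms by (simp add: ennreal_top_divide ennreal_mult[symmetric] top_unique)
    qed
  qed
  also have "\<dots> \<longleftrightarrow> conv_bounded A (fourier_coeff a)"
  proof -
    have "conv c 0 = 0" for c by (simp add: conv_def fun_eq_iff)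
    then have "seq_norm \<tau> (conv (fourier_coeff a) 0) \<le> ennreal A * seq_norm \<tau> 0"
      using seq_norm_eq_0[of 0] by simp
    then show ?thesis unfolding conv_bounded_def using assms by metis
  qed
  finally show ?thesis .
qed

lemma multipliers_iff:
  "a \<in> multipliers \<tau> \<longleftrightarrow> a \<in> periodic_distributions \<and> fourier_coeff a \<in> bounded_convolvers"
proof (intro iffI conjI)
  assume a: "a \<in> multipliers \<tau>"
  then show "a \<in> periodic_distributions" by (simp add: multipliers_def)
  have "multiplier_norm \<tau> a < \<infinity>" using a by (simp add: multipliers_def)
  then have "multiplier_norm \<tau> a \<le> ennreal (enn2real (multiplier_norm \<tau> a))" by (simp add: less_top)
  then show "fourier_coeff a \<in> bounded_convolvers"
    unfolding bounded_convolvers_def using multiplier_norm_le_iff[OF enn2real_nonneg] by blast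
next
  assume a: "a \<in> periodic_distributions \<and> fourier_coeff a \<in> bounded_convolvers"
  then obtain A where A: "conv_bounded A (fourier_coeff a)" by (auto simp: bounded_convolvers_def)
  have "multiplier_norm \<tau> a \<le> ennreal A" using multiplier_norm_le_iff A conv_bounded_nonneg by blast
  then have "multiplier_norm \<tau> a < \<infinity>" by (auto intro: le_less_trans)
  moreover have "distr_conv a \<phi> \<in> seq_space \<tau>" if "\<phi> \<in> fin_supp_seqs" for \<phi>
  proof -
    have \<phi>: "finsupp \<phi>" using that by (simp add: fin_supp_seqs_def)
    then have "seq_norm \<tau> (conv (fourier_coeff a) \<phi>) \<le> ennreal A * seq_norm \<tau> \<phi>"
      using A by (simp add: conv_bounded_def)
    also have "\<dots> < \<infinity>" using seq_norm_finite[OF \<phi>] by (simp add: ennreal_mult_less_top)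
    finally show ?thesis by (simp add: seq_space_def distr_conv_eq)
  qed
  ultimately show "a \<in> multipliers \<tau>" using a by (simp add: multipliers_def)
qed

lemma multiplier_closure_iff:
  "a \<in> multiplier_closure \<tau> S \<longleftrightarrow> a \<in> multipliers \<tau> \<and>
     (\<forall>\<epsilon>>0. \<exists>b\<in>S. conv_bounded \<epsilon> (fourier_coeff a - fourier_coeff b))"
proof -
  have "(\<forall>\<epsilon>>0. \<exists>b\<in>S. multiplier_norm \<tau> (a - b) < ennreal \<epsilon>) \<longleftrightarrow>
      (\<forall>\<epsilon>>0. \<exists>b\<in>S. conv_bounded \<epsilon> (fourier_coeff a - fourier_coeff b))" (is "?L \<longleftrightarrow> ?R")
  proof
    assume ?L
    then show ?R
      unfolding fourier_coeff_diff[symmetric] by (metis multiplier_norm_le_iff less_imp_le)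
  next
    assume R: ?R
    show ?L
    proof (intro allI impI)
      fix \<epsilon> :: real assume \<epsilon>: "\<epsilon> > 0"
      then obtain b where b: "b \<in> S" "conv_bounded (\<epsilon> / 2) (fourier_coeff a - fourier_coeff b)"
        using R half_gt_zero by blast
      then have "multiplier_norm \<tau> (a - b) \<le> ennreal (\<epsilon> / 2)"
        using \<epsilon> by (subst multiplier_norm_le_iff) (auto simp: fourier_coeff_diff)
      also have "\<dots> < ennreal \<epsilon>" using \<epsilon> by (simp add: ennreal_lessI)
      finally show "\<exists>b\<in>S. multiplier_norm \<tau> (a - b) < ennreal \<epsilon>" using b(1) by blast
    qed
  qed
  then show ?thesis by (simp add: multiplier_closure_def)
qed

text \<open>The passage from multipliers to coefficients is thereby onto, so a decomposition found
  among sequences can be carried back to multipliers.\<close>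

lemma bounded_convolver_symbol:
  assumes "c \<in> bounded_convolvers"
  shows "\<exists>f\<in>periodic_Linf. distr_of f \<in> multipliers \<tau> \<and> fourier_coeff (distr_of f) = c"
proof -
  obtain f where f: "f \<in> periodic_Linf" "fourier_coeff (distr_of f) = c"
    using conv_bounded_symbol_exists assms by (auto simp: bounded_convolvers_def)
  obtain C where "f \<in> borel_measurable circle_measure" "AE t in circle_measure. cmod (f t) \<le> C"
    using periodic_Linf_circle[OF f(1)] .
  then have "distr_of f \<in> periodic_distributions" by (rule distr_of_distribution)
  then show ?thesis using f assms by (auto simp: multipliers_iff)
qed

text \<open>Existence of a bounded symbol and uniqueness of distributions make the choice in
  \<open>symbol_fun\<close> meaningful.\<close>

lemma symbol_fun_multiplier:
  assumes "a \<in> multipliers \<tau>"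
  shows "symbol_fun a \<in> periodic_Linf \<and> distr_of (symbol_fun a) = a"
proof -
  have a: "a \<in> periodic_distributions" "fourier_coeff a \<in> bounded_convolvers"
    using assms by (auto simp: multipliers_iff)
  obtain f where f: "f \<in> periodic_Linf" "distr_of f \<in> multipliers \<tau>" "fourier_coeff (distr_of f) = fourier_coeff a"
    using bounded_convolver_symbol[OF a(2)] by blast
  have "distr_of f = a"
    using f a by (intro distribution_eqI) (auto simp: multipliers_iff)
  then show ?thesis
    unfolding symbol_fun_def using f(1) by (intro someI[of "\<lambda>f. f \<in> periodic_Linf \<and> distr_of f = a"]) simp
qed

lemma distr_mult_conv_limit:
  assumes a: "a \<in> multipliers \<tau>" and b: "b \<in> multipliers \<tau>"
  shows "distr_mult a b \<in> periodic_distributions"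
    and "is_conv_limit (fourier_coeff a) (fourier_coeff b) (fourier_coeff (distr_mult a b))"
proof -
  let ?f = "symbol_fun a" and ?g = "symbol_fun b"
  have f: "?f \<in> periodic_Linf" "distr_of ?f = a" and g: "?g \<in> periodic_Linf" "distr_of ?g = b"
    using symbol_fun_multiplier a b by auto
  obtain B where "conv_bounded B (fourier_coeff b)" using b by (auto simp: multipliers_iff bounded_convolvers_def)
  from symbol_product[OF f(1) this g(1)]
  show "is_conv_limit (fourier_coeff a) (fourier_coeff b) (fourier_coeff (distr_mult a b))"
    by (simp add: f g distr_mult_def)
  obtain F where F: "?f \<in> borel_measurable circle_measure" "AE t in circle_measure. cmod (?f t) \<le> F"
    using periodic_Linf_circle[OF f(1)] .
  obtain G where G: "?g \<in> borel_measurable circle_measure" "AE t in circle_measure. cmod (?g t) \<le> G"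
    using periodic_Linf_circle[OF g(1)] .
  show "distr_mult a b \<in> periodic_distributions"
    unfolding distr_mult_def
  proof (rule distr_of_distribution)
    show "AE t in circle_measure. cmod (?f t * ?g t) \<le> \<bar>F\<bar> * G"
      using F(2) G(2) by eventually_elim (auto simp: norm_mult intro!: mult_mono)
  qed (use F G in auto)
qed

lemma conv_limit_exists:
  assumes "c \<in> bounded_convolvers" "d \<in> bounded_convolvers"
  shows "\<exists>e. is_conv_limit c d e"
  using bounded_convolver_symbol[OF assms(1)] bounded_convolver_symbol[OF assms(2)] distr_mult_conv_limit(2)
  by metis

lemma C_multipliers_iff:
  "a \<in> C_multipliers \<tau> \<longleftrightarrow> a \<in> multipliers \<tau> \<and> fourier_coeff a \<in> poly_limits"
proof -
  have "(\<exists>b\<in>distr_of ` trig_polys. conv_bounded \<epsilon> (fourier_coeff a - fourier_coeff b)) \<longleftrightarrow>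
      (\<exists>q. finsupp q \<and> conv_bounded \<epsilon> (fourier_coeff a - q))" for \<epsilon>
  proof -
    have "fourier_coeff (distr_of (trig_eval q)) = q" if "finsupp q" for q
      using fourier_coeff_trig_eval[OF that] by auto
    then show ?thesis unfolding trig_polys_eq by force
  qed
  then show ?thesis
    by (auto simp: C_multipliers_def multiplier_closure_iff poly_limits_def multipliers_iff)
qed

text \<open>In the converse direction both parts of the coefficient decomposition are realised by
  symbols, and the equality of distributions is checked on coefficients.\<close>

lemma sum_multipliers_iff:
  assumes H: "\<And>b. b \<in> H \<longleftrightarrow> b \<in> multipliers \<tau> \<and> (\<forall>n\<in>I. fourier_coeff b n = 0)"
  shows "a \<in> C_multipliers \<tau> + H \<longleftrightarrow> a \<in> multipliers \<tau> \<and> fourier_coeff a \<in> approx_vanishing I"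
proof
  assume "a \<in> C_multipliers \<tau> + H"
  then obtain b h where bh: "a = b + h" "b \<in> C_multipliers \<tau>" "h \<in> H" by (auto elim: set_plus_elim)
  have "fourier_coeff a \<in> approx_vanishing I"
    unfolding approx_vanishing_iff
  proof (intro exI conjI)
    show "fourier_coeff a = fourier_coeff b + fourier_coeff h" by (simp only: bh(1) fourier_coeff_add)
    show "fourier_coeff b \<in> poly_limits" using bh(2) by (simp add: C_multipliers_iff)
    show "fourier_coeff h \<in> bounded_convolvers" "\<forall>n\<in>I. fourier_coeff h n = 0"
      using bh(3) by (simp_all add: H multipliers_iff)
  qed
  moreover have "b \<in> periodic_distributions" "h \<in> periodic_distributions"
    using bh(2,3) by (simp_all add: C_multipliers_iff H multipliers_iff)
  then have "a \<in> periodic_distributions" unfolding bh(1) by (rule distributions_add)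
  ultimately show "a \<in> multipliers \<tau> \<and> fourier_coeff a \<in> approx_vanishing I"
    by (auto simp: multipliers_iff approx_vanishing_def)
next
  assume a: "a \<in> multipliers \<tau> \<and> fourier_coeff a \<in> approx_vanishing I"
  then obtain y h where yh: "fourier_coeff a = y + h" "y \<in> poly_limits" "h \<in> bounded_convolvers" "\<forall>n\<in>I. h n = 0"
    unfolding approx_vanishing_iff by blast
  obtain f where f: "distr_of f \<in> multipliers \<tau>" "fourier_coeff (distr_of f) = y"
    using bounded_convolver_symbol[of y] yh(2) by (auto simp: poly_limits_def)
  obtain g where g: "distr_of g \<in> multipliers \<tau>" "fourier_coeff (distr_of g) = h"
    using bounded_convolver_symbol[OF yh(3)] by auto
  have "a = distr_of f + distr_of g"
  proof (rule distribution_eqI)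
    show "distr_of f + distr_of g \<in> periodic_distributions"
      using f(1) g(1) by (intro distributions_add) (simp_all add: multipliers_iff)
    show "fourier_coeff a = fourier_coeff (distr_of f + distr_of g)"
      by (simp only: fourier_coeff_add f(2) g(2) yh(1))
  qed (use a in \<open>simp add: multipliers_iff\<close>)
  moreover have "distr_of f \<in> C_multipliers \<tau>" "distr_of g \<in> H"
    using f g yh by (auto simp: C_multipliers_iff H)
  ultimately show "a \<in> C_multipliers \<tau> + H" by (auto intro: set_plus_intro)
qed

lemma closed_subalgebra_sum:
  assumes s: "s = 1 \<or> s = - 1" and I: "I = {n. s * n < 0}"
    and H: "\<And>b. b \<in> H \<longleftrightarrow> b \<in> multipliers \<tau> \<and> (\<forall>n\<in>I. fourier_coeff b n = 0)"
  shows "closed_subalgebra \<tau> (C_multipliers \<tau> + H)"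
  unfolding closed_subalgebra_def
proof (intro conjI allI ballI subsetI)
  note iff = sum_multipliers_iff[OF H]
  show "a \<in> multipliers \<tau>" if "a \<in> C_multipliers \<tau> + H" for a using that iff by blast
  have zero: "0 \<in> bounded_convolvers" using conv_bounded_zero by (auto simp: bounded_convolvers_def)
  have "0 \<in> almost_vanishing I" using zero by (simp add: almost_vanishing_def)
  then have "0 \<in> approx_vanishing I"
    using zero conv_bounded_mono[OF conv_bounded_zero] by (auto simp: approx_vanishing_def intro!: bexI[of _ 0])
  moreover have "fourier_coeff 0 = 0" by (simp add: fourier_coeff_def fun_eq_iff)
  ultimately show "0 \<in> C_multipliers \<tau> + H"
    using zero distributions_zero by (simp add: iff multipliers_iff)
  show "a + b \<in> C_multipliers \<tau> + H" if "a \<in> C_multipliers \<tau> + H" "b \<in> C_multipliers \<tau> + H" for a b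
    using that approx_vanishing_add distributions_add bounded_convolvers_add
    unfolding iff multipliers_iff fourier_coeff_add by blast
  show "(\<lambda>u. z * a u) \<in> C_multipliers \<tau> + H" if "a \<in> C_multipliers \<tau> + H" for z a
    using that approx_vanishing_scale distributions_scale bounded_convolvers_scale
    unfolding iff multipliers_iff fourier_coeff_scale by blast
  show "distr_mult a b \<in> C_multipliers \<tau> + H" if ab: "a \<in> C_multipliers \<tau> + H" "b \<in> C_multipliers \<tau> + H" for a b
  proof -
    have m: "a \<in> multipliers \<tau>" "b \<in> multipliers \<tau>"
      and v: "fourier_coeff a \<in> approx_vanishing I" "fourier_coeff b \<in> approx_vanishing I"
      using ab by (simp_all add: iff)
    have "fourier_coeff (distr_mult a b) \<in> approx_vanishing I"
      by (rule approx_vanishing_conv_limit[OF s I v distr_mult_conv_limit(2)[OF m] conv_limit_exists])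
    then show ?thesis
      using distr_mult_conv_limit(1)[OF m] by (auto simp: iff multipliers_iff approx_vanishing_def)
  qed
  show "a \<in> C_multipliers \<tau> + H" if "a \<in> multiplier_closure \<tau> (C_multipliers \<tau> + H)" for a
  proof -
    have a: "a \<in> multipliers \<tau>" "\<And>\<epsilon>. \<epsilon> > 0 \<Longrightarrow> \<exists>b\<in>C_multipliers \<tau> + H. conv_bounded \<epsilon> (fourier_coeff a - fourier_coeff b)"
      using that by (auto simp: multiplier_closure_iff)
    have "fourier_coeff a \<in> approx_vanishing I"
    proof (rule approx_vanishing_closed)
      show "fourier_coeff a \<in> bounded_convolvers" using a(1) by (simp add: multipliers_iff)
      show "\<exists>d\<in>approx_vanishing I. conv_bounded \<epsilon> (fourier_coeff a - d)" if "\<epsilon> > 0" for \<epsilon>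
        using a(2)[OF that] iff by blast
    qed
    then show ?thesis using a(1) iff by blast
  qed
qed

end

theorem theorem1p3:
  fixes \<rho> :: "(int \<Rightarrow> real) \<Rightarrow> ennreal" and w :: "int \<Rightarrow> real"
  assumes "banach_function_norm \<rho>"
    and "rearrangement_invariant \<rho>"
    and "reflexive_norm \<rho>"
    and "0 < lower_boyd_index \<rho>"
    and "upper_boyd_index \<rho> < 1"
    and "w \<in> muckenhoupt_sym (1 / lower_boyd_index \<rho>) \<inter> muckenhoupt_sym (1 / upper_boyd_index \<rho>)"
  shows "closed_subalgebra (weighted \<rho> w)
           (C_multipliers (weighted \<rho> w) + Hinf_plus (weighted \<rho> w)) \<and>
         closed_subalgebra (weighted \<rho> w)
           (C_multipliers (weighted \<rho> w) + Hinf_minus (weighted \<rho> w))"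
proof -
  have "1 < 1 / upper_boyd_index \<rho>"
    using lower_boyd_index_le_upper[OF assms(1,2)] assms(4,5) by simp
  then interpret sequence_norm "weighted \<rho> w"
    using weighted_sequence_norm[OF assms(1,2)] assms(6) by blast
  show ?thesis
  proof
    show "closed_subalgebra (weighted \<rho> w) (C_multipliers (weighted \<rho> w) + Hinf_plus (weighted \<rho> w))"
      by (rule closed_subalgebra_sum[of 1]) (auto simp: Hinf_plus_def)
    show "closed_subalgebra (weighted \<rho> w) (C_multipliers (weighted \<rho> w) + Hinf_minus (weighted \<rho> w))"
    proof (rule closed_subalgebra_sum[of "- 1"])
      have "(\<forall>n<0. fourier_coeff b (- n) = 0) \<longleftrightarrow> (\<forall>n>0. fourier_coeff b n = 0)" for b
        by (metis add.inverse_inverse neg_0_less_iff_less neg_less_0_iff_less)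
      then show "b \<in> Hinf_minus (weighted \<rho> w) \<longleftrightarrow>
          b \<in> multipliers (weighted \<rho> w) \<and> (\<forall>n\<in>{n. - 1 * n < 0}. fourier_coeff b n = 0)" for b
        by (simp add: Hinf_minus_def)
    qed auto
  qed
qed

end
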